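(* Let $P$ be a finite dimensional Poisson algebra over a field $k$. Then $(\mathcal{P}(P),\eta_P)$ is the initial object of the category $\mathrm{CoactBialg}_P$ of all commutative bialgebras coacting on $P$.
   Context: All vector spaces, algebras and tensor products are over an arbitrary field $k$. A Poisson algebra is a vector space $P$ which is both an associative commutative (not necessarily unital) algebra and a Lie algebra such that $[x, yz] = [x,y]z + y[x,z]$ for all $x,y,z$. Morphisms of Poisson algebras are linear maps that are both algebra and Lie algebra homomorphisms. If $A$ is a unital commutative associative algebra, $P\otimes A$ is a Poisson algebra with $(x\otimes a)(y\otimes b) = xy \otimes ab$, $[x \otimes a, y\otimes b] = [x,y]\otimes ab$. For a commutative bialgebra $H$, a right Poisson $H$-comodule algebra is a Poisson algebra $P$ with a Poisson algebra map $\rho_P\colon P\to P\otimes H$ that is also a right $H$-comodule structure on $P$; one says that $H$ coacts on $P$. $\mathrm{CoactBialg}_P$ is the category whose objects are pairs $(H,\rho_P)$ with $H$ a commutative bialgebra and $\rho_P\colon P\to P\otimes H$ a right Poisson $H$-comodule algebra structure on $P$; morphisms $(H,\rho_P)\to(H',\rho_P')$ are bialgebra maps $f\colon H\to H'$ with $(\mathrm{Id}_P\otimes f)\circ\rho_P=\rho_P'$. Let $\{e_1,\dots,e_n\}$ be a basis of $P$, with $e_ie_j=\sum_s\tau_{i,j}^se_s$ and $[e_i,e_j]=\sum_s\mu_{i,j}^se_s$. $\mathcal{P}(P)$ is the unital commutative algebra generated by $x_{si}$ ($s,i=1,\dots,n$) subject to the relations $\sum_{u=1}^n\tau_{i,j}^ux_{au}=\sum_{s,t=1}^n\tau_{s,t}^ax_{si}x_{tj}$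 and $\sum_{u=1}^n\mu_{i,j}^ux_{au}=\sum_{s,t=1}^n\mu_{s,t}^ax_{si}x_{tj}$ for all $a,i,j=1,\dots,n$. It is a bialgebra with $\Delta(x_{ij})=\sum_{s=1}^nx_{is}\otimes x_{sj}$ and $\varepsilon(x_{ij})=\delta_{i,j}$, and $\eta_P\colon P\to P\otimes\mathcal{P}(P)$, $\eta_P(e_i)=\sum_{s=1}^ne_s\otimes x_{si}$, is a Poisson algebra map and a right $\mathcal{P}(P)$-comodule structure on $P$. *)

theory Defs
  imports "HOL-Algebra.Module" "HOL-Algebra.QuotRing" "HOL-Library.Multiset"
begin

text \<open>
  Vector spaces over a field \<open>K\<close> are modules over \<open>K\<close> in the sense of the locale \<open>module\<close>,
  and unital commutative algebras are the locale \<open>algebra\<close>. The record type of modules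
  has fields \<open>mult\<close> and \<open>one\<close>; they carry no meaning for a plain vector space.
\<close>

section \<open>Linear maps, algebra maps, bases\<close>

definition linear_hom ::
  "('k, 'r) ring_scheme \<Rightarrow> ('k, 'v, 'm) module_scheme \<Rightarrow> ('k, 'w, 'l) module_scheme \<Rightarrow> ('v \<Rightarrow> 'w) set"
  where "linear_hom K V W = {f \<in> carrier V \<rightarrow> carrier W.
    (\<forall>x\<in>carrier V. \<forall>y\<in>carrier V. f (x \<oplus>\<^bsub>V\<^esub> y) = f x \<oplus>\<^bsub>W\<^esub> f y) \<and>
    (\<forall>a\<in>carrier K. \<forall>x\<in>carrier V. f (a \<odot>\<^bsub>V\<^esub> x) = a \<odot>\<^bsub>W\<^esub> f x)}"

definition alg_hom ::
  "('k, 'r) ring_scheme \<Rightarrow> ('k, 'v, 'm) module_scheme \<Rightarrow> ('k, 'w, 'l) module_scheme \<Rightarrow> ('v \<Rightarrow> 'w) set"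
  where "alg_hom K A B = ring_hom A B \<inter> linear_hom K A B"

definition scalars :: "('k, 'r) ring_scheme \<Rightarrow> ('k, 'k) module"
  where "scalars K = \<lparr>carrier = carrier K, monoid.mult = monoid.mult K, one = \<one>\<^bsub>K\<^esub>,
    zero = \<zero>\<^bsub>K\<^esub>, add = add K, smult = monoid.mult K\<rparr>"

definition lin_comb :: "('k, 'v, 'm) module_scheme \<Rightarrow> nat \<Rightarrow> (nat \<Rightarrow> 'v) \<Rightarrow> (nat \<Rightarrow> 'k) \<Rightarrow> 'v"
  where "lin_comb V n e c = (\<Oplus>\<^bsub>V\<^esub>i\<in>{1..n}. c i \<odot>\<^bsub>V\<^esub> e i)"

definition is_basis ::
  "('k, 'r) ring_scheme \<Rightarrow> ('k, 'v, 'm) module_scheme \<Rightarrow> nat \<Rightarrow> (nat \<Rightarrow> 'v) \<Rightarrow> bool"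
  where "is_basis K V n e \<longleftrightarrow>
    e \<in> {1..n} \<rightarrow> carrier V \<and>
    (\<forall>v\<in>carrier V. \<exists>c\<in>{1..n} \<rightarrow> carrier K. v = lin_comb V n e c) \<and>
    (\<forall>c\<in>{1..n} \<rightarrow> carrier K. lin_comb V n e c = \<zero>\<^bsub>V\<^esub> \<longrightarrow> (\<forall>i\<in>{1..n}. c i = \<zero>\<^bsub>K\<^esub>))"

definition coords ::
  "('k, 'r) ring_scheme \<Rightarrow> ('k, 'v, 'm) module_scheme \<Rightarrow> nat \<Rightarrow> (nat \<Rightarrow> 'v) \<Rightarrow> 'v \<Rightarrow> nat \<Rightarrow> 'k"
  where "coords K V n e v = (THE c. c \<in> {1..n} \<rightarrow>\<^sub>E carrier K \<and> v = lin_comb V n e c)"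


section \<open>Free modules and quotients\<close>

definition free_mod :: "('k, 'r) ring_scheme \<Rightarrow> 's set \<Rightarrow> ('k, 's \<Rightarrow> 'k) module"
  where "free_mod K S =
    \<lparr>carrier = {f. range f \<subseteq> carrier K \<and> finite {s. f s \<noteq> \<zero>\<^bsub>K\<^esub>} \<and> {s. f s \<noteq> \<zero>\<^bsub>K\<^esub>} \<subseteq> S},
     monoid.mult = undefined, one = undefined,
     zero = (\<lambda>_. \<zero>\<^bsub>K\<^esub>), add = (\<lambda>f g s. f s \<oplus>\<^bsub>K\<^esub> g s), smult = (\<lambda>a f s. a \<otimes>\<^bsub>K\<^esub> f s)\<rparr>"

definition delta :: "('k, 'r) ring_scheme \<Rightarrow> 's \<Rightarrow> 's \<Rightarrow> 'k"
  where "delta K s = (\<lambda>t. if t = s then \<one>\<^bsub>K\<^esub> else \<zero>\<^bsub>K\<^esub>)"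

text \<open>The linear extension of \<open>\<phi>\<close>, which is prescribed on the basis of all \<open>delta K s\<close>.\<close>

definition free_ext ::
  "('k, 'r) ring_scheme \<Rightarrow> ('k, 'u, 'm) module_scheme \<Rightarrow> ('s \<Rightarrow> 'u) \<Rightarrow> ('s \<Rightarrow> 'k) \<Rightarrow> 'u"
  where "free_ext K U \<phi> f = (\<Oplus>\<^bsub>U\<^esub>s\<in>{s. f s \<noteq> \<zero>\<^bsub>K\<^esub>}. f s \<odot>\<^bsub>U\<^esub> \<phi> s)"

text \<open>
  \<open>M Quot N\<close> with its scalar multiplication: the quotient vector space for a
  submodule \<open>N\<close>, and the quotient algebra if \<open>M\<close> is an algebra and \<open>N\<close> an ideal.
\<close>

definition quot_mod :: "('k, 'v, 'm) module_scheme \<Rightarrow> 'v set \<Rightarrow> ('k, 'v set) module"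
  where "quot_mod M N =
    ring.extend (M Quot N) (module.fields (\<lambda>a X. \<Union>x\<in>X. N +>\<^bsub>M\<^esub> (a \<odot>\<^bsub>M\<^esub> x)))"


section \<open>Tensor products\<close>

text \<open>
  The tensor product of \<open>V\<close> and \<open>W\<close> is the free module on \<open>V \<times> W\<close> modulo the
  submodule generated by the bilinearity relations.
\<close>

abbreviation pair_mod ::
  "('k, 'r) ring_scheme \<Rightarrow> ('k, 'v, 'm) module_scheme \<Rightarrow> ('k, 'w, 'l) module_scheme
    \<Rightarrow> ('k, 'v \<times> 'w \<Rightarrow> 'k) module"
  where "pair_mod K V W \<equiv> free_mod K (carrier V \<times> carrier W)"

definition bilin_rels ::
  "('k, 'r) ring_scheme \<Rightarrow> ('k, 'v, 'm) module_scheme \<Rightarrow> ('k, 'w, 'l) module_scheme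
    \<Rightarrow> ('v \<times> 'w \<Rightarrow> 'k) set"
  where "bilin_rels K V W = (let F = pair_mod K V W in
    {delta K (v \<oplus>\<^bsub>V\<^esub> v', w) \<ominus>\<^bsub>F\<^esub> (delta K (v, w) \<oplus>\<^bsub>F\<^esub> delta K (v', w)) |v v' w.
       v \<in> carrier V \<and> v' \<in> carrier V \<and> w \<in> carrier W} \<union>
    {delta K (v, w \<oplus>\<^bsub>W\<^esub> w') \<ominus>\<^bsub>F\<^esub> (delta K (v, w) \<oplus>\<^bsub>F\<^esub> delta K (v, w')) |v w w'.
       v \<in> carrier V \<and> w \<in> carrier W \<and> w' \<in> carrier W} \<union>
    {delta K (a \<odot>\<^bsub>V\<^esub> v, w) \<ominus>\<^bsub>F\<^esub> (a \<odot>\<^bsub>F\<^esub> delta K (v, w)) |a v w.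
       a \<in> carrier K \<and> v \<in> carrier V \<and> w \<in> carrier W} \<union>
    {delta K (v, a \<odot>\<^bsub>W\<^esub> w) \<ominus>\<^bsub>F\<^esub> (a \<odot>\<^bsub>F\<^esub> delta K (v, w)) |a v w.
       a \<in> carrier K \<and> v \<in> carrier V \<and> w \<in> carrier W})"

definition bilin_sub ::
  "('k, 'r) ring_scheme \<Rightarrow> ('k, 'v, 'm) module_scheme \<Rightarrow> ('k, 'w, 'l) module_scheme
    \<Rightarrow> ('v \<times> 'w \<Rightarrow> 'k) set"
  where "bilin_sub K V W =
    \<Inter>{N. submodule N K (pair_mod K V W) \<and> bilin_rels K V W \<subseteq> N}"

definition tensor_space ::
  "('k, 'r) ring_scheme \<Rightarrow> ('k, 'v, 'm) module_scheme \<Rightarrow> ('k, 'w, 'l) module_scheme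
    \<Rightarrow> ('k, ('v \<times> 'w \<Rightarrow> 'k) set) module"
  where "tensor_space K V W = quot_mod (pair_mod K V W) (bilin_sub K V W)"

definition tens ::
  "('k, 'r) ring_scheme \<Rightarrow> ('k, 'v, 'm) module_scheme \<Rightarrow> ('k, 'w, 'l) module_scheme
    \<Rightarrow> 'v \<Rightarrow> 'w \<Rightarrow> ('v \<times> 'w \<Rightarrow> 'k) set"
  where "tens K V W v w = bilin_sub K V W +>\<^bsub>pair_mod K V W\<^esub> delta K (v, w)"

text \<open>
  The linear map from a tensor product to \<open>U\<close> induced by a bilinear map \<open>\<beta>\<close>. For
  bilinear \<open>\<beta>\<close> the value does not depend on the representative chosen.
\<close>

definition tens_ext ::
  "('k, 'r) ring_scheme \<Rightarrow> ('k, 'u, 'm) module_scheme \<Rightarrow> ('v \<Rightarrow> 'w \<Rightarrow> 'u)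
    \<Rightarrow> ('v \<times> 'w \<Rightarrow> 'k) set \<Rightarrow> 'u"
  where "tens_ext K U \<beta> X = free_ext K U (\<lambda>(v, w). \<beta> v w) (SOME f. f \<in> X)"

text \<open>The bilinear operation \<open>(v \<otimes> w, v' \<otimes> w') \<mapsto> p v v' \<otimes> q w w'\<close>.\<close>

definition tens_op ::
  "('k, 'r) ring_scheme \<Rightarrow> ('k, 'v, 'm) module_scheme \<Rightarrow> ('k, 'w, 'l) module_scheme
    \<Rightarrow> ('v \<Rightarrow> 'v \<Rightarrow> 'v) \<Rightarrow> ('w \<Rightarrow> 'w \<Rightarrow> 'w)
    \<Rightarrow> ('v \<times> 'w \<Rightarrow> 'k) set \<Rightarrow> ('v \<times> 'w \<Rightarrow> 'k) set \<Rightarrow> ('v \<times> 'w \<Rightarrow> 'k) set"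
  where "tens_op K V W p q X Y =
    tens_ext K (tensor_space K V W)
      (\<lambda>v w. tens_ext K (tensor_space K V W) (\<lambda>v' w'. tens K V W (p v v') (q w w')) Y) X"

definition tensor ::
  "('k, 'r) ring_scheme \<Rightarrow> ('k, 'v, 'm) module_scheme \<Rightarrow> ('k, 'w, 'l) module_scheme
    \<Rightarrow> ('k, ('v \<times> 'w \<Rightarrow> 'k) set) module"
  where "tensor K A B = (tensor_space K A B)
    \<lparr>monoid.mult := tens_op K A B (monoid.mult A) (monoid.mult B), one := tens K A B \<one>\<^bsub>A\<^esub> \<one>\<^bsub>B\<^esub>\<rparr>"

text \<open>\<open>f \<otimes> g\<close> as a map with values in \<open>tensor K V' W'\<close>.\<close>

definition tensor_map ::
  "('k, 'r) ring_scheme \<Rightarrow> ('k, 'v1, 'm) module_scheme \<Rightarrow> ('k, 'w1, 'l) module_scheme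
    \<Rightarrow> ('v \<Rightarrow> 'v1) \<Rightarrow> ('w \<Rightarrow> 'w1) \<Rightarrow> ('v \<times> 'w \<Rightarrow> 'k) set \<Rightarrow> ('v1 \<times> 'w1 \<Rightarrow> 'k) set"
  where "tensor_map K V' W' f g =
    tens_ext K (tensor K V' W') (\<lambda>v w. tens K V' W' (f v) (g w))"

text \<open>The associator \<open>(u \<otimes> v) \<otimes> w \<mapsto> u \<otimes> (v \<otimes> w)\<close>.\<close>

definition tensor_assoc ::
  "('k, 'r) ring_scheme \<Rightarrow> ('k, 'u, 'm) module_scheme \<Rightarrow> ('k, 'v, 'l) module_scheme
    \<Rightarrow> ('k, 'w, 'h) module_scheme
    \<Rightarrow> (('u \<times> 'v \<Rightarrow> 'k) set \<times> 'w \<Rightarrow> 'k) set \<Rightarrow> ('u \<times> ('v \<times> 'w \<Rightarrow> 'k) set \<Rightarrow> 'k) set"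
  where "tensor_assoc K U V W =
    (let T = tensor K U (tensor K V W) in
     tens_ext K T (\<lambda>X w. tens_ext K T (\<lambda>u v. tens K U (tensor K V W) u (tens K V W v w)) X))"


section \<open>Poisson algebras\<close>

record ('k, 'p) poisson = "('k, 'p) module" +
  lie :: "['p, 'p] \<Rightarrow> 'p"

text \<open>The associative product need not be unital, so the field \<open>one\<close> of \<open>P\<close> is unconstrained.\<close>

locale poisson_algebra = module K P for K and P (structure) +
  assumes mult_closed: "\<lbrakk>x \<in> carrier P; y \<in> carrier P\<rbrakk> \<Longrightarrow> x \<otimes>\<^bsub>P\<^esub> y \<in> carrier P"
    and mult_add: "\<lbrakk>x \<in> carrier P; y \<in> carrier P; z \<in> carrier P\<rbrakk>
      \<Longrightarrow> (x \<oplus>\<^bsub>P\<^esub> y) \<otimes>\<^bsub>P\<^esub> z = (x \<otimes>\<^bsub>P\<^esub> z) \<oplus>\<^bsub>P\<^esub> (y \<otimes>\<^bsub>P\<^esub> z)"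
    and mult_smult: "\<lbrakk>a \<in> carrier K; x \<in> carrier P; y \<in> carrier P\<rbrakk>
      \<Longrightarrow> (a \<odot>\<^bsub>P\<^esub> x) \<otimes>\<^bsub>P\<^esub> y = a \<odot>\<^bsub>P\<^esub> (x \<otimes>\<^bsub>P\<^esub> y)"
    and mult_commute: "\<lbrakk>x \<in> carrier P; y \<in> carrier P\<rbrakk> \<Longrightarrow> x \<otimes>\<^bsub>P\<^esub> y = y \<otimes>\<^bsub>P\<^esub> x"
    and mult_assoc: "\<lbrakk>x \<in> carrier P; y \<in> carrier P; z \<in> carrier P\<rbrakk>
      \<Longrightarrow> (x \<otimes>\<^bsub>P\<^esub> y) \<otimes>\<^bsub>P\<^esub> z = x \<otimes>\<^bsub>P\<^esub> (y \<otimes>\<^bsub>P\<^esub> z)"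
    and lie_closed: "\<lbrakk>x \<in> carrier P; y \<in> carrier P\<rbrakk> \<Longrightarrow> lie P x y \<in> carrier P"
    and lie_add_left: "\<lbrakk>x \<in> carrier P; y \<in> carrier P; z \<in> carrier P\<rbrakk>
      \<Longrightarrow> lie P (x \<oplus>\<^bsub>P\<^esub> y) z = lie P x z \<oplus>\<^bsub>P\<^esub> lie P y z"
    and lie_add_right: "\<lbrakk>x \<in> carrier P; y \<in> carrier P; z \<in> carrier P\<rbrakk>
      \<Longrightarrow> lie P x (y \<oplus>\<^bsub>P\<^esub> z) = lie P x y \<oplus>\<^bsub>P\<^esub> lie P x z"
    and lie_smult_left: "\<lbrakk>a \<in> carrier K; x \<in> carrier P; y \<in> carrier P\<rbrakk>
      \<Longrightarrow> lie P (a \<odot>\<^bsub>P\<^esub> x) y = a \<odot>\<^bsub>P\<^esub> lie P x y"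
    and lie_smult_right: "\<lbrakk>a \<in> carrier K; x \<in> carrier P; y \<in> carrier P\<rbrakk>
      \<Longrightarrow> lie P x (a \<odot>\<^bsub>P\<^esub> y) = a \<odot>\<^bsub>P\<^esub> lie P x y"
    and lie_self: "x \<in> carrier P \<Longrightarrow> lie P x x = \<zero>\<^bsub>P\<^esub>"
    and jacobi: "\<lbrakk>x \<in> carrier P; y \<in> carrier P; z \<in> carrier P\<rbrakk>
      \<Longrightarrow> lie P x (lie P y z) \<oplus>\<^bsub>P\<^esub> lie P y (lie P z x) \<oplus>\<^bsub>P\<^esub> lie P z (lie P x y) = \<zero>\<^bsub>P\<^esub>"
    and leibniz: "\<lbrakk>x \<in> carrier P; y \<in> carrier P; z \<in> carrier P\<rbrakk>
      \<Longrightarrow> lie P x (y \<otimes>\<^bsub>P\<^esub> z) = (lie P x y \<otimes>\<^bsub>P\<^esub> z) \<oplus>\<^bsub>P\<^esub> (y \<otimes>\<^bsub>P\<^esub> lie P x z)"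

definition poisson_hom ::
  "('k, 'r) ring_scheme \<Rightarrow> ('k, 'p, 'm) poisson_scheme \<Rightarrow> ('k, 'q, 'l) poisson_scheme \<Rightarrow> ('p \<Rightarrow> 'q) set"
  where "poisson_hom K P Q = {f \<in> linear_hom K P Q.
    \<forall>x\<in>carrier P. \<forall>y\<in>carrier P. f (x \<otimes>\<^bsub>P\<^esub> y) = f x \<otimes>\<^bsub>Q\<^esub> f y \<and> f (lie P x y) = lie Q (f x) (f y)}"

definition poisson_tensor ::
  "('k, 'r) ring_scheme \<Rightarrow> ('k, 'p, 'm) poisson_scheme \<Rightarrow> ('k, 'h, 'l) module_scheme
    \<Rightarrow> ('k, ('p \<times> 'h \<Rightarrow> 'k) set) poisson"
  where "poisson_tensor K P A =
    module.extend (tensor K P A) (poisson.fields (tens_op K P A (lie P) (monoid.mult A)))"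


section \<open>Commutative bialgebras and the category of coactions on \<open>P\<close>\<close>

record ('k, 'h) bialg = "('k, 'h) module" +
  comult :: "'h \<Rightarrow> ('h \<times> 'h \<Rightarrow> 'k) set"
  counit :: "'h \<Rightarrow> 'k"

locale comm_bialgebra = algebra K H for K and H (structure) +
  assumes comult_hom: "comult H \<in> alg_hom K H (tensor K H H)"
    and counit_hom: "counit H \<in> alg_hom K H (scalars K)"
    and coassoc: "h \<in> carrier H \<Longrightarrow>
      tensor_assoc K H H H (tensor_map K (tensor K H H) H (comult H) (\<lambda>x. x) (comult H h)) =
      tensor_map K H (tensor K H H) (\<lambda>x. x) (comult H) (comult H h)"
    and counit_left: "h \<in> carrier H \<Longrightarrow>
      tensor_map K (scalars K) H (counit H) (\<lambda>x. x) (comult H h) = tens K (scalars K) H \<one>\<^bsub>K\<^esub> h"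
    and counit_right: "h \<in> carrier H \<Longrightarrow>
      tensor_map K H (scalars K) (\<lambda>x. x) (counit H) (comult H h) = tens K H (scalars K) h \<one>\<^bsub>K\<^esub>"

definition right_comodule ::
  "('k, 'r) ring_scheme \<Rightarrow> ('k, 'h, 'l) bialg_scheme \<Rightarrow> ('k, 'v, 'm) module_scheme
    \<Rightarrow> ('v \<Rightarrow> ('v \<times> 'h \<Rightarrow> 'k) set) \<Rightarrow> bool"
  where "right_comodule K H V \<rho> \<longleftrightarrow> \<rho> \<in> linear_hom K V (tensor K V H) \<and>
    (\<forall>v\<in>carrier V.
      tensor_assoc K V H H (tensor_map K (tensor K V H) H \<rho> (\<lambda>x. x) (\<rho> v)) =
        tensor_map K V (tensor K H H) (\<lambda>x. x) (comult H) (\<rho> v) \<and>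
      tensor_map K V (scalars K) (\<lambda>x. x) (counit H) (\<rho> v) = tens K V (scalars K) v \<one>\<^bsub>K\<^esub>)"

definition coact_obj ::
  "('k, 'r) ring_scheme \<Rightarrow> ('k, 'p, 'm) poisson_scheme \<Rightarrow> ('k, 'h, 'l) bialg_scheme
    \<Rightarrow> ('p \<Rightarrow> ('p \<times> 'h \<Rightarrow> 'k) set) \<Rightarrow> bool"
  where "coact_obj K P H \<rho> \<longleftrightarrow>
    comm_bialgebra K H \<and> right_comodule K H P \<rho> \<and> \<rho> \<in> poisson_hom K P (poisson_tensor K P H)"

text \<open>
  A morphism is a map on the carrier of \<open>H\<close>; requiring it to be extensional makes
  equality of morphisms the equality of HOL functions.
\<close>

definition coact_hom ::
  "('k, 'r) ring_scheme \<Rightarrow> ('k, 'p, 'm) poisson_scheme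
    \<Rightarrow> ('k, 'h, 'l) bialg_scheme \<Rightarrow> ('p \<Rightarrow> ('p \<times> 'h \<Rightarrow> 'k) set)
    \<Rightarrow> ('k, 'h1, 'l1) bialg_scheme \<Rightarrow> ('p \<Rightarrow> ('p \<times> 'h1 \<Rightarrow> 'k) set) \<Rightarrow> ('h \<Rightarrow> 'h1) set"
  where "coact_hom K P H \<rho> H' \<rho>' = {f \<in> alg_hom K H H' \<inter> extensional (carrier H).
    (\<forall>h\<in>carrier H. comult H' (f h) = tensor_map K H' H' f f (comult H h) \<and>
                   counit H' (f h) = counit H h) \<and>
    (\<forall>p\<in>carrier P. tensor_map K P H' (\<lambda>x. x) f (\<rho> p) = \<rho>' p)}"


section \<open>The universal bialgebra of a Poisson algebra with a finite basis\<close>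

text \<open>
  Polynomials over \<open>K\<close> in the variables from \<open>I\<close>. A monomial is a multiset of variables,
  and the product is the bilinear extension of the product of monomials.
\<close>

definition mpoly_alg :: "('k, 'r) ring_scheme \<Rightarrow> 'i set \<Rightarrow> ('k, 'i multiset \<Rightarrow> 'k) module"
  where "mpoly_alg K I = (let F = free_mod K {m. set_mset m \<subseteq> I} in
    F\<lparr>monoid.mult := (\<lambda>f g. free_ext K F (\<lambda>m. free_ext K F (\<lambda>m'. delta K (m + m')) g) f),
      one := delta K {#}\<rparr>)"

text \<open>
  With \<open>c = coords K P n e\<close>, the scalars \<open>c (e i \<otimes> e j) s\<close> and \<open>c (lie P (e i) (e j)) s\<close> are
  the structure constants; \<open>univ_rels\<close> is applied to both products of \<open>P\<close>.
\<close>

definition univ_rels ::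
  "('k, 'r) ring_scheme \<Rightarrow> ('k, 'p, 'm) module_scheme \<Rightarrow> nat \<Rightarrow> (nat \<Rightarrow> 'p) \<Rightarrow> ('p \<Rightarrow> 'p \<Rightarrow> 'p)
    \<Rightarrow> ((nat \<times> nat) multiset \<Rightarrow> 'k) set"
  where "univ_rels K P n e b =
    (let A = mpoly_alg K ({1..n} \<times> {1..n});
         x = (\<lambda>s i. delta K {#(s, i)#});
         \<gamma> = (\<lambda>i j. coords K P n e (b (e i) (e j)))
     in {(\<Oplus>\<^bsub>A\<^esub>u\<in>{1..n}. \<gamma> i j u \<odot>\<^bsub>A\<^esub> x a u) \<ominus>\<^bsub>A\<^esub>
         (\<Oplus>\<^bsub>A\<^esub>s\<in>{1..n}. \<Oplus>\<^bsub>A\<^esub>t\<in>{1..n}. \<gamma> s t a \<odot>\<^bsub>A\<^esub> (x s i \<otimes>\<^bsub>A\<^esub> x t j)) |a i j.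
         a \<in> {1..n} \<and> i \<in> {1..n} \<and> j \<in> {1..n}})"

definition univ_ideal ::
  "('k, 'r) ring_scheme \<Rightarrow> ('k, 'p, 'm) poisson_scheme \<Rightarrow> nat \<Rightarrow> (nat \<Rightarrow> 'p)
    \<Rightarrow> ((nat \<times> nat) multiset \<Rightarrow> 'k) set"
  where "univ_ideal K P n e = genideal (mpoly_alg K ({1..n} \<times> {1..n}))
    (univ_rels K P n e (monoid.mult P) \<union> univ_rels K P n e (lie P))"

definition univ_alg ::
  "('k, 'r) ring_scheme \<Rightarrow> ('k, 'p, 'm) poisson_scheme \<Rightarrow> nat \<Rightarrow> (nat \<Rightarrow> 'p)
    \<Rightarrow> ('k, ((nat \<times> nat) multiset \<Rightarrow> 'k) set) module"
  where "univ_alg K P n e = quot_mod (mpoly_alg K ({1..n} \<times> {1..n})) (univ_ideal K P n e)"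

definition univ_gen ::
  "('k, 'r) ring_scheme \<Rightarrow> ('k, 'p, 'm) poisson_scheme \<Rightarrow> nat \<Rightarrow> (nat \<Rightarrow> 'p)
    \<Rightarrow> nat \<Rightarrow> nat \<Rightarrow> ((nat \<times> nat) multiset \<Rightarrow> 'k) set"
  where "univ_gen K P n e s i =
    univ_ideal K P n e +>\<^bsub>mpoly_alg K ({1..n} \<times> {1..n})\<^esub> delta K {#(s, i)#}"

definition univ_comult ::
  "('k, 'r) ring_scheme \<Rightarrow> ('k, 'p, 'm) poisson_scheme \<Rightarrow> nat \<Rightarrow> (nat \<Rightarrow> 'p)
    \<Rightarrow> ((nat \<times> nat) multiset \<Rightarrow> 'k) set
    \<Rightarrow> (((nat \<times> nat) multiset \<Rightarrow> 'k) set \<times> ((nat \<times> nat) multiset \<Rightarrow> 'k) set \<Rightarrow> 'k) set"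
  where "univ_comult K P n e =
    (let A = univ_alg K P n e; x = univ_gen K P n e; T = tensor K A A in
     THE f. f \<in> alg_hom K A T \<inter> extensional (carrier A) \<and>
       (\<forall>i\<in>{1..n}. \<forall>j\<in>{1..n}. f (x i j) = (\<Oplus>\<^bsub>T\<^esub>s\<in>{1..n}. tens K A A (x i s) (x s j))))"

definition univ_counit ::
  "('k, 'r) ring_scheme \<Rightarrow> ('k, 'p, 'm) poisson_scheme \<Rightarrow> nat \<Rightarrow> (nat \<Rightarrow> 'p)
    \<Rightarrow> ((nat \<times> nat) multiset \<Rightarrow> 'k) set \<Rightarrow> 'k"
  where "univ_counit K P n e =
    (let A = univ_alg K P n e; x = univ_gen K P n e in
     THE f. f \<in> alg_hom K A (scalars K) \<inter> extensional (carrier A) \<and>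
       (\<forall>i\<in>{1..n}. \<forall>j\<in>{1..n}. f (x i j) = (if i = j then \<one>\<^bsub>K\<^esub> else \<zero>\<^bsub>K\<^esub>)))"

definition univ_bialg ::
  "('k, 'r) ring_scheme \<Rightarrow> ('k, 'p, 'm) poisson_scheme \<Rightarrow> nat \<Rightarrow> (nat \<Rightarrow> 'p)
    \<Rightarrow> ('k, ((nat \<times> nat) multiset \<Rightarrow> 'k) set) bialg"
  where "univ_bialg K P n e = module.extend (univ_alg K P n e)
    (bialg.fields (univ_comult K P n e) (univ_counit K P n e))"

text \<open>The linear map with \<open>e i \<mapsto> (\<Sum>s. e s \<otimes> x s i)\<close>.\<close>

definition univ_coaction ::
  "('k, 'r) ring_scheme \<Rightarrow> ('k, 'p, 'm) poisson_scheme \<Rightarrow> nat \<Rightarrow> (nat \<Rightarrow> 'p)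
    \<Rightarrow> 'p \<Rightarrow> ('p \<times> ((nat \<times> nat) multiset \<Rightarrow> 'k) set \<Rightarrow> 'k) set"
  where "univ_coaction K P n e v =
    (let A = univ_alg K P n e; T = tensor K P A in
     lin_comb T n (\<lambda>i. \<Oplus>\<^bsub>T\<^esub>s\<in>{1..n}. tens K P A (e s) (univ_gen K P n e s i)) (coords K P n e v))"

end

theory Submission
  imports Defs
begin

text \<open>
  An algebra map from the universal algebra to \<open>B\<close> is a matrix over \<open>B\<close> that satisfies the defining
  relations, and these say precisely that the linear map \<open>e i \<mapsto> (\<Sum>s. e s \<otimes> h s i)\<close> from \<open>P\<close> to
  \<open>P \<otimes> B\<close> preserves both products of \<open>P\<close>. The matrices satisfying the relations are closed under
  products, which gives the comultiplication. Conversely a coaction of \<open>B\<close> on \<open>P\<close> is determined by its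
  matrix \<open>h\<close>, and the comodule axioms state that \<open>\<Delta> (h t i) = (\<Sum>s. h t s \<otimes> h s i)\<close> and
  \<open>\<epsilon> (h t i) = \<delta> t i\<close>. So the algebra map with \<open>x s i \<mapsto> h s i\<close> is a bialgebra map; it is unique
  since the coefficients of an element of \<open>P \<otimes> B\<close> on the basis \<open>e\<close> are unique.
\<close>

section \<open>Linear maps\<close>

text \<open>A tensor is a coset in a free module and has no normal form, and \<open>tens_ext\<close>
  evaluates an arbitrarily chosen representative. So every map out of a tensor product, including
  the product of a tensor algebra and the associator, must first be shown to come from a bilinear
  map. After that it is known on pure tensors, and identities are proved by making one tensor
  variable at a time pure. The finite basis identifies P \<otimes> B with B^n. This turns an
  equation between tensors into n equations in B and gives every coaction a matrix. The associative
  product and the bracket are handled by the same arguments, made for an arbitrary bilinear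
  \<open>b\<close> and its structure constants. In H \<otimes> H the two matrices to be multiplied
  are X \<otimes> 1 and 1 \<otimes> X, both images of the generic matrix under algebra maps. Since
  comultiplication and counit are definite descriptions, the universal property of the underlying
  algebra has to come before them, and maps are kept extensional so that agreement on generators
  becomes equality of functions.\<close>

lemma linear_homI:
  assumes "\<And>x. x \<in> carrier V \<Longrightarrow> f x \<in> carrier W"
    and "\<And>x y. \<lbrakk>x \<in> carrier V; y \<in> carrier V\<rbrakk> \<Longrightarrow> f (x \<oplus>\<^bsub>V\<^esub> y) = f x \<oplus>\<^bsub>W\<^esub> f y"
    and "\<And>a x. \<lbrakk>a \<in> carrier K; x \<in> carrier V\<rbrakk> \<Longrightarrow> f (a \<odot>\<^bsub>V\<^esub> x) = a \<odot>\<^bsub>W\<^esub> f x"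
  shows "f \<in> linear_hom K V W"
  using assms unfolding linear_hom_def by auto

lemma linear_hom_closed: "\<lbrakk>f \<in> linear_hom K V W; x \<in> carrier V\<rbrakk> \<Longrightarrow> f x \<in> carrier W"
  and linear_hom_add: "\<lbrakk>f \<in> linear_hom K V W; x \<in> carrier V; y \<in> carrier V\<rbrakk>
    \<Longrightarrow> f (x \<oplus>\<^bsub>V\<^esub> y) = f x \<oplus>\<^bsub>W\<^esub> f y"
  and linear_hom_smult: "\<lbrakk>f \<in> linear_hom K V W; a \<in> carrier K; x \<in> carrier V\<rbrakk>
    \<Longrightarrow> f (a \<odot>\<^bsub>V\<^esub> x) = a \<odot>\<^bsub>W\<^esub> f x"
  unfolding linear_hom_def by auto

lemma linear_hom_comp:
  "\<lbrakk>f \<in> linear_hom K U V; g \<in> linear_hom K V W\<rbrakk> \<Longrightarrow> (\<lambda>x. g (f x)) \<in> linear_hom K U W"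
  unfolding linear_hom_def by (auto simp: Pi_def)

lemma linear_hom_id: "(\<lambda>x. x) \<in> linear_hom K V V"
  unfolding linear_hom_def by auto

context
  fixes K (structure) and V and W and f
  assumes V: "module K V" and W: "module K W" and f: "f \<in> linear_hom K V W"
begin

interpretation V: module K V by (rule V)
interpretation W: module K W by (rule W)

lemma linear_hom_zero: "f \<zero>\<^bsub>V\<^esub> = \<zero>\<^bsub>W\<^esub>"
proof -
  have "f \<zero>\<^bsub>V\<^esub> = f (\<zero> \<odot>\<^bsub>V\<^esub> \<zero>\<^bsub>V\<^esub>)" by simp
  also have "\<dots> = \<zero> \<odot>\<^bsub>W\<^esub> f \<zero>\<^bsub>V\<^esub>" by (intro linear_hom_smult[OF f]) auto
  finally show ?thesis using linear_hom_closed[OF f] by simp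
qed

lemma linear_hom_uminus:
  assumes "x \<in> carrier V" shows "f (\<ominus>\<^bsub>V\<^esub> x) = \<ominus>\<^bsub>W\<^esub> f x"
proof -
  have "f (\<ominus>\<^bsub>V\<^esub> x) \<oplus>\<^bsub>W\<^esub> f x = f (\<ominus>\<^bsub>V\<^esub> x \<oplus>\<^bsub>V\<^esub> x)"
    using assms by (intro linear_hom_add[OF f, symmetric]) auto
  then show ?thesis using assms linear_hom_closed[OF f]
    by (simp add: V.M.l_neg linear_hom_zero W.M.minus_equality)
qed

lemma linear_hom_minus:
  "\<lbrakk>x \<in> carrier V; y \<in> carrier V\<rbrakk> \<Longrightarrow> f (x \<ominus>\<^bsub>V\<^esub> y) = f x \<ominus>\<^bsub>W\<^esub> f y"
  by (simp add: a_minus_def linear_hom_uminus linear_hom_add[OF f])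

lemma linear_hom_finsum:
  assumes "finite I" "g \<in> I \<rightarrow> carrier V"
  shows "f (\<Oplus>\<^bsub>V\<^esub>i\<in>I. g i) = (\<Oplus>\<^bsub>W\<^esub>i\<in>I. f (g i))"
  using assms
proof (induction rule: finite_induct)
  case empty
  then show ?case by (simp add: linear_hom_zero)
next
  case (insert i I)
  have "(\<lambda>i. f (g i)) \<in> I \<rightarrow> carrier W" "f (g i) \<in> carrier W"
    using insert linear_hom_closed[OF f] by (auto simp: Pi_def)
  then show ?case using insert by (simp add: linear_hom_add[OF f])
qed

lemma linear_hom_kernel: "submodule {x \<in> carrier V. f x = \<zero>\<^bsub>W\<^esub>} K V"
  by (rule V.submoduleI)
    (auto simp: linear_hom_zero linear_hom_uminus linear_hom_add[OF f] linear_hom_smult[OF f])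

end

text \<open>This is how agreement on a spanning family passes to the whole module. Free modules and
  tensor products both get their extensionality rule from it.\<close>

lemma linear_hom_equalizer:
  assumes V: "module K V" and W: "module K W"
    and f: "f \<in> linear_hom K V W" and g: "g \<in> linear_hom K V W"
  shows "submodule {x \<in> carrier V. f x = g x} K V"
proof -
  interpret V: module K V by fact
  show ?thesis
    by (rule V.submoduleI)
      (auto simp: linear_hom_zero[OF V W f] linear_hom_zero[OF V W g]
        linear_hom_uminus[OF V W f] linear_hom_uminus[OF V W g]
        linear_hom_add[OF f] linear_hom_add[OF g] linear_hom_smult[OF f] linear_hom_smult[OF g])
qed

lemma (in abelian_monoid) finsum_swap:
  assumes "finite I" "finite J" "\<And>i j. \<lbrakk>i \<in> I; j \<in> J\<rbrakk> \<Longrightarrow> f i j \<in> carrier G"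
  shows "(\<Oplus>i\<in>I. \<Oplus>j\<in>J. f i j) = (\<Oplus>j\<in>J. \<Oplus>i\<in>I. f i j)"
  using assms
proof (induction rule: finite_induct)
  case (insert i I)
  have "(\<Oplus>j\<in>J. \<Oplus>i\<in>insert i I. f i j) = (\<Oplus>j\<in>J. f i j \<oplus> (\<Oplus>i\<in>I. f i j))"
    using insert by (intro finsum_cong') (auto simp: Pi_def intro!: finsum_insert finsum_closed)
  also have "\<dots> = (\<Oplus>j\<in>J. f i j) \<oplus> (\<Oplus>j\<in>J. \<Oplus>i\<in>I. f i j)"
    using insert by (intro finsum_addf) (auto simp: Pi_def intro!: finsum_closed)
  finally show ?case using insert by (simp add: Pi_def)
qed simp

section \<open>Free modules\<close>

lemma free_mod_carrier: "f \<in> carrier (free_mod K S) \<longleftrightarrow>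
    (\<forall>s. f s \<in> carrier K) \<and> finite {s. f s \<noteq> \<zero>\<^bsub>K\<^esub>} \<and> {s. f s \<noteq> \<zero>\<^bsub>K\<^esub>} \<subseteq> S"
  by (auto simp: free_mod_def)

lemma free_mod_simps [simp]:
  "zero (free_mod K S) = (\<lambda>_. \<zero>\<^bsub>K\<^esub>)"
  "f \<oplus>\<^bsub>free_mod K S\<^esub> g = (\<lambda>s. f s \<oplus>\<^bsub>K\<^esub> g s)"
  "a \<odot>\<^bsub>free_mod K S\<^esub> f = (\<lambda>s. a \<otimes>\<^bsub>K\<^esub> f s)"
  by (simp_all add: free_mod_def)

context cring
begin

lemma free_mod_module: "module R (free_mod R S)"
proof (rule moduleI)
  show "abelian_group (free_mod R S)"
  proof (rule abelian_groupI)
    fix f g assume fg: "f \<in> carrier (free_mod R S)" "g \<in> carrier (free_mod R S)"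
    have sub: "{s. f s \<oplus> g s \<noteq> \<zero>} \<subseteq> {s. f s \<noteq> \<zero>} \<union> {s. g s \<noteq> \<zero>}" by auto
    moreover have "finite ({s. f s \<noteq> \<zero>} \<union> {s. g s \<noteq> \<zero>})" using fg by (simp add: free_mod_carrier)
    ultimately have "finite {s. f s \<oplus> g s \<noteq> \<zero>}" by (rule finite_subset)
    moreover have "{s. f s \<oplus> g s \<noteq> \<zero>} \<subseteq> S" using sub fg unfolding free_mod_carrier by blast
    ultimately show "f \<oplus>\<^bsub>free_mod R S\<^esub> g \<in> carrier (free_mod R S)"
      using fg by (simp add: free_mod_carrier)
  next
    fix f assume f: "f \<in> carrier (free_mod R S)"
    have sub: "{s. \<ominus> f s \<noteq> \<zero>} \<subseteq> {s. f s \<noteq> \<zero>}" by auto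
    moreover have "finite {s. f s \<noteq> \<zero>}" using f by (simp add: free_mod_carrier)
    ultimately have "finite {s. \<ominus> f s \<noteq> \<zero>}" by (rule finite_subset)
    moreover have "{s. \<ominus> f s \<noteq> \<zero>} \<subseteq> S" using sub f unfolding free_mod_carrier by blast
    ultimately have "(\<lambda>s. \<ominus> f s) \<in> carrier (free_mod R S)"
      using f by (simp add: free_mod_carrier)
    then show "\<exists>y\<in>carrier (free_mod R S). y \<oplus>\<^bsub>free_mod R S\<^esub> f = \<zero>\<^bsub>free_mod R S\<^esub>"
      using f by (intro bexI[of _ "\<lambda>s. \<ominus> f s"]) (simp_all add: free_mod_carrier l_neg)
  qed (auto simp: free_mod_carrier fun_eq_iff a_ac)
next
  fix a f assume f: "a \<in> carrier R" "f \<in> carrier (free_mod R S)"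
  have sub: "{s. a \<otimes> f s \<noteq> \<zero>} \<subseteq> {s. f s \<noteq> \<zero>}" using f by auto
  moreover have "finite {s. f s \<noteq> \<zero>}" using f by (simp add: free_mod_carrier)
  ultimately have "finite {s. a \<otimes> f s \<noteq> \<zero>}" by (rule finite_subset)
  moreover have "{s. a \<otimes> f s \<noteq> \<zero>} \<subseteq> S" using sub f unfolding free_mod_carrier by blast
  ultimately show "a \<odot>\<^bsub>free_mod R S\<^esub> f \<in> carrier (free_mod R S)"
    using f by (simp add: free_mod_carrier)
qed (auto simp: free_mod_carrier fun_eq_iff l_distr r_distr m_assoc is_cring)

lemma delta_closed: "s \<in> S \<Longrightarrow> delta R s \<in> carrier (free_mod R S)"
  by (auto simp: free_mod_carrier delta_def)

text \<open>Induction on the support: erasing one coefficient shrinks the support, and a multiple of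
  one \<open>delta\<close> restores it. Spanning is expressed through an arbitrary submodule
  \<open>N\<close> so that it applies to equalizers and to preimages.\<close>

lemma free_mod_span:
  assumes N: "submodule N R (free_mod R S)" and d: "\<And>s. s \<in> S \<Longrightarrow> delta R s \<in> N"
  shows "carrier (free_mod R S) \<subseteq> N"
proof -
  interpret F: module R "free_mod R S" by (rule free_mod_module)
  note NE = F.submoduleE[OF N]
  have *: "f \<in> N" if "finite T" "f \<in> carrier (free_mod R S)" "{s. f s \<noteq> \<zero>} = T" for T f
    using that
  proof (induction T arbitrary: f rule: finite_induct)
    case empty
    then have "f = \<zero>\<^bsub>free_mod R S\<^esub>" by auto
    moreover have "\<zero>\<^bsub>free_mod R S\<^esub> \<in> N"
      using subgroup.one_closed[OF submodule.axioms(1)[OF N]] by simp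
    ultimately show ?case by simp
  next
    case (insert s T)
    let ?g = "f(s := \<zero>)"
    have s: "s \<in> S" "f s \<in> carrier R" using insert by (auto simp: free_mod_carrier)
    have T: "{t. ?g t \<noteq> \<zero>} = T" using insert by auto
    moreover have "?g \<in> carrier (free_mod R S)" unfolding free_mod_carrier T
      using insert by (auto simp: free_mod_carrier)
    ultimately have "?g \<in> N" using insert.IH by blast
    then have "?g \<oplus>\<^bsub>free_mod R S\<^esub> (f s \<odot>\<^bsub>free_mod R S\<^esub> delta R s) \<in> N"
      using NE(4,5) d s by blast
    also have "?g \<oplus>\<^bsub>free_mod R S\<^esub> (f s \<odot>\<^bsub>free_mod R S\<^esub> delta R s) = f"
      using insert by (auto simp: fun_eq_iff delta_def free_mod_carrier)
    finally show ?case .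
  qed
  show ?thesis using * by (auto simp: free_mod_carrier)
qed

text \<open>\<open>free_ext\<close> sums over the support of \<open>f\<close>, which changes with
  \<open>f\<close>. Values at different elements become comparable only after padding the sums with
  zero terms to a common finite index set.\<close>

lemma free_ext_superset:
  assumes U: "module R U" and f: "f \<in> carrier (free_mod R S)" and phi: "\<phi> \<in> S \<rightarrow> carrier U"
    and T: "finite T" "{s. f s \<noteq> \<zero>} \<subseteq> T" "T \<subseteq> S"
  shows "free_ext R U \<phi> f = (\<Oplus>\<^bsub>U\<^esub>s\<in>T. f s \<odot>\<^bsub>U\<^esub> \<phi> s)"
proof -
  interpret U: module R U by fact
  have "\<phi> s \<in> carrier U" if "s \<in> T" for s using phi T that by auto
  then show ?thesis unfolding free_ext_def using f phi T
    by (intro U.M.add.finprod_mono_neutral_cong_left) (auto simp: free_mod_carrier)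
qed

lemma free_ext_linear:
  assumes U: "module R U" and phi: "\<phi> \<in> S \<rightarrow> carrier U"
  shows "free_ext R U \<phi> \<in> linear_hom R (free_mod R S) U"
proof -
  interpret U: module R U by fact
  interpret F: module R "free_mod R S" by (rule free_mod_module)
  show ?thesis
  proof (rule linear_homI)
    fix f assume f: "f \<in> carrier (free_mod R S)"
    then show "free_ext R U \<phi> f \<in> carrier U" using phi unfolding free_ext_def
      by (intro U.M.finsum_closed) (auto simp: free_mod_carrier)
  next
    fix f g assume f: "f \<in> carrier (free_mod R S)" "g \<in> carrier (free_mod R S)"
    \<comment> \<open>Cancellation can make the support of the sum smaller than this union, so the
      union serves as index set for all three extensions.\<close>
    let ?T = "{s. f s \<noteq> \<zero>} \<union> {s. g s \<noteq> \<zero>}"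
    have T: "finite ?T" "?T \<subseteq> S" using f by (auto simp: free_mod_carrier)
    have p: "\<phi> s \<in> carrier U" "f s \<in> carrier R" "g s \<in> carrier R" if "s \<in> ?T" for s
      using phi T that f by (auto simp: free_mod_carrier)
    have fg: "f \<oplus>\<^bsub>free_mod R S\<^esub> g \<in> carrier (free_mod R S)" using f by blast
    have "free_ext R U \<phi> (f \<oplus>\<^bsub>free_mod R S\<^esub> g)
        = (\<Oplus>\<^bsub>U\<^esub>s\<in>?T. (f \<oplus>\<^bsub>free_mod R S\<^esub> g) s \<odot>\<^bsub>U\<^esub> \<phi> s)"
      using T by (intro free_ext_superset[OF U fg phi]) auto
    also have "\<dots> = (\<Oplus>\<^bsub>U\<^esub>s\<in>?T. f s \<odot>\<^bsub>U\<^esub> \<phi> s \<oplus>\<^bsub>U\<^esub> g s \<odot>\<^bsub>U\<^esub> \<phi> s)"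
      using p by (intro U.M.finsum_cong') (auto simp: U.smult_l_distr)
    also have "\<dots> = (\<Oplus>\<^bsub>U\<^esub>s\<in>?T. f s \<odot>\<^bsub>U\<^esub> \<phi> s) \<oplus>\<^bsub>U\<^esub> (\<Oplus>\<^bsub>U\<^esub>s\<in>?T. g s \<odot>\<^bsub>U\<^esub> \<phi> s)"
      using p by (intro U.M.finsum_addf) auto
    also have "\<dots> = free_ext R U \<phi> f \<oplus>\<^bsub>U\<^esub> free_ext R U \<phi> g"
      using T free_ext_superset[OF U f(1) phi T(1)] free_ext_superset[OF U f(2) phi T(1)] by auto
    finally show "free_ext R U \<phi> (f \<oplus>\<^bsub>free_mod R S\<^esub> g) = free_ext R U \<phi> f \<oplus>\<^bsub>U\<^esub> free_ext R U \<phi> g" .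
  next
    fix a f assume f: "a \<in> carrier R" "f \<in> carrier (free_mod R S)"
    let ?T = "{s. f s \<noteq> \<zero>}"
    have T: "finite ?T" "?T \<subseteq> S" using f by (auto simp: free_mod_carrier)
    have p: "\<phi> s \<in> carrier U" "f s \<in> carrier R" if "s \<in> ?T" for s
      using phi T that f by (auto simp: free_mod_carrier)
    have af: "a \<odot>\<^bsub>free_mod R S\<^esub> f \<in> carrier (free_mod R S)" using f by blast
    have "free_ext R U \<phi> (a \<odot>\<^bsub>free_mod R S\<^esub> f) = (\<Oplus>\<^bsub>U\<^esub>s\<in>?T. (a \<odot>\<^bsub>free_mod R S\<^esub> f) s \<odot>\<^bsub>U\<^esub> \<phi> s)"
      using T f by (intro free_ext_superset[OF U af phi]) auto
    also have "\<dots> = (\<Oplus>\<^bsub>U\<^esub>s\<in>?T. a \<odot>\<^bsub>U\<^esub> (f s \<odot>\<^bsub>U\<^esub> \<phi> s))"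
      using p f(1) by (intro U.M.finsum_cong') (auto simp: U.smult_assoc1)
    also have "\<dots> = a \<odot>\<^bsub>U\<^esub> (\<Oplus>\<^bsub>U\<^esub>s\<in>?T. f s \<odot>\<^bsub>U\<^esub> \<phi> s)"
      using p f(1) T by (intro U.finsum_smult_ldistr[symmetric]) auto
    finally show "free_ext R U \<phi> (a \<odot>\<^bsub>free_mod R S\<^esub> f) = a \<odot>\<^bsub>U\<^esub> free_ext R U \<phi> f"
      by (simp add: free_ext_def)
  qed
qed

lemma free_ext_delta:
  assumes U: "module R U" and phi: "\<phi> s \<in> carrier U"
  shows "free_ext R U \<phi> (delta R s) = \<phi> s"
proof -
  interpret U: module R U by fact
  have "delta R s \<in> carrier (free_mod R {s})" by (rule delta_closed) simp
  then have "free_ext R U \<phi> (delta R s) = (\<Oplus>\<^bsub>U\<^esub>t\<in>{s}. delta R s t \<odot>\<^bsub>U\<^esub> \<phi> t)"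
    using phi by (intro free_ext_superset[OF U]) (auto simp: delta_def)
  then show ?thesis using phi by (simp add: delta_def)
qed

lemma free_mod_hom_eqI:
  assumes U: "module R U" and f: "f \<in> linear_hom R (free_mod R S) U" and g: "g \<in> linear_hom R (free_mod R S) U"
    and eq: "\<And>s. s \<in> S \<Longrightarrow> f (delta R s) = g (delta R s)" and x: "x \<in> carrier (free_mod R S)"
  shows "f x = g x"
proof -
  have "carrier (free_mod R S) \<subseteq> {x \<in> carrier (free_mod R S). f x = g x}"
    using eq by (intro free_mod_span[OF linear_hom_equalizer[OF free_mod_module U f g]])
      (simp add: delta_closed)
  then show ?thesis using x by blast
qed

end

section \<open>Quotients\<close>

lemma (in abelian_group) minus_zero_imp_eq:
  assumes "a \<ominus> b = \<zero>" "a \<in> carrier G" "b \<in> carrier G" shows "a = b"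
proof -
  have "a = (a \<ominus> b) \<oplus> b" using assms(2,3) by (simp add: minus_eq a_assoc l_neg)
  then show ?thesis using assms by simp
qed

text \<open>A surjection that respects the operations carries every module law to its target.
  Applied to a projection this handles quotients; applied to \<open>id\<close> it handles records
  that share the operations of a known module and differ in other fields.\<close>

lemma module_surj:
  assumes M: "module K M" and surj: "\<pi> ` carrier M = carrier Q"
    and add: "\<And>x y. \<lbrakk>x \<in> carrier M; y \<in> carrier M\<rbrakk> \<Longrightarrow> \<pi> (x \<oplus>\<^bsub>M\<^esub> y) = \<pi> x \<oplus>\<^bsub>Q\<^esub> \<pi> y"
    and zero: "\<pi> \<zero>\<^bsub>M\<^esub> = \<zero>\<^bsub>Q\<^esub>"
    and smult: "\<And>a x. \<lbrakk>a \<in> carrier K; x \<in> carrier M\<rbrakk> \<Longrightarrow> \<pi> (a \<odot>\<^bsub>M\<^esub> x) = a \<odot>\<^bsub>Q\<^esub> \<pi> x"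
  shows "module K Q"
proof -
  interpret M: module K M by fact
  note defs = surj[symmetric] add[symmetric] zero[symmetric] smult[symmetric]
  show ?thesis
  proof (rule moduleI[OF M.R.is_cring])
    show "abelian_group Q"
    proof (rule abelian_groupI)
      fix x assume "x \<in> carrier Q"
      then obtain u where u: "u \<in> carrier M" "x = \<pi> u" by (auto simp: surj[symmetric])
      then have "\<pi> (\<ominus>\<^bsub>M\<^esub> u) \<oplus>\<^bsub>Q\<^esub> x = \<zero>\<^bsub>Q\<^esub>" by (simp add: add[symmetric] zero[symmetric] M.M.l_neg)
      then show "\<exists>y\<in>carrier Q. y \<oplus>\<^bsub>Q\<^esub> x = \<zero>\<^bsub>Q\<^esub>" using u surj by blast
    qed (auto simp: defs M.M.a_ac)
  qed (auto simp: defs M.smult_l_distr M.smult_r_distr M.smult_assoc1)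
qed

lemma algebra_surj:
  assumes M: "algebra K M" and surj: "\<pi> ` carrier M = carrier Q"
    and add: "\<And>x y. \<lbrakk>x \<in> carrier M; y \<in> carrier M\<rbrakk> \<Longrightarrow> \<pi> (x \<oplus>\<^bsub>M\<^esub> y) = \<pi> x \<oplus>\<^bsub>Q\<^esub> \<pi> y"
    and zero: "\<pi> \<zero>\<^bsub>M\<^esub> = \<zero>\<^bsub>Q\<^esub>"
    and smult: "\<And>a x. \<lbrakk>a \<in> carrier K; x \<in> carrier M\<rbrakk> \<Longrightarrow> \<pi> (a \<odot>\<^bsub>M\<^esub> x) = a \<odot>\<^bsub>Q\<^esub> \<pi> x"
    and mult: "\<And>x y. \<lbrakk>x \<in> carrier M; y \<in> carrier M\<rbrakk> \<Longrightarrow> \<pi> (x \<otimes>\<^bsub>M\<^esub> y) = \<pi> x \<otimes>\<^bsub>Q\<^esub> \<pi> y"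
    and one: "\<pi> \<one>\<^bsub>M\<^esub> = \<one>\<^bsub>Q\<^esub>"
  shows "algebra K Q"
proof -
  interpret M: algebra K M by fact
  interpret Q: module K Q by (rule module_surj[OF M.module surj add zero smult])
  note defs = surj[symmetric] add[symmetric] mult[symmetric] one[symmetric] smult[symmetric]
  have "cring Q"
    by (rule cringI[OF Q.M.abelian_group_axioms])
      (auto intro!: comm_monoidI simp: defs M.m_ac M.l_distr M.r_distr)
  then show ?thesis
    using Q.module_axioms
    by (intro algebra.intro algebra_axioms.intro) (auto simp: defs M.smult_assoc2)
qed

lemma quot_mod_simps [simp]:
  "carrier (quot_mod M N) = a_rcosets\<^bsub>M\<^esub> N"
  "\<one>\<^bsub>quot_mod M N\<^esub> = N +>\<^bsub>M\<^esub> \<one>\<^bsub>M\<^esub>"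
  "\<zero>\<^bsub>quot_mod M N\<^esub> = N"
  "X \<oplus>\<^bsub>quot_mod M N\<^esub> Y = X <+>\<^bsub>M\<^esub> Y"
  "X \<otimes>\<^bsub>quot_mod M N\<^esub> Y = rcoset_mult M N X Y"
  "a \<odot>\<^bsub>quot_mod M N\<^esub> X = (\<Union>x\<in>X. N +>\<^bsub>M\<^esub> (a \<odot>\<^bsub>M\<^esub> x))"
  by (simp_all add: quot_mod_def FactRing_def ring.defs module.defs)

context module
begin

lemma submodule_abelian_subgroup:
  assumes "submodule N R M" shows "abelian_subgroup N M"
  using assms by (intro abelian_subgroupI3 additive_subgroup.intro submodule.axioms(1) M.abelian_group_axioms)

lemma submodule_zero: "submodule N R M \<Longrightarrow> \<zero>\<^bsub>M\<^esub> \<in> N"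
  using subgroup.one_closed[OF submodule.axioms(1)] by fastforce

lemma submodule_Inter:
  assumes "\<And>N. N \<in> \<N> \<Longrightarrow> submodule N R M" "\<N> \<noteq> {}"
  shows "submodule (\<Inter>\<N>) R M"
proof (rule submoduleI)
  show "\<Inter>\<N> \<subseteq> carrier M" using assms submoduleE(1) by blast
qed (auto intro: submodule_zero submoduleE(3-5) assms(1))

context
  fixes N assumes N: "submodule N R M"
begin

interpretation N: abelian_subgroup N M by (rule submodule_abelian_subgroup[OF N])

lemma coset_eq_iff:
  assumes "x \<in> carrier M" "y \<in> carrier M"
  shows "N +>\<^bsub>M\<^esub> x = N +>\<^bsub>M\<^esub> y \<longleftrightarrow> x \<ominus>\<^bsub>M\<^esub> y \<in> N"
proof -
  have "N +>\<^bsub>M\<^esub> x = N +>\<^bsub>M\<^esub> y \<longleftrightarrow> x \<in> N +>\<^bsub>M\<^esub> y"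
    using assms by (metis N.a_repr_independence' N.a_rcos_self)
  then show ?thesis
    using N.a_rcos_module[OF assms(2,1)] by (simp add: a_minus_def)
qed

lemma quot_carrier: "carrier (quot_mod M N) = (\<lambda>x. N +>\<^bsub>M\<^esub> x) ` carrier M"
  by (auto simp: A_RCOSETS_def' a_r_coset_def')

lemma quot_add: "\<lbrakk>x \<in> carrier M; y \<in> carrier M\<rbrakk>
    \<Longrightarrow> (N +>\<^bsub>M\<^esub> x) \<oplus>\<^bsub>quot_mod M N\<^esub> (N +>\<^bsub>M\<^esub> y) = N +>\<^bsub>M\<^esub> (x \<oplus>\<^bsub>M\<^esub> y)"
  by (simp add: N.a_rcos_sum)

lemma quot_zero: "N +>\<^bsub>M\<^esub> \<zero>\<^bsub>M\<^esub> = N"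
  by (rule M.a_coset_add_zero[OF N.a_subset])

lemma quot_smult:
  assumes a: "a \<in> carrier R" and x: "x \<in> carrier M"
  shows "a \<odot>\<^bsub>quot_mod M N\<^esub> (N +>\<^bsub>M\<^esub> x) = N +>\<^bsub>M\<^esub> (a \<odot>\<^bsub>M\<^esub> x)"
proof -
  have "N +>\<^bsub>M\<^esub> (a \<odot>\<^bsub>M\<^esub> y) = N +>\<^bsub>M\<^esub> (a \<odot>\<^bsub>M\<^esub> x)" if "y \<in> N +>\<^bsub>M\<^esub> x" for y
  proof -
    have y: "y \<in> carrier M" using that x N.a_elemrcos_carrier by blast
    have "y \<ominus>\<^bsub>M\<^esub> x \<in> N" using N.a_repr_independence'[OF that x] coset_eq_iff[OF y x] by simp
    then have "a \<odot>\<^bsub>M\<^esub> (y \<ominus>\<^bsub>M\<^esub> x) \<in> N" by (rule submoduleE(4)[OF N a])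
    then show ?thesis using a x y
      by (subst coset_eq_iff) (simp_all add: a_minus_def smult_r_distr smult_r_minus)
  qed
  then show ?thesis unfolding quot_mod_simps(6) using N.a_rcos_self[OF x] by (intro SUP_eq_const) blast+
qed

lemma quot_module: "module R (quot_mod M N)"
  by (rule module_surj[OF module_axioms quot_carrier[symmetric]])
    (simp_all only: quot_add quot_smult quot_zero quot_mod_simps(3))

lemma quot_proj_linear: "(\<lambda>x. N +>\<^bsub>M\<^esub> x) \<in> linear_hom R M (quot_mod M N)"
  by (rule linear_homI)
    (simp_all only: quot_add quot_smult quot_carrier image_eqI)

text \<open>Two elements of a coset differ by an element of \<open>N\<close>, where \<open>f\<close>
  vanishes. This legitimates the choice of a representative, both in \<open>tens_ext\<close> and for
  maps out of a quotient algebra.\<close>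

lemma quot_some:
  assumes U: "module R U" and f: "f \<in> linear_hom R M U"
    and null: "\<And>x. x \<in> N \<Longrightarrow> f x = \<zero>\<^bsub>U\<^esub>" and x: "x \<in> carrier M"
  shows "f (SOME y. y \<in> N +>\<^bsub>M\<^esub> x) = f x"
proof -
  interpret U: module R U by fact
  let ?y = "SOME y. y \<in> N +>\<^bsub>M\<^esub> x"
  have y: "?y \<in> N +>\<^bsub>M\<^esub> x" by (rule someI[of _ x]) (rule N.a_rcos_self[OF x])
  then have yM: "?y \<in> carrier M" using x N.a_elemrcos_carrier by blast
  have "?y \<ominus>\<^bsub>M\<^esub> x \<in> N" using N.a_repr_independence'[OF y x] coset_eq_iff[OF yM x] by simp
  then have "f ?y \<ominus>\<^bsub>U\<^esub> f x = \<zero>\<^bsub>U\<^esub>"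
    by (simp only: null linear_hom_minus[OF module_axioms U f yM x, symmetric])
  then show ?thesis using yM x linear_hom_closed[OF f] by (metis U.M.minus_zero_imp_eq)
qed

end

end

text \<open>Serves to pull a submodule of a tensor product back to the free module above it, where
  the spanning elements are known.\<close>

lemma linear_hom_vimage:
  assumes V: "module K V" and W: "module K W" and f: "f \<in> linear_hom K V W" and N: "submodule N K W"
  shows "submodule {x \<in> carrier V. f x \<in> N} K V"
proof -
  interpret V: module K V by fact
  interpret W: module K W by fact
  show ?thesis
    by (rule V.submoduleI)
      (auto simp: linear_hom_zero[OF V W f] linear_hom_uminus[OF V W f] linear_hom_add[OF f]
        linear_hom_smult[OF f] intro: W.submoduleE[OF N] W.submodule_zero[OF N])
qed

context algebra
begin

lemma ideal_submodule:
  assumes "ideal I M" shows "submodule I R M"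
proof -
  interpret I: ideal I M by fact
  show ?thesis
  proof (rule submoduleI)
    fix a x assume a: "a \<in> carrier R" and x: "x \<in> I"
    \<comment> \<open>A scalar acts as multiplication by its multiple of the unit, so absorption by
      the ideal yields closure under scalars.\<close>
    then have "(a \<odot>\<^bsub>M\<^esub> \<one>\<^bsub>M\<^esub>) \<otimes>\<^bsub>M\<^esub> x \<in> I" by (intro I.I_l_closed) auto
    then show "a \<odot>\<^bsub>M\<^esub> x \<in> I" using a x I.Icarr by (simp add: smult_assoc2)
  qed (auto simp: I.Icarr)
qed

lemma quot_algebra:
  assumes I: "ideal I M" shows "algebra R (quot_mod M I)"
proof -
  interpret I: ideal I M by fact
  note S = ideal_submodule[OF I]
  show ?thesis
    by (rule algebra_surj[OF algebra_axioms quot_carrier[OF S, symmetric]])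
      (simp_all only: quot_add[OF S] quot_smult[OF S] quot_zero[OF S] quot_mod_simps(2,3,5) I.rcoset_mult_add)
qed

lemma quot_proj_alg_hom:
  assumes I: "ideal I M" shows "(\<lambda>x. I +>\<^bsub>M\<^esub> x) \<in> alg_hom R M (quot_mod M I)"
proof -
  interpret I: ideal I M by fact
  note S = ideal_submodule[OF I]
  have "(\<lambda>x. I +>\<^bsub>M\<^esub> x) \<in> ring_hom M (quot_mod M I)"
    by (rule ring_hom_memI)
      (simp_all only: quot_add[OF S] quot_carrier[OF S] quot_mod_simps(2,5) I.rcoset_mult_add image_eqI)
  then show ?thesis using quot_proj_linear[OF S] by (simp add: alg_hom_def)
qed

end

section \<open>Tensor products\<close>

text \<open>Bilinearity is phrased through the partial maps being in \<open>linear_hom\<close>, so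
  that they can be composed and compared as linear maps with the other argument frozen.\<close>

definition bilin_map ::
  "('k, 'r) ring_scheme \<Rightarrow> ('k, 'v, 'm) module_scheme \<Rightarrow> ('k, 'w, 'l) module_scheme
    \<Rightarrow> ('k, 'u, 'h) module_scheme \<Rightarrow> ('v \<Rightarrow> 'w \<Rightarrow> 'u) \<Rightarrow> bool"
  where "bilin_map K V W U \<beta> \<longleftrightarrow>
    (\<forall>w\<in>carrier W. (\<lambda>v. \<beta> v w) \<in> linear_hom K V U) \<and> (\<forall>v\<in>carrier V. \<beta> v \<in> linear_hom K W U)"

lemma bilin_mapI:
  assumes "\<And>v w. \<lbrakk>v \<in> carrier V; w \<in> carrier W\<rbrakk> \<Longrightarrow> \<beta> v w \<in> carrier U"
    and "\<And>v v' w. \<lbrakk>v \<in> carrier V; v' \<in> carrier V; w \<in> carrier W\<rbrakk> \<Longrightarrow> \<beta> (v \<oplus>\<^bsub>V\<^esub> v') w = \<beta> v w \<oplus>\<^bsub>U\<^esub> \<beta> v' w"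
    and "\<And>a v w. \<lbrakk>a \<in> carrier K; v \<in> carrier V; w \<in> carrier W\<rbrakk> \<Longrightarrow> \<beta> (a \<odot>\<^bsub>V\<^esub> v) w = a \<odot>\<^bsub>U\<^esub> \<beta> v w"
    and "\<And>v w w'. \<lbrakk>v \<in> carrier V; w \<in> carrier W; w' \<in> carrier W\<rbrakk> \<Longrightarrow> \<beta> v (w \<oplus>\<^bsub>W\<^esub> w') = \<beta> v w \<oplus>\<^bsub>U\<^esub> \<beta> v w'"
    and "\<And>a v w. \<lbrakk>a \<in> carrier K; v \<in> carrier V; w \<in> carrier W\<rbrakk> \<Longrightarrow> \<beta> v (a \<odot>\<^bsub>W\<^esub> w) = a \<odot>\<^bsub>U\<^esub> \<beta> v w"
  shows "bilin_map K V W U \<beta>"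
  using assms by (simp add: bilin_map_def linear_hom_def)

lemma bilin_map_left: "\<lbrakk>bilin_map K V W U \<beta>; w \<in> carrier W\<rbrakk> \<Longrightarrow> (\<lambda>v. \<beta> v w) \<in> linear_hom K V U"
  and bilin_map_right: "\<lbrakk>bilin_map K V W U \<beta>; v \<in> carrier V\<rbrakk> \<Longrightarrow> \<beta> v \<in> linear_hom K W U"
  by (auto simp: bilin_map_def)

lemma bilin_map_closed:
  "\<lbrakk>bilin_map K V W U \<beta>; v \<in> carrier V; w \<in> carrier W\<rbrakk> \<Longrightarrow> \<beta> v w \<in> carrier U"
  by (auto simp: bilin_map_def dest: linear_hom_closed)

lemma tensor_simps [simp]:
  "carrier (tensor K V W) = carrier (tensor_space K V W)"
  "zero (tensor K V W) = zero (tensor_space K V W)"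
  "add (tensor K V W) = add (tensor_space K V W)"
  "smult (tensor K V W) = smult (tensor_space K V W)"
  "monoid.mult (tensor K V W) = tens_op K V W (monoid.mult V) (monoid.mult W)"
  "one (tensor K V W) = tens K V W \<one>\<^bsub>V\<^esub> \<one>\<^bsub>W\<^esub>"
  by (simp_all add: tensor_def)

text \<open>\<open>tensor_space\<close> and \<open>tensor\<close> differ only in product and unit,
  which a linear combination never consults. Hence extensions with values in either
  coincide.\<close>

lemma free_ext_cong:
  assumes "carrier U = carrier U'" "zero U = zero U'" "add U = add U'" "smult U = smult U'"
  shows "free_ext K U = free_ext K U'"
  using assms by (intro ext) (simp add: free_ext_def finsum_def finprod_def)

lemma tens_ext_tensor_space: "tens_ext K (tensor_space K V W) = tens_ext K (tensor K V W)"
  by (intro ext) (simp add: tens_ext_def free_ext_cong[of "tensor K V W" "tensor_space K V W"])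

lemma bilin_relsI:
  assumes "v \<in> carrier V" "w \<in> carrier W"
  shows "v' \<in> carrier V \<Longrightarrow> delta K (v \<oplus>\<^bsub>V\<^esub> v', w) \<ominus>\<^bsub>pair_mod K V W\<^esub>
      (delta K (v, w) \<oplus>\<^bsub>pair_mod K V W\<^esub> delta K (v', w)) \<in> bilin_rels K V W"
    and "w' \<in> carrier W \<Longrightarrow> delta K (v, w \<oplus>\<^bsub>W\<^esub> w') \<ominus>\<^bsub>pair_mod K V W\<^esub>
      (delta K (v, w) \<oplus>\<^bsub>pair_mod K V W\<^esub> delta K (v, w')) \<in> bilin_rels K V W"
    and "a \<in> carrier K \<Longrightarrow> delta K (a \<odot>\<^bsub>V\<^esub> v, w) \<ominus>\<^bsub>pair_mod K V W\<^esub>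
      (a \<odot>\<^bsub>pair_mod K V W\<^esub> delta K (v, w)) \<in> bilin_rels K V W"
    and "a \<in> carrier K \<Longrightarrow> delta K (v, a \<odot>\<^bsub>W\<^esub> w) \<ominus>\<^bsub>pair_mod K V W\<^esub>
      (a \<odot>\<^bsub>pair_mod K V W\<^esub> delta K (v, w)) \<in> bilin_rels K V W"
  unfolding bilin_rels_def Let_def using assms
  by (blast intro: UnI1 UnI2)+

context
  fixes K (structure) and V and W
  assumes V: "module K V" and W: "module K W"
begin

interpretation V: module K V by (rule V)
interpretation W: module K W by (rule W)

private abbreviation (input) "FF \<equiv> pair_mod K V W"
private abbreviation (input) "BB \<equiv> bilin_sub K V W"

interpretation F: module K FF by (rule V.R.free_mod_module)

lemma bilin_rels_closed: "bilin_rels K V W \<subseteq> carrier FF"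
  unfolding bilin_rels_def Let_def
  by (auto simp del: free_mod_simps intro!: V.R.delta_closed F.M.minus_closed F.M.a_closed F.smult_closed)

lemma bilin_sub_submodule: "submodule BB K FF"
  unfolding bilin_sub_def
  using bilin_rels_closed F.carrier_is_submodule by (intro F.submodule_Inter) auto

lemma bilin_rels_sub: "bilin_rels K V W \<subseteq> BB"
  unfolding bilin_sub_def by auto

lemma tensor_space_module: "module K (tensor_space K V W)"
  unfolding tensor_space_def by (rule F.quot_module[OF bilin_sub_submodule])

lemma tensor_module: "module K (tensor K V W)"
  by (rule module_surj[OF tensor_space_module, of id]) auto

interpretation T: module K "tensor K V W" by (rule tensor_module)

lemma tens_proj_linear: "(\<lambda>x. BB +>\<^bsub>FF\<^esub> x) \<in> linear_hom K FF (tensor K V W)"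
  using F.quot_proj_linear[OF bilin_sub_submodule] by (simp add: linear_hom_def tensor_space_def del: quot_mod_simps)

lemma tens_closed: "\<lbrakk>v \<in> carrier V; w \<in> carrier W\<rbrakk> \<Longrightarrow> tens K V W v w \<in> carrier (tensor K V W)"
  unfolding tens_def by (rule linear_hom_closed[OF tens_proj_linear]) (simp add: V.R.delta_closed)

lemma tens_eqI:
  assumes "x \<ominus>\<^bsub>FF\<^esub> y \<in> bilin_rels K V W" "x \<in> carrier FF" "y \<in> carrier FF"
  shows "BB +>\<^bsub>FF\<^esub> x = BB +>\<^bsub>FF\<^esub> y"
  using assms bilin_rels_sub by (subst F.coset_eq_iff[OF bilin_sub_submodule]) auto

lemma tens_bilin: "bilin_map K V W (tensor K V W) (tens K V W)"
proof (rule bilin_mapI)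
  have d: "delta K (v, w) \<in> carrier FF" if "v \<in> carrier V" "w \<in> carrier W" for v w
    using that by (simp add: V.R.delta_closed)
  note [simp] = d
  note lin = linear_hom_add[OF tens_proj_linear, symmetric] linear_hom_smult[OF tens_proj_linear, symmetric]
  fix v w assume [simp]: "v \<in> carrier V" "w \<in> carrier W"
  show "tens K V W v w \<in> carrier (tensor K V W)" by (simp add: tens_closed del: tensor_simps)
  {
    fix v' assume [simp]: "v' \<in> carrier V"
    show "tens K V W (v \<oplus>\<^bsub>V\<^esub> v') w = tens K V W v w \<oplus>\<^bsub>tensor K V W\<^esub> tens K V W v' w"
      unfolding tens_def
      by (subst lin, simp, simp, intro tens_eqI d F.M.a_closed bilin_relsI)
        simp_all
  }
  {
    fix w' assume [simp]: "w' \<in> carrier W"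
    show "tens K V W v (w \<oplus>\<^bsub>W\<^esub> w') = tens K V W v w \<oplus>\<^bsub>tensor K V W\<^esub> tens K V W v w'"
      unfolding tens_def
      by (subst lin, simp, simp, intro tens_eqI d F.M.a_closed bilin_relsI)
        simp_all
  }
  {
    fix a assume [simp]: "a \<in> carrier K"
    show "tens K V W (a \<odot>\<^bsub>V\<^esub> v) w = a \<odot>\<^bsub>tensor K V W\<^esub> tens K V W v w"
      unfolding tens_def
      by (subst lin, simp, simp, intro tens_eqI d F.smult_closed bilin_relsI)
        simp_all
    show "tens K V W v (a \<odot>\<^bsub>W\<^esub> w) = a \<odot>\<^bsub>tensor K V W\<^esub> tens K V W v w"
      unfolding tens_def
      by (subst lin, simp, simp, intro tens_eqI d F.smult_closed bilin_relsI)
        simp_all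
  }
qed

text \<open>The preimage of \<open>N\<close> under the projection is a submodule of the free module
  containing every \<open>delta\<close>, hence is everything; the projection is onto.\<close>

lemma tensor_span:
  assumes N: "submodule N K (tensor K V W)"
    and t: "\<And>v w. \<lbrakk>v \<in> carrier V; w \<in> carrier W\<rbrakk> \<Longrightarrow> tens K V W v w \<in> N"
  shows "carrier (tensor K V W) \<subseteq> N"
proof -
  have sub: "carrier FF \<subseteq> {x \<in> carrier FF. BB +>\<^bsub>FF\<^esub> x \<in> N}"
    using t by (intro V.R.free_mod_span linear_hom_vimage[OF F.module_axioms tensor_module tens_proj_linear N])
      (auto simp: V.R.delta_closed tens_def)
  have "BB +>\<^bsub>FF\<^esub> x \<in> N" if "x \<in> carrier FF" for x using subsetD[OF sub that] by blast
  then show ?thesis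
    unfolding tensor_simps tensor_space_def F.quot_carrier[OF bilin_sub_submodule] by (rule image_subsetI)
qed

text \<open>The extensionality principle behind all later tensor identities. With several tensor
  variables it is applied to one of them while the others stay fixed.\<close>

lemma tensor_hom_eqI:
  assumes U: "module K U" and f: "f \<in> linear_hom K (tensor K V W) U" and g: "g \<in> linear_hom K (tensor K V W) U"
    and eq: "\<And>v w. \<lbrakk>v \<in> carrier V; w \<in> carrier W\<rbrakk> \<Longrightarrow> f (tens K V W v w) = g (tens K V W v w)"
    and x: "x \<in> carrier (tensor K V W)"
  shows "f x = g x"
proof -
  have "carrier (tensor K V W) \<subseteq> {x \<in> carrier (tensor K V W). f x = g x}"
    using eq by (intro tensor_span[OF linear_hom_equalizer[OF tensor_module U f g]])
      (simp add: tens_closed del: tensor_simps)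
  then show ?thesis using x by blast
qed

context
  fixes U and \<beta>
  assumes U: "module K U" and beta: "bilin_map K V W U \<beta>"
begin

interpretation U: module K U by (rule U)

text \<open>Removes the choice of a representative: bilinearity of \<beta> puts each defining
  relation of the tensor product in the kernel of the free extension, so that extension is constant
  on cosets.\<close>

lemma tens_ext_coset:
  assumes x: "x \<in> carrier FF"
  shows "tens_ext K U \<beta> (BB +>\<^bsub>FF\<^esub> x) = free_ext K U (\<lambda>(v, w). \<beta> v w) x"
  unfolding tens_ext_def
proof (rule F.quot_some[OF bilin_sub_submodule U _ _ x])
  let ?f = "free_ext K U (\<lambda>(v, w). \<beta> v w)"
  show f: "?f \<in> linear_hom K FF U"
    using bilin_map_closed[OF beta] by (intro V.R.free_ext_linear[OF U]) auto
  note lin = linear_hom_minus[OF F.module_axioms U f] linear_hom_add[OF f] linear_hom_smult[OF f]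
  have d: "delta K (v, w) \<in> carrier FF" "?f (delta K (v, w)) = \<beta> v w" "\<beta> v w \<in> carrier U"
    if "v \<in> carrier V" "w \<in> carrier W" for v w
    using that bilin_map_closed[OF beta] by (auto simp: V.R.delta_closed V.R.free_ext_delta[OF U])
  have "bilin_rels K V W \<subseteq> {x \<in> carrier FF. ?f x = \<zero>\<^bsub>U\<^esub>}"
  proof
    fix x assume x: "x \<in> bilin_rels K V W"
    then have "x \<in> carrier FF" using bilin_rels_closed by blast
    moreover have "?f x = \<zero>\<^bsub>U\<^esub>"
      using x unfolding bilin_rels_def Let_def
      by (elim UnE; clarsimp simp del: free_mod_simps)
        (simp_all del: free_mod_simps add: lin d
          linear_hom_add[OF bilin_map_left[OF beta]] linear_hom_add[OF bilin_map_right[OF beta]]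
          linear_hom_smult[OF bilin_map_left[OF beta]] linear_hom_smult[OF bilin_map_right[OF beta]]
          U.M.minus_eq U.M.r_neg)
    ultimately show "x \<in> {x \<in> carrier FF. ?f x = \<zero>\<^bsub>U\<^esub>}" by simp
  qed
  \<comment> \<open>The kernel is a submodule containing the relations, hence one of the submodules
    intersected in \<open>bilin_sub\<close>.\<close>
  then have "BB \<subseteq> {x \<in> carrier FF. ?f x = \<zero>\<^bsub>U\<^esub>}"
    unfolding bilin_sub_def using linear_hom_kernel[OF F.module_axioms U f] by blast
  then show "?f x = \<zero>\<^bsub>U\<^esub>" if "x \<in> BB" for x using that by blast
qed

lemma tens_ext_tens: "\<lbrakk>v \<in> carrier V; w \<in> carrier W\<rbrakk> \<Longrightarrow> tens_ext K U \<beta> (tens K V W v w) = \<beta> v w"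
  using bilin_map_closed[OF beta]
  by (simp add: tens_def tens_ext_coset V.R.delta_closed V.R.free_ext_delta[OF U])

lemma tens_ext_linear: "tens_ext K U \<beta> \<in> linear_hom K (tensor K V W) U"
proof -
  let ?f = "free_ext K U (\<lambda>(v, w). \<beta> v w)"
  have f: "?f \<in> linear_hom K FF U"
    using bilin_map_closed[OF beta] by (intro V.R.free_ext_linear[OF U]) auto
  have sur: "\<exists>y\<in>carrier FF. x = BB +>\<^bsub>FF\<^esub> y" if "x \<in> carrier (tensor K V W)" for x
    using F.quot_carrier[OF bilin_sub_submodule] that
    by (auto simp add: tensor_space_def simp del: quot_mod_simps)
  note lin = linear_hom_add[OF tens_proj_linear, symmetric] linear_hom_smult[OF tens_proj_linear, symmetric]
  show ?thesis
  proof (rule linear_homI)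
    fix x assume "x \<in> carrier (tensor K V W)"
    then obtain x' where x: "x' \<in> carrier FF" "x = BB +>\<^bsub>FF\<^esub> x'" using sur by blast
    then show "tens_ext K U \<beta> x \<in> carrier U"
      by (simp add: tens_ext_coset linear_hom_closed[OF f])
    {
      fix a assume "a \<in> carrier K"
      then show "tens_ext K U \<beta> (a \<odot>\<^bsub>tensor K V W\<^esub> x) = a \<odot>\<^bsub>U\<^esub> tens_ext K U \<beta> x"
        using x F.smult_closed
        by (simp add: lin tens_ext_coset linear_hom_smult[OF f] del: free_mod_simps tensor_simps)
    }
    fix y assume "y \<in> carrier (tensor K V W)"
    then obtain y' where y: "y' \<in> carrier FF" "y = BB +>\<^bsub>FF\<^esub> y'" using sur by blast
    then show "tens_ext K U \<beta> (x \<oplus>\<^bsub>tensor K V W\<^esub> y) = tens_ext K U \<beta> x \<oplus>\<^bsub>U\<^esub> tens_ext K U \<beta> y"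
      using x F.M.a_closed
      by (simp add: lin tens_ext_coset linear_hom_add[OF f] del: free_mod_simps tensor_simps)
  qed
qed

end

end

section \<open>Extensions depending on a parameter and bilinear operations on tensors\<close>

lemma bilin_map_add_left: "\<lbrakk>bilin_map K V W U \<beta>; v \<in> carrier V; v' \<in> carrier V; w \<in> carrier W\<rbrakk>
    \<Longrightarrow> \<beta> (v \<oplus>\<^bsub>V\<^esub> v') w = \<beta> v w \<oplus>\<^bsub>U\<^esub> \<beta> v' w"
  and bilin_map_add_right: "\<lbrakk>bilin_map K V W U \<beta>; v \<in> carrier V; w \<in> carrier W; w' \<in> carrier W\<rbrakk>
    \<Longrightarrow> \<beta> v (w \<oplus>\<^bsub>W\<^esub> w') = \<beta> v w \<oplus>\<^bsub>U\<^esub> \<beta> v w'"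
  and bilin_map_smult_left: "\<lbrakk>bilin_map K V W U \<beta>; a \<in> carrier K; v \<in> carrier V; w \<in> carrier W\<rbrakk>
    \<Longrightarrow> \<beta> (a \<odot>\<^bsub>V\<^esub> v) w = a \<odot>\<^bsub>U\<^esub> \<beta> v w"
  and bilin_map_smult_right: "\<lbrakk>bilin_map K V W U \<beta>; a \<in> carrier K; v \<in> carrier V; w \<in> carrier W\<rbrakk>
    \<Longrightarrow> \<beta> v (a \<odot>\<^bsub>W\<^esub> w) = a \<odot>\<^bsub>U\<^esub> \<beta> v w"
  by (auto simp: bilin_map_def linear_hom_def)

lemma linear_hom_plus:
  assumes "module K U" "f \<in> linear_hom K V U" "g \<in> linear_hom K V U"
  shows "(\<lambda>x. f x \<oplus>\<^bsub>U\<^esub> g x) \<in> linear_hom K V U"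
proof -
  interpret U: module K U by fact
  show ?thesis using linear_hom_closed[OF assms(2)] linear_hom_closed[OF assms(3)]
    by (intro linear_homI)
      (auto simp: linear_hom_add[OF assms(2)] linear_hom_add[OF assms(3)] linear_hom_smult[OF assms(2)]
        linear_hom_smult[OF assms(3)] U.smult_r_distr U.M.a_ac)
qed

lemma linear_hom_scale:
  assumes "module K U" "f \<in> linear_hom K V U" "a \<in> carrier K"
  shows "(\<lambda>x. a \<odot>\<^bsub>U\<^esub> f x) \<in> linear_hom K V U"
proof -
  interpret U: module K U by fact
  show ?thesis using linear_hom_closed[OF assms(2)] assms(3)
    by (intro linear_homI)
      (auto simp: linear_hom_add[OF assms(2)] linear_hom_smult[OF assms(2)] U.smult_r_distr
        U.smult_assoc1[symmetric] U.R.m_comm)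
qed

text \<open>For fixed \<open>y\<close> and \<open>y'\<close> the two sides of a linearity law in the
  parameter are linear in \<open>x\<close>, so pure tensors suffice, and there the law is the
  hypothesis on \<beta>. Nested extensions, such as \<open>tens_op\<close> and the associator, need
  this before the outer extension is meaningful.\<close>

lemma tens_ext_param:
  assumes V: "module K V" and W: "module K W" and U: "module K U"
    and bil: "\<And>y. y \<in> carrier S \<Longrightarrow> bilin_map K V W U (\<lambda>v w. \<beta> v w y)"
    and lin: "\<And>v w. \<lbrakk>v \<in> carrier V; w \<in> carrier W\<rbrakk> \<Longrightarrow> \<beta> v w \<in> linear_hom K S U"
    and S: "module K S"
  shows "bilin_map K (tensor K V W) S U (\<lambda>x y. tens_ext K U (\<lambda>v w. \<beta> v w y) x)"
proof -
  interpret S: module K S by fact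
  let ?F = "\<lambda>x y. tens_ext K U (\<lambda>v w. \<beta> v w y) x"
  have L: "(\<lambda>x. ?F x y) \<in> linear_hom K (tensor K V W) U" if "y \<in> carrier S" for y
    by (rule tens_ext_linear[OF V W U bil[OF that]])
  note E = tens_ext_tens[OF V W U bil]
  have "?F x (y \<oplus>\<^bsub>S\<^esub> y') = ?F x y \<oplus>\<^bsub>U\<^esub> ?F x y'"
    if "x \<in> carrier (tensor K V W)" "y \<in> carrier S" "y' \<in> carrier S" for x y y'
    by (rule tensor_hom_eqI[OF V W U L linear_hom_plus[OF U L L] _ that(1)])
      (use that in \<open>auto simp: E linear_hom_add[OF lin]\<close>)
  moreover have "?F x (a \<odot>\<^bsub>S\<^esub> y) = a \<odot>\<^bsub>U\<^esub> ?F x y"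
    if "x \<in> carrier (tensor K V W)" "y \<in> carrier S" "a \<in> carrier K" for x y a
    by (rule tensor_hom_eqI[OF V W U L linear_hom_scale[OF U L] _ that(1)])
      (use that in \<open>auto simp: E linear_hom_smult[OF lin]\<close>)
  ultimately show ?thesis
    by (intro bilin_mapI) (simp_all only: linear_hom_closed[OF L] linear_hom_add[OF L] linear_hom_smult[OF L])
qed

lemma tens_op_tensor: "tens_op K V W p q X Y = tens_ext K (tensor K V W)
    (\<lambda>v w. tens_ext K (tensor K V W) (\<lambda>v' w'. tens K V W (p v v') (q w w')) Y) X"
  by (simp add: tens_op_def tens_ext_tensor_space)

context
  fixes K (structure) and V and W and p and q
  assumes V: "module K V" and W: "module K W"
    and p: "bilin_map K V V V p" and q: "bilin_map K W W W q"
begin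

interpretation V: module K V by (rule V)
interpretation W: module K W by (rule W)
interpretation T: module K "tensor K V W" by (rule tensor_module[OF V W])

private lemmas tens_bil = tens_bilin[OF V W]
private lemmas bil_simps = bilin_map_closed[OF tens_bil] bilin_map_add_left[OF tens_bil] bilin_map_add_right[OF tens_bil]
  bilin_map_smult_left[OF tens_bil] bilin_map_smult_right[OF tens_bil]
  bilin_map_closed[OF p] bilin_map_add_left[OF p] bilin_map_add_right[OF p]
  bilin_map_smult_left[OF p] bilin_map_smult_right[OF p]
  bilin_map_closed[OF q] bilin_map_add_left[OF q] bilin_map_add_right[OF q]
  bilin_map_smult_left[OF q] bilin_map_smult_right[OF q]

text \<open>The outer extension in \<open>tens_op\<close> is taken of this map, so it must be
  bilinear for every fixed \<open>y\<close>. Each of \<open>v\<close> and \<open>w\<close> is in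
  turn the parameter of the inner extension.\<close>

lemma tens_op_inner_bilin:
  assumes "y \<in> carrier (tensor K V W)"
  shows "bilin_map K V W (tensor K V W)
    (\<lambda>v w. tens_ext K (tensor K V W) (\<lambda>v' w'. tens K V W (p v v') (q w w')) y)"
  unfolding bilin_map_def
proof (intro conjI ballI)
  fix w assume [simp]: "w \<in> carrier W"
  show "(\<lambda>v. tens_ext K (tensor K V W) (\<lambda>v' w'. tens K V W (p v v') (q w w')) y) \<in> linear_hom K V (tensor K V W)"
    by (rule bilin_map_right[OF tens_ext_param[OF V W tensor_module[OF V W] _ _ V] assms])
      (auto intro!: bilin_mapI linear_homI simp del: tensor_simps simp: bil_simps)
next
  fix v assume [simp]: "v \<in> carrier V"
  show "(\<lambda>w. tens_ext K (tensor K V W) (\<lambda>v' w'. tens K V W (p v v') (q w w')) y) \<in> linear_hom K W (tensor K V W)"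
    by (rule bilin_map_right[OF tens_ext_param[OF V W tensor_module[OF V W] _ _ W] assms])
      (auto intro!: bilin_mapI linear_homI simp del: tensor_simps simp: bil_simps)
qed

lemma tens_op_tens_bilin:
  assumes "v \<in> carrier V" "w \<in> carrier W"
  shows "bilin_map K V W (tensor K V W) (\<lambda>v' w'. tens K V W (p v v') (q w w'))"
  using assms by (intro bilin_mapI) (auto simp del: tensor_simps simp: bil_simps)

lemma tens_op_bilin: "bilin_map K (tensor K V W) (tensor K V W) (tensor K V W) (tens_op K V W p q)"
  unfolding tens_op_tensor[abs_def]
  by (intro tens_ext_param[OF V W tensor_module[OF V W] _ _ tensor_module[OF V W]] tens_op_inner_bilin
    tens_ext_linear[OF V W tensor_module[OF V W]] tens_op_tens_bilin)

lemma tens_op_tens: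
  assumes "v \<in> carrier V" "w \<in> carrier W" "v' \<in> carrier V" "w' \<in> carrier W"
  shows "tens_op K V W p q (tens K V W v w) (tens K V W v' w') = tens K V W (p v v') (q w w')"
  using assms unfolding tens_op_tensor
  by (simp add: tens_ext_tens[OF V W tensor_module[OF V W] tens_op_inner_bilin] tens_closed[OF V W]
      tens_ext_tens[OF V W tensor_module[OF V W] tens_op_tens_bilin] del: tensor_simps)

end

section \<open>Algebra maps and the algebra structure on a tensor product\<close>

lemma alg_homI:
  assumes "f \<in> linear_hom K A B"
    and "\<And>x y. \<lbrakk>x \<in> carrier A; y \<in> carrier A\<rbrakk> \<Longrightarrow> f (x \<otimes>\<^bsub>A\<^esub> y) = f x \<otimes>\<^bsub>B\<^esub> f y"
    and "f \<one>\<^bsub>A\<^esub> = \<one>\<^bsub>B\<^esub>"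
  shows "f \<in> alg_hom K A B"
  using assms by (auto simp: alg_hom_def linear_hom_def intro!: ring_hom_memI)

lemma alg_hom_linear: "f \<in> alg_hom K A B \<Longrightarrow> f \<in> linear_hom K A B"
  and alg_hom_mult: "\<lbrakk>f \<in> alg_hom K A B; x \<in> carrier A; y \<in> carrier A\<rbrakk> \<Longrightarrow> f (x \<otimes>\<^bsub>A\<^esub> y) = f x \<otimes>\<^bsub>B\<^esub> f y"
  and alg_hom_one: "f \<in> alg_hom K A B \<Longrightarrow> f \<one>\<^bsub>A\<^esub> = \<one>\<^bsub>B\<^esub>"
  and alg_hom_closed: "\<lbrakk>f \<in> alg_hom K A B; x \<in> carrier A\<rbrakk> \<Longrightarrow> f x \<in> carrier B"
  by (auto simp: alg_hom_def linear_hom_def dest: ring_hom_mult ring_hom_one)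

lemma alg_hom_comp:
  assumes "f \<in> alg_hom K A B" "g \<in> alg_hom K B C"
  shows "(\<lambda>x. g (f x)) \<in> alg_hom K A C"
  by (rule alg_homI[OF linear_hom_comp[OF alg_hom_linear[OF assms(1)] alg_hom_linear[OF assms(2)]]])
    (auto simp: alg_hom_mult[OF assms(1)] alg_hom_mult[OF assms(2)] alg_hom_one[OF assms(1)]
      alg_hom_one[OF assms(2)] alg_hom_closed[OF assms(1)])

lemma alg_hom_id: "(\<lambda>x. x) \<in> alg_hom K A A"
  by (intro alg_homI linear_hom_id) auto

lemma (in algebra) mult_bilin: "bilin_map R M M M (monoid.mult M)"
proof (rule bilin_mapI)
  fix a x y assume *: "a \<in> carrier R" "x \<in> carrier M" "y \<in> carrier M"
  then have "(a \<odot>\<^bsub>M\<^esub> y) \<otimes>\<^bsub>M\<^esub> x = a \<odot>\<^bsub>M\<^esub> (y \<otimes>\<^bsub>M\<^esub> x)" by (intro smult_assoc2)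
  then show "x \<otimes>\<^bsub>M\<^esub> (a \<odot>\<^bsub>M\<^esub> y) = a \<odot>\<^bsub>M\<^esub> (x \<otimes>\<^bsub>M\<^esub> y)" using * by (simp add: m_comm)
qed (auto simp: smult_assoc2 l_distr r_distr)

text \<open>Fits products obtained by bilinear extension: the distributive and scalar laws come at
  once from bilinearity, and commutativity supplies the laws on the other side. Tensor algebras and
  polynomial algebras are both verified this way.\<close>

lemma algebra_bilinI:
  assumes M: "module K M" and mult: "bilin_map K M M M (monoid.mult M)" and one: "\<one>\<^bsub>M\<^esub> \<in> carrier M"
    and comm: "\<And>x y. \<lbrakk>x \<in> carrier M; y \<in> carrier M\<rbrakk> \<Longrightarrow> x \<otimes>\<^bsub>M\<^esub> y = y \<otimes>\<^bsub>M\<^esub> x"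
    and assoc: "\<And>x y z. \<lbrakk>x \<in> carrier M; y \<in> carrier M; z \<in> carrier M\<rbrakk> \<Longrightarrow> x \<otimes>\<^bsub>M\<^esub> y \<otimes>\<^bsub>M\<^esub> z = x \<otimes>\<^bsub>M\<^esub> (y \<otimes>\<^bsub>M\<^esub> z)"
    and l_one: "\<And>x. x \<in> carrier M \<Longrightarrow> \<one>\<^bsub>M\<^esub> \<otimes>\<^bsub>M\<^esub> x = x"
  shows "algebra K M"
proof -
  interpret M: module K M by fact
  have "comm_monoid M"
    using assms by (intro comm_monoidI) (auto intro: bilin_map_closed)
  then have "cring M"
    by (intro cringI M.M.abelian_group_axioms) (auto intro: bilin_map_add_left[OF mult])
  then show ?thesis
    by (intro algebra.intro algebra_axioms.intro M bilin_map_smult_left[OF mult])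
qed

context
  fixes K (structure) and A and B
  assumes A: "algebra K A" and B: "algebra K B"
begin

interpretation A: algebra K A by (rule A)
interpretation B: algebra K B by (rule B)
interpretation T: module K "tensor K A B" by (rule tensor_module[OF A.module B.module])

private abbreviation (input) "T \<equiv> tensor K A B"

lemma tensor_mult_bilin: "bilin_map K T T T (monoid.mult T)"
  using tens_op_bilin[OF A.module B.module A.mult_bilin B.mult_bilin] by (simp only: tensor_simps(5))

lemma tensor_mult_tens:
  "\<lbrakk>a \<in> carrier A; b \<in> carrier B; a' \<in> carrier A; b' \<in> carrier B\<rbrakk>
    \<Longrightarrow> tens K A B a b \<otimes>\<^bsub>T\<^esub> tens K A B a' b' = tens K A B (a \<otimes>\<^bsub>A\<^esub> a') (b \<otimes>\<^bsub>B\<^esub> b')"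
  unfolding tensor_simps(5) by (rule tens_op_tens[OF A.module B.module A.mult_bilin B.mult_bilin])

private lemmas eqI = tensor_hom_eqI[OF A.module B.module T.module_axioms]
private lemmas tclosed = tens_closed[OF A.module B.module]
private lemmas mclosed = bilin_map_closed[OF tensor_mult_bilin]

text \<open>Both sides of each law are linear in every variable. The variables are released from
  pure tensors one at a time, so commutativity takes two rounds and associativity three, the
  innermost being the law in the factors.\<close>

lemma tensor_algebra: "algebra K (tensor K A B)"
proof (rule algebra_bilinI[OF T.module_axioms tensor_mult_bilin])
  note L = bilin_map_left[OF tensor_mult_bilin] and R = bilin_map_right[OF tensor_mult_bilin]
  have one: "\<one>\<^bsub>T\<^esub> = tens K A B \<one>\<^bsub>A\<^esub> \<one>\<^bsub>B\<^esub>" by simp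
  show oneC: "\<one>\<^bsub>T\<^esub> \<in> carrier T" unfolding one by (rule tclosed) auto
  have comm1: "x \<otimes>\<^bsub>T\<^esub> tens K A B a b = tens K A B a b \<otimes>\<^bsub>T\<^esub> x"
    if "x \<in> carrier T" "a \<in> carrier A" "b \<in> carrier B" for x a b
    by (rule eqI[OF L R _ that(1)])
      (use that in \<open>auto simp: tclosed tensor_mult_tens A.m_comm B.m_comm simp del: tensor_simps\<close>)
  show "x \<otimes>\<^bsub>T\<^esub> y = y \<otimes>\<^bsub>T\<^esub> x" if "x \<in> carrier T" "y \<in> carrier T" for x y
    by (rule eqI[OF R L _ that(2)]) (use that in \<open>auto simp: comm1 simp del: tensor_simps\<close>)
  show "\<one>\<^bsub>T\<^esub> \<otimes>\<^bsub>T\<^esub> x = x" if "x \<in> carrier T" for x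
    by (rule eqI[OF R linear_hom_id _ that])
      (use oneC in \<open>auto simp: tclosed tensor_mult_tens one simp del: tensor_simps\<close>)
  have as1: "tens K A B a b \<otimes>\<^bsub>T\<^esub> tens K A B a' b' \<otimes>\<^bsub>T\<^esub> z = tens K A B a b \<otimes>\<^bsub>T\<^esub> (tens K A B a' b' \<otimes>\<^bsub>T\<^esub> z)"
    if "z \<in> carrier T" "a \<in> carrier A" "b \<in> carrier B" "a' \<in> carrier A" "b' \<in> carrier B" for a b a' b' z
    by (rule eqI[OF R linear_hom_comp[OF R R] _ that(1)])
      (use that in \<open>auto simp: tclosed tensor_mult_tens A.m_assoc B.m_assoc simp del: tensor_simps\<close>)
  have as2: "tens K A B a b \<otimes>\<^bsub>T\<^esub> y \<otimes>\<^bsub>T\<^esub> z = tens K A B a b \<otimes>\<^bsub>T\<^esub> (y \<otimes>\<^bsub>T\<^esub> z)"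
    if "z \<in> carrier T" "a \<in> carrier A" "b \<in> carrier B" "y \<in> carrier T" for a b y z
    by (rule eqI[OF linear_hom_comp[OF R L] linear_hom_comp[OF L R] _ that(4)])
      (use that in \<open>auto simp: tclosed as1 simp del: tensor_simps\<close>)
  show "x \<otimes>\<^bsub>T\<^esub> y \<otimes>\<^bsub>T\<^esub> z = x \<otimes>\<^bsub>T\<^esub> (y \<otimes>\<^bsub>T\<^esub> z)"
    if "x \<in> carrier T" "y \<in> carrier T" "z \<in> carrier T" for x y z
    by (rule eqI[OF linear_hom_comp[OF L L] L _ that(1)])
      (use that in \<open>auto simp: tclosed as2 mclosed simp del: tensor_simps\<close>)
qed

lemma tensor_alg_homI:
  assumes C: "algebra K C" and f: "f \<in> linear_hom K T C"
    and mult: "\<And>a b a' b'. \<lbrakk>a \<in> carrier A; b \<in> carrier B; a' \<in> carrier A; b' \<in> carrier B\<rbrakk>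
      \<Longrightarrow> f (tens K A B (a \<otimes>\<^bsub>A\<^esub> a') (b \<otimes>\<^bsub>B\<^esub> b')) = f (tens K A B a b) \<otimes>\<^bsub>C\<^esub> f (tens K A B a' b')"
    and one: "f (tens K A B \<one>\<^bsub>A\<^esub> \<one>\<^bsub>B\<^esub>) = \<one>\<^bsub>C\<^esub>"
  shows "f \<in> alg_hom K T C"
proof -
  interpret C: algebra K C by fact
  note eqI = tensor_hom_eqI[OF A.module B.module C.module]
  note L = bilin_map_left[OF tensor_mult_bilin] and R = bilin_map_right[OF tensor_mult_bilin]
  note LC = bilin_map_left[OF C.mult_bilin] and RC = bilin_map_right[OF C.mult_bilin]
  note fc = linear_hom_closed[OF f]
  show ?thesis
  proof (rule alg_homI[OF f])
    show "f \<one>\<^bsub>T\<^esub> = \<one>\<^bsub>C\<^esub>" by (simp add: one)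
    have 1: "f (tens K A B a b \<otimes>\<^bsub>T\<^esub> y) = f (tens K A B a b) \<otimes>\<^bsub>C\<^esub> f y"
      if "a \<in> carrier A" "b \<in> carrier B" "y \<in> carrier T" for a b y
      by (rule eqI[OF linear_hom_comp[OF R f] linear_hom_comp[OF f RC] _ that(3)])
        (use that in \<open>auto simp: tclosed fc mult tensor_mult_tens simp del: tensor_simps\<close>)
    show "f (x \<otimes>\<^bsub>T\<^esub> y) = f x \<otimes>\<^bsub>C\<^esub> f y" if "x \<in> carrier T" "y \<in> carrier T" for x y
      by (rule eqI[OF linear_hom_comp[OF L f] linear_hom_comp[OF f LC] _ that(1)])
        (use that in \<open>auto simp: tclosed fc 1 simp del: tensor_simps\<close>)
  qed
qed

text \<open>Together with the embedding of the other factor this prepares the comultiplication: the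
  two embeddings carry a matrix of generators to two matrices over the tensor algebra, and (a
  \<otimes> 1)(1 \<otimes> b) = a \<otimes> b governs their product.\<close>

lemma tensor_left_hom: "(\<lambda>a. tens K A B a \<one>\<^bsub>B\<^esub>) \<in> alg_hom K A T"
  by (rule alg_homI[OF bilin_map_left[OF tens_bilin[OF A.module B.module]]])
    (auto simp: tensor_mult_tens simp del: tensor_simps(5))

lemma tensor_right_hom: "(\<lambda>b. tens K A B \<one>\<^bsub>A\<^esub> b) \<in> alg_hom K B T"
  by (rule alg_homI[OF bilin_map_right[OF tens_bilin[OF A.module B.module]]])
    (auto simp: tensor_mult_tens simp del: tensor_simps(5))

end

section \<open>Maps between tensor products\<close>

context
  fixes K (structure) and V and W and V' and W' and f and g
  assumes V: "module K V" and W: "module K W" and V': "module K V'" and W': "module K W'"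
    and f: "f \<in> linear_hom K V V'" and g: "g \<in> linear_hom K W W'"
begin

lemma tensor_map_bilin: "bilin_map K V W (tensor K V' W') (\<lambda>v w. tens K V' W' (f v) (g w))"
  unfolding bilin_map_def
  using linear_hom_comp[OF f bilin_map_left[OF tens_bilin[OF V' W']]]
    linear_hom_comp[OF g bilin_map_right[OF tens_bilin[OF V' W']]]
    linear_hom_closed[OF f] linear_hom_closed[OF g] by blast

lemma tensor_map_linear: "tensor_map K V' W' f g \<in> linear_hom K (tensor K V W) (tensor K V' W')"
  unfolding tensor_map_def by (rule tens_ext_linear[OF V W tensor_module[OF V' W'] tensor_map_bilin])

lemma tensor_map_tens:
  "\<lbrakk>v \<in> carrier V; w \<in> carrier W\<rbrakk> \<Longrightarrow> tensor_map K V' W' f g (tens K V W v w) = tens K V' W' (f v) (g w)"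
  unfolding tensor_map_def by (rule tens_ext_tens[OF V W tensor_module[OF V' W'] tensor_map_bilin])

end

text \<open>Multiplicativity matters because it makes both sides of the bialgebra axioms algebra
  maps, which then need comparing on generators only.\<close>

lemma tensor_map_alg_hom:
  assumes A: "algebra K A" and B: "algebra K B" and A': "algebra K A'" and B': "algebra K B'"
    and f: "f \<in> alg_hom K A A'" and g: "g \<in> alg_hom K B B'"
  shows "tensor_map K A' B' f g \<in> alg_hom K (tensor K A B) (tensor K A' B')"
proof -
  interpret A: algebra K A by fact
  interpret B: algebra K B by fact
  note mods = algebra.module[OF A] algebra.module[OF B] algebra.module[OF A'] algebra.module[OF B']
    alg_hom_linear[OF f] alg_hom_linear[OF g]
  show ?thesis
    by (rule tensor_alg_homI[OF A B tensor_algebra[OF A' B'] tensor_map_linear[OF mods]])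
      (simp_all add: tensor_map_tens[OF mods] tensor_mult_tens[OF A' B'] alg_hom_closed[OF f] alg_hom_closed[OF g]
        alg_hom_mult[OF f] alg_hom_mult[OF g] alg_hom_one[OF f] alg_hom_one[OF g] del: tensor_simps(5))
qed

section \<open>The associator\<close>

context
  fixes K (structure) and U and V and W
  assumes U: "module K U" and V: "module K V" and W: "module K W"
begin

private abbreviation (input) "TT \<equiv> tensor K U (tensor K V W)"

private lemmas assoc_mods = tensor_module[OF V W] tensor_module[OF U tensor_module[OF V W]] tensor_module[OF U V]
private lemmas b1 = tens_bilin[OF V W] and b2 = tens_bilin[OF U tensor_module[OF V W]]
private lemmas bs = bilin_map_closed[OF b1] bilin_map_add_left[OF b1] bilin_map_add_right[OF b1]
  bilin_map_smult_left[OF b1] bilin_map_smult_right[OF b1]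
  bilin_map_closed[OF b2] bilin_map_add_left[OF b2] bilin_map_add_right[OF b2]
  bilin_map_smult_left[OF b2] bilin_map_smult_right[OF b2]

lemma tensor_assoc_bilin0: "w \<in> carrier W \<Longrightarrow> bilin_map K U V TT (\<lambda>u v. tens K U (tensor K V W) u (tens K V W v w))"
  by (rule bilin_mapI) (simp_all add: bs del: tensor_simps)

lemma tensor_assoc_bilin: "bilin_map K (tensor K U V) W TT
    (\<lambda>X w. tens_ext K TT (\<lambda>u v. tens K U (tensor K V W) u (tens K V W v w)) X)"
  by (rule tens_ext_param[OF U V assoc_mods(2) _ _ W])
    (auto intro!: tensor_assoc_bilin0 linear_homI simp del: tensor_simps simp: bs)

lemma tensor_assoc_linear: "tensor_assoc K U V W \<in> linear_hom K (tensor K (tensor K U V) W) TT"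
  unfolding tensor_assoc_def Let_def by (rule tens_ext_linear[OF assoc_mods(3) W assoc_mods(2) tensor_assoc_bilin])

lemma tensor_assoc_tens:
  assumes "u \<in> carrier U" "v \<in> carrier V" "w \<in> carrier W"
  shows "tensor_assoc K U V W (tens K (tensor K U V) W (tens K U V u v) w)
    = tens K U (tensor K V W) u (tens K V W v w)"
  using assms unfolding tensor_assoc_def Let_def
  by (simp add: tens_ext_tens[OF assoc_mods(3) W assoc_mods(2) tensor_assoc_bilin] tens_closed[OF U V]
      tens_ext_tens[OF U V assoc_mods(2) tensor_assoc_bilin0] del: tensor_simps)

end

text \<open>\<open>tensor_alg_homI\<close> reduces the claim to pure tensors of the outer product.
  Their first components are still arbitrary tensors and are reduced in two further rounds.\<close>

lemma tensor_assoc_alg_hom: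
  assumes A: "algebra K A" and B: "algebra K B" and C: "algebra K C"
  shows "tensor_assoc K A B C \<in> alg_hom K (tensor K (tensor K A B) C) (tensor K A (tensor K B C))"
proof -
  interpret A: algebra K A by fact
  interpret B: algebra K B by fact
  interpret C: algebra K C by fact
  note AB = tensor_algebra[OF A B] and BC = tensor_algebra[OF B C]
  interpret AB: algebra K "tensor K A B" by (rule AB)
  interpret T: algebra K "tensor K A (tensor K B C)" by (rule tensor_algebra[OF A BC])
  note mods = A.module B.module C.module
  note lin = tensor_assoc_linear[OF mods]
  let ?f = "tensor_assoc K A B C"
  let ?T = "tensor K A (tensor K B C)"
  note tc = tens_closed[OF mods(1,2)] tens_closed[OF mods(2,3)] tens_closed[OF AB.module mods(3)]
    tens_closed[OF mods(1) tensor_module[OF mods(2,3)]]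
  note tm = tensor_mult_tens[OF A B] tensor_mult_tens[OF B C] tensor_mult_tens[OF A BC]
  note lc = linear_hom_closed[OF lin]
  have fl: "(\<lambda>X. ?f (tens K (tensor K A B) C X c)) \<in> linear_hom K (tensor K A B) ?T" if "c \<in> carrier C" for c
    by (rule linear_hom_comp[OF bilin_map_left[OF tens_bilin[OF AB.module C.module] that] lin])
  note L = bilin_map_left[OF AB.mult_bilin] and R = bilin_map_right[OF AB.mult_bilin]
  note LT = bilin_map_left[OF T.mult_bilin] and RT = bilin_map_right[OF T.mult_bilin]
  note eqI = tensor_hom_eqI[OF A.module B.module T.module]
  \<comment> \<open>Here the left factor has a pure first component; the next step releases
    it.\<close>
  have 1: "?f (tens K (tensor K A B) C (tens K A B a b \<otimes>\<^bsub>tensor K A B\<^esub> Y) (c \<otimes>\<^bsub>C\<^esub> c'))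
      = ?f (tens K (tensor K A B) C (tens K A B a b) c) \<otimes>\<^bsub>?T\<^esub> ?f (tens K (tensor K A B) C Y c')"
    if "a \<in> carrier A" "b \<in> carrier B" "Y \<in> carrier (tensor K A B)" "c \<in> carrier C" "c' \<in> carrier C" for a b Y c c'
    by (rule eqI[OF linear_hom_comp[OF R fl] linear_hom_comp[OF fl RT] _ that(3)])
      (use that in \<open>auto simp: tc lc tm tensor_assoc_tens[OF mods] simp del: tensor_simps\<close>)
  have 2: "?f (tens K (tensor K A B) C (X \<otimes>\<^bsub>tensor K A B\<^esub> Y) (c \<otimes>\<^bsub>C\<^esub> c'))
      = ?f (tens K (tensor K A B) C X c) \<otimes>\<^bsub>?T\<^esub> ?f (tens K (tensor K A B) C Y c')"
    if "X \<in> carrier (tensor K A B)" "Y \<in> carrier (tensor K A B)" "c \<in> carrier C" "c' \<in> carrier C" for X Y c c'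
    by (rule eqI[OF linear_hom_comp[OF L fl] linear_hom_comp[OF fl LT] _ that(1)])
      (use that in \<open>auto simp: tc lc 1 simp del: tensor_simps\<close>)
  show ?thesis
    by (rule tensor_alg_homI[OF AB C tensor_algebra[OF A BC] lin 2])
      (simp_all add: tensor_assoc_tens[OF mods])
qed

lemma scalars_algebra:
  assumes "cring K" shows "algebra K (scalars K)"
proof -
  interpret cring K by fact
  have "cring (scalars K)"
    by (intro cringI abelian_groupI comm_monoidI) (auto simp: scalars_def a_ac m_ac l_distr r_distr intro: exI[of _ "\<ominus>\<^bsub>K\<^esub> _"] l_neg)
  then show ?thesis
    by (intro algebraI is_cring) (auto simp: scalars_def l_distr r_distr m_assoc)
qed

section \<open>Polynomial algebras\<close>

text \<open>The counterpart of \<open>tens_ext_param\<close> for free modules. It makes the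
  polynomial product, a nested free extension, bilinear.\<close>

lemma free_ext_param:
  assumes K: "cring K" and U: "module K U" and Y: "module K Y"
    and lin: "\<And>s. s \<in> S \<Longrightarrow> \<beta> s \<in> linear_hom K Y U"
  shows "bilin_map K (free_mod K S) Y U (\<lambda>x y. free_ext K U (\<lambda>s. \<beta> s y) x)"
proof -
  interpret K: cring K by fact
  interpret Y: module K Y by fact
  let ?F = "\<lambda>x y. free_ext K U (\<lambda>s. \<beta> s y) x"
  have bc: "\<beta> s y \<in> carrier U" if "s \<in> S" "y \<in> carrier Y" for s y
    using linear_hom_closed[OF lin] that by blast
  then have L: "(\<lambda>x. ?F x y) \<in> linear_hom K (free_mod K S) U" if "y \<in> carrier Y" for y
    using that by (intro K.free_ext_linear[OF U]) auto
  have E: "?F (delta K s) y = \<beta> s y" if "s \<in> S" "y \<in> carrier Y" for s y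
    by (rule K.free_ext_delta[OF U]) (rule bc[OF that])
  note eqI = K.free_mod_hom_eqI[OF U]
  have "?F x (y \<oplus>\<^bsub>Y\<^esub> y') = ?F x y \<oplus>\<^bsub>U\<^esub> ?F x y'"
    if "x \<in> carrier (free_mod K S)" "y \<in> carrier Y" "y' \<in> carrier Y" for x y y'
    by (rule eqI[OF L linear_hom_plus[OF U L L] _ that(1)])
      (use that in \<open>auto simp: E linear_hom_add[OF lin]\<close>)
  moreover have "?F x (a \<odot>\<^bsub>Y\<^esub> y) = a \<odot>\<^bsub>U\<^esub> ?F x y"
    if "x \<in> carrier (free_mod K S)" "y \<in> carrier Y" "a \<in> carrier K" for x y a
    by (rule eqI[OF L linear_hom_scale[OF U L] _ that(1)])
      (use that in \<open>auto simp: E linear_hom_smult[OF lin]\<close>)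
  ultimately show ?thesis
    by (intro bilin_mapI) (simp_all only: linear_hom_closed[OF L] linear_hom_add[OF L] linear_hom_smult[OF L])
qed

context
  fixes K :: "('k, 'r) ring_scheme" (structure) and I :: "'i set"
  assumes K: "cring K"
begin

interpretation K: cring K by (rule K)

private abbreviation (input) "M \<equiv> mpoly_alg K I"
private abbreviation (input) "F \<equiv> free_mod K {m. set_mset m \<subseteq> I}"

lemma mpoly_simps:
  "carrier M = carrier F" "zero M = zero F" "add M = add F" "smult M = smult F" "one M = delta K {#}"
  "f \<otimes>\<^bsub>M\<^esub> g = free_ext K F (\<lambda>m. free_ext K F (\<lambda>m'. delta K (m + m')) g) f"
  by (simp_all add: mpoly_alg_def Let_def)

lemma mpoly_module: "module K M"
  by (rule module_surj[OF K.free_mod_module, of id]) (auto simp: mpoly_simps(1-4))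

lemma mpoly_linear_hom: "linear_hom K M U = linear_hom K F U" "linear_hom K U M = linear_hom K U F"
  by (simp_all add: linear_hom_def mpoly_simps(1-4))

lemma mpoly_delta_closed: "set_mset m \<subseteq> I \<Longrightarrow> delta K m \<in> carrier M"
  unfolding mpoly_simps by (rule K.delta_closed) simp

lemma mpoly_hom_eqI:
  assumes "module K U" "f \<in> linear_hom K M U" "g \<in> linear_hom K M U"
    and "\<And>m. set_mset m \<subseteq> I \<Longrightarrow> f (delta K m) = g (delta K m)" and "x \<in> carrier M"
  shows "f x = g x"
  using assms(4) by (intro K.free_mod_hom_eqI[OF assms(1) assms(2,3)[unfolded mpoly_linear_hom] _
    assms(5)[unfolded mpoly_simps]]) auto

lemma mpoly_mult_inner: "set_mset m \<subseteq> I \<Longrightarrow> free_ext K F (\<lambda>m'. delta K (m + m')) \<in> linear_hom K F F"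
  by (rule K.free_ext_linear[OF K.free_mod_module]) (auto intro!: K.delta_closed)

lemma mpoly_mult_bilin: "bilin_map K M M M (monoid.mult M)"
proof -
  have "bilin_map K F F F (\<lambda>f g. free_ext K F (\<lambda>m. free_ext K F (\<lambda>m'. delta K (m + m')) g) f)"
    by (rule free_ext_param[OF K K.free_mod_module K.free_mod_module mpoly_mult_inner]) simp
  moreover have "monoid.mult M = (\<lambda>f g. free_ext K F (\<lambda>m. free_ext K F (\<lambda>m'. delta K (m + m')) g) f)"
    by (rule ext, rule ext, rule mpoly_simps)
  ultimately show ?thesis by (simp add: bilin_map_def mpoly_linear_hom mpoly_simps(1-5))
qed

lemma mpoly_mult_delta:
  assumes "set_mset m \<subseteq> I" "set_mset m' \<subseteq> I"
  shows "delta K m \<otimes>\<^bsub>M\<^esub> delta K m' = delta K (m + m')"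
proof -
  have c: "delta K m'' \<in> carrier F" if "set_mset m'' \<subseteq> I" for m''
    using that by (intro K.delta_closed) simp
  show ?thesis unfolding mpoly_simps using assms
    by (simp add: K.free_ext_delta[OF K.free_mod_module] c linear_hom_closed[OF mpoly_mult_inner] del: free_mod_simps)
qed

text \<open>By bilinearity the laws reduce to monomials, where they are the commutative monoid laws
  of multiset addition.\<close>

lemma mpoly_algebra: "algebra K M"
proof (rule algebra_bilinI[OF mpoly_module mpoly_mult_bilin])
  note L = bilin_map_left[OF mpoly_mult_bilin] and R = bilin_map_right[OF mpoly_mult_bilin]
  note eqI = mpoly_hom_eqI[OF mpoly_module]
  note c = mpoly_delta_closed and d = mpoly_mult_delta
  note mc = bilin_map_closed[OF mpoly_mult_bilin]
  have one: "\<one>\<^bsub>M\<^esub> = delta K {#}" by (rule mpoly_simps)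
  show oneC: "\<one>\<^bsub>M\<^esub> \<in> carrier M" unfolding one by (rule c) auto
  have comm1: "x \<otimes>\<^bsub>M\<^esub> delta K m = delta K m \<otimes>\<^bsub>M\<^esub> x" if "x \<in> carrier M" "set_mset m \<subseteq> I" for x m
    by (rule eqI[OF L R _ that(1)]) (use that in \<open>auto simp: c d union_commute\<close>)
  show "x \<otimes>\<^bsub>M\<^esub> y = y \<otimes>\<^bsub>M\<^esub> x" if "x \<in> carrier M" "y \<in> carrier M" for x y
    by (rule eqI[OF R L _ that(2)]) (use that in \<open>auto simp: comm1\<close>)
  show "\<one>\<^bsub>M\<^esub> \<otimes>\<^bsub>M\<^esub> x = x" if "x \<in> carrier M" for x
    by (rule eqI[OF R linear_hom_id _ that]) (use oneC in \<open>auto simp: c d one\<close>)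
  have as1: "delta K m \<otimes>\<^bsub>M\<^esub> delta K m' \<otimes>\<^bsub>M\<^esub> z = delta K m \<otimes>\<^bsub>M\<^esub> (delta K m' \<otimes>\<^bsub>M\<^esub> z)"
    if "z \<in> carrier M" "set_mset m \<subseteq> I" "set_mset m' \<subseteq> I" for m m' z
    by (rule eqI[OF R linear_hom_comp[OF R R] _ that(1)]) (use that in \<open>auto simp: c d union_assoc\<close>)
  have as2: "delta K m \<otimes>\<^bsub>M\<^esub> y \<otimes>\<^bsub>M\<^esub> z = delta K m \<otimes>\<^bsub>M\<^esub> (y \<otimes>\<^bsub>M\<^esub> z)"
    if "z \<in> carrier M" "set_mset m \<subseteq> I" "y \<in> carrier M" for m y z
    by (rule eqI[OF linear_hom_comp[OF R L] linear_hom_comp[OF L R] _ that(3)])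
      (use that in \<open>auto simp: c as1\<close>)
  show "x \<otimes>\<^bsub>M\<^esub> y \<otimes>\<^bsub>M\<^esub> z = x \<otimes>\<^bsub>M\<^esub> (y \<otimes>\<^bsub>M\<^esub> z)" if "x \<in> carrier M" "y \<in> carrier M" "z \<in> carrier M" for x y z
    by (rule eqI[OF linear_hom_comp[OF L L] L _ that(1)]) (use that in \<open>auto simp: c as2 mc\<close>)
qed

text \<open>Linearity reduces the comparison to monomials, and multiplicativity reduces it to
  variables by induction on the multiset.\<close>

lemma mpoly_alg_hom_eqI:
  assumes B: "algebra K B" and f: "f \<in> alg_hom K M B" and g: "g \<in> alg_hom K M B"
    and eq: "\<And>i. i \<in> I \<Longrightarrow> f (delta K {#i#}) = g (delta K {#i#})" and x: "x \<in> carrier M"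
  shows "f x = g x"
proof (rule mpoly_hom_eqI[OF algebra.module[OF B] alg_hom_linear[OF f] alg_hom_linear[OF g] _ x])
  fix m assume "set_mset m \<subseteq> I"
  then show "f (delta K m) = g (delta K m)"
  proof (induction m)
    case empty
    then show ?case using alg_hom_one[OF f] alg_hom_one[OF g] by (simp add: mpoly_simps)
  next
    case (add i m)
    then have "delta K (add_mset i m) = delta K {#i#} \<otimes>\<^bsub>M\<^esub> delta K m" by (simp add: mpoly_mult_delta)
    then show ?case using add by (simp add: alg_hom_mult[OF f] alg_hom_mult[OF g] mpoly_delta_closed eq)
  qed
qed

lemma mpoly_alg_hom_exists:
  assumes B: "algebra K B" and I: "finite I" and b: "b \<in> I \<rightarrow> carrier B"
  obtains f where "f \<in> alg_hom K M B" "\<And>i. i \<in> I \<Longrightarrow> f (delta K {#i#}) = b i"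
proof -
  interpret B: algebra K B by fact
  interpret M: algebra K M by (rule mpoly_algebra)
  \<comment> \<open>The value of the monomial \<open>m\<close> at \<open>b\<close>. The product runs
    over all of \<open>I\<close>, not over the support of \<open>m\<close>, so that for
    \<open>m + m'\<close> the exponents add factor by factor.\<close>
  define \<phi> where "\<phi> m = (\<Otimes>\<^bsub>B\<^esub>i\<in>I. b i [^]\<^bsub>B\<^esub> count m i)" for m
  have bc: "b i \<in> carrier B" if "i \<in> I" for i using b that by auto
  have phic: "\<phi> m \<in> carrier B" for m unfolding \<phi>_def using bc by (intro B.finprod_closed) auto
  have phi_add: "\<phi> (m + m') = \<phi> m \<otimes>\<^bsub>B\<^esub> \<phi> m'" for m m'
  proof -
    have "\<phi> (m + m') = (\<Otimes>\<^bsub>B\<^esub>i\<in>I. b i [^]\<^bsub>B\<^esub> count m i \<otimes>\<^bsub>B\<^esub> b i [^]\<^bsub>B\<^esub> count m' i)"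
      unfolding \<phi>_def using bc by (intro B.finprod_cong') (auto simp: B.nat_pow_mult)
    also have "\<dots> = \<phi> m \<otimes>\<^bsub>B\<^esub> \<phi> m'" unfolding \<phi>_def using bc by (intro B.finprod_multf) auto
    finally show ?thesis .
  qed
  have phi_single: "\<phi> {#i#} = b i" if i: "i \<in> I" for i
  proof -
    have "\<phi> {#i#} = (\<Otimes>\<^bsub>B\<^esub>j\<in>I. if i = j then b j else \<one>\<^bsub>B\<^esub>)"
      unfolding \<phi>_def using bc i by (intro B.finprod_cong') auto
    also have "\<dots> = b i" using bc I by (intro B.finprod_singleton[OF i]) auto
    finally show ?thesis .
  qed
  have phi_empty: "\<phi> {#} = \<one>\<^bsub>B\<^esub>" unfolding \<phi>_def by (simp add: B.finprod_one_eqI)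
  let ?f = "free_ext K B \<phi>"
  have f: "?f \<in> linear_hom K M B"
    unfolding mpoly_linear_hom using phic by (intro K.free_ext_linear[OF B.module]) auto
  have fd: "?f (delta K m) = \<phi> m" for m by (rule K.free_ext_delta[OF B.module]) (rule phic)
  note eqI = mpoly_hom_eqI[OF B.module]
  note L = bilin_map_left[OF mpoly_mult_bilin] and R = bilin_map_right[OF mpoly_mult_bilin]
  note LB = bilin_map_left[OF B.mult_bilin] and RB = bilin_map_right[OF B.mult_bilin]
  have 1: "?f (delta K m \<otimes>\<^bsub>M\<^esub> y) = ?f (delta K m) \<otimes>\<^bsub>B\<^esub> ?f y" if "set_mset m \<subseteq> I" "y \<in> carrier M" for m y
    by (rule eqI[OF linear_hom_comp[OF R f] linear_hom_comp[OF f RB] _ that(2)])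
      (use that in \<open>auto simp: mpoly_delta_closed fd phic mpoly_mult_delta phi_add\<close>)
  have "?f \<in> alg_hom K M B"
  proof (rule alg_homI[OF f])
    show "?f (x \<otimes>\<^bsub>M\<^esub> y) = ?f x \<otimes>\<^bsub>B\<^esub> ?f y" if "x \<in> carrier M" "y \<in> carrier M" for x y
      by (rule eqI[OF linear_hom_comp[OF L f] linear_hom_comp[OF f LB] _ that(1)])
        (use that in \<open>auto simp: 1 linear_hom_closed[OF f]\<close>)
    show "?f \<one>\<^bsub>M\<^esub> = \<one>\<^bsub>B\<^esub>" unfolding mpoly_simps fd by (rule phi_empty)
  qed
  then show ?thesis using phi_single fd by (intro that[of ?f]) auto
qed

end

section \<open>Maps out of quotient algebras\<close>

lemma alg_hom_kernel_ideal:
  assumes A: "algebra K A" and B: "algebra K B" and f: "f \<in> alg_hom K A B"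
  shows "ideal {x \<in> carrier A. f x = \<zero>\<^bsub>B\<^esub>} A"
proof -
  interpret A: algebra K A by fact
  interpret B: algebra K B by fact
  show ?thesis
    by (rule idealI[OF A.ring_axioms submodule.axioms(1)[OF linear_hom_kernel[OF A.module B.module alg_hom_linear[OF f]]]])
      (auto simp: alg_hom_mult[OF f] alg_hom_closed[OF f])
qed

text \<open>The induced map evaluates \<open>f\<close> at a chosen representative and is restricted
  to the carrier: extensionality is demanded by \<open>coact_hom\<close> and by the descriptions of
  comultiplication and counit.\<close>

lemma (in algebra) quot_alg_hom_exists:
  assumes B: "algebra R B" and I: "ideal I M" and f: "f \<in> alg_hom R M B"
    and null: "\<And>x. x \<in> I \<Longrightarrow> f x = \<zero>\<^bsub>B\<^esub>"
  obtains g where "g \<in> alg_hom R (quot_mod M I) B" "g \<in> extensional (carrier (quot_mod M I))"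
    "\<And>x. x \<in> carrier M \<Longrightarrow> g (I +>\<^bsub>M\<^esub> x) = f x"
proof -
  interpret B: algebra R B by fact
  interpret Q: algebra R "quot_mod M I" by (rule quot_algebra[OF I])
  note S = ideal_submodule[OF I] and p = quot_proj_alg_hom[OF I]
  let ?g = "restrict (\<lambda>X. f (SOME y. y \<in> X)) (carrier (quot_mod M I))"
  note C = alg_hom_closed[OF p]
  have gv: "?g (I +>\<^bsub>M\<^esub> x) = f x" if "x \<in> carrier M" for x
    using C[OF that] quot_some[OF S B.module alg_hom_linear[OF f] null that] by simp
  note car = quot_carrier[OF S]
  note pl = alg_hom_linear[OF p]
  note ps = linear_hom_add[OF pl] linear_hom_smult[OF pl] alg_hom_mult[OF p]
  note fl = alg_hom_linear[OF f]
  have sur: "\<exists>x\<in>carrier M. X = I +>\<^bsub>M\<^esub> x" if "X \<in> carrier (quot_mod M I)" for X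
    using that unfolding car by blast
  have "?g \<in> alg_hom R (quot_mod M I) B"
  proof (rule alg_homI[OF linear_homI])
    fix X assume "X \<in> carrier (quot_mod M I)"
    then obtain x where x: "x \<in> carrier M" "X = I +>\<^bsub>M\<^esub> x" using sur by blast
    show "?g X \<in> carrier B" unfolding x(2) gv[OF x(1)] by (rule alg_hom_closed[OF f x(1)])
    show "?g (a \<odot>\<^bsub>quot_mod M I\<^esub> X) = a \<odot>\<^bsub>B\<^esub> ?g X" if "a \<in> carrier R" for a
      unfolding x(2) gv[OF x(1)] linear_hom_smult[OF pl that x(1), symmetric] gv[OF smult_closed[OF that x(1)]]
      by (rule linear_hom_smult[OF fl that x(1)])
    fix Y assume "Y \<in> carrier (quot_mod M I)"
    then obtain y where y: "y \<in> carrier M" "Y = I +>\<^bsub>M\<^esub> y" using sur by blast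
    show "?g (X \<oplus>\<^bsub>quot_mod M I\<^esub> Y) = ?g X \<oplus>\<^bsub>B\<^esub> ?g Y"
      unfolding x(2) y(2) gv[OF x(1)] gv[OF y(1)] linear_hom_add[OF pl x(1) y(1), symmetric] gv[OF M.a_closed[OF x(1) y(1)]]
      by (rule linear_hom_add[OF fl x(1) y(1)])
    show "?g (X \<otimes>\<^bsub>quot_mod M I\<^esub> Y) = ?g X \<otimes>\<^bsub>B\<^esub> ?g Y"
      unfolding x(2) y(2) gv[OF x(1)] gv[OF y(1)] alg_hom_mult[OF p x(1) y(1), symmetric] gv[OF m_closed[OF x(1) y(1)]]
      by (rule alg_hom_mult[OF f x(1) y(1)])
  next
    show "?g \<one>\<^bsub>quot_mod M I\<^esub> = \<one>\<^bsub>B\<^esub>"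
      unfolding alg_hom_one[OF p, symmetric] gv[OF one_closed] by (rule alg_hom_one[OF f])
  qed
  then show ?thesis using gv by (intro that[of ?g]) auto
qed

section \<open>Coordinates\<close>

context
  fixes K (structure) and V and n :: nat and e
  assumes V: "module K V" and basis: "is_basis K V n e"
begin

interpretation V: module K V by (rule V)

lemma basis_closed: "i \<in> {1..n} \<Longrightarrow> e i \<in> carrier V"
  using basis unfolding is_basis_def by auto

text \<open>\<open>is_basis\<close> expresses independence for vanishing combinations only, so it is
  applied to the differences of the coefficients.\<close>

lemma lin_comb_unique:
  assumes c: "c \<in> {1..n} \<rightarrow> carrier K" and d: "d \<in> {1..n} \<rightarrow> carrier K"
    and eq: "lin_comb V n e c = lin_comb V n e d" and i: "i \<in> {1..n}"
  shows "c i = d i"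
proof -
  have cc: "c j \<in> carrier K" "d j \<in> carrier K" "e j \<in> carrier V" if "j \<in> {1..n}" for j
    using c d basis_closed that by auto
  have "lin_comb V n e (\<lambda>j. c j \<ominus> d j) = (\<Oplus>\<^bsub>V\<^esub>j\<in>{1..n}. c j \<odot>\<^bsub>V\<^esub> e j \<oplus>\<^bsub>V\<^esub> (\<ominus> \<one>) \<odot>\<^bsub>V\<^esub> (d j \<odot>\<^bsub>V\<^esub> e j))"
    unfolding lin_comb_def using cc
    by (intro V.M.finsum_cong') (auto simp: a_minus_def V.smult_l_distr V.smult_l_minus)
  also have "\<dots> = lin_comb V n e c \<oplus>\<^bsub>V\<^esub> (\<ominus> \<one>) \<odot>\<^bsub>V\<^esub> lin_comb V n e d"
    unfolding lin_comb_def using cc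
    by (subst V.finsum_smult_ldistr) (auto intro!: V.M.finsum_addf)
  also have "\<dots> = \<zero>\<^bsub>V\<^esub>"
    unfolding eq unfolding lin_comb_def using cc
    by (subst V.smult_l_minus) (auto simp: V.M.r_neg intro!: V.M.finsum_closed)
  finally have "c i \<ominus> d i = \<zero>"
    using basis i cc unfolding is_basis_def by blast
  then show ?thesis using V.R.minus_zero_imp_eq cc i by blast
qed

lemma coords_eqI:
  assumes c: "c \<in> {1..n} \<rightarrow> carrier K" and i: "i \<in> {1..n}"
  shows "coords K V n e (lin_comb V n e c) i = c i"
proof -
  \<comment> \<open>\<open>coords\<close> is described among extensional functions, so the witness
    must be undefined outside the index range.\<close>
  let ?c = "restrict c {1..n}"
  have lc: "lin_comb V n e ?c = lin_comb V n e c"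
    unfolding lin_comb_def using c basis_closed by (intro V.M.finsum_cong') auto
  have "coords K V n e (lin_comb V n e c) = ?c"
    unfolding coords_def
  proof (rule the_equality)
    show "?c \<in> {1..n} \<rightarrow>\<^sub>E carrier K \<and> lin_comb V n e c = lin_comb V n e ?c"
      using c lc by auto
    fix d assume "d \<in> {1..n} \<rightarrow>\<^sub>E carrier K \<and> lin_comb V n e c = lin_comb V n e d"
    then show "d = ?c"
      using lin_comb_unique[of d c] c
      by (intro extensionalityI[of d "{1..n}"]) (auto simp: PiE_iff Pi_iff)
  qed
  then show ?thesis using i by simp
qed

lemma coords_closed_lin_comb:
  assumes v: "v \<in> carrier V"
  shows "coords K V n e v \<in> {1..n} \<rightarrow> carrier K" "lin_comb V n e (coords K V n e v) = v"
proof -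
  obtain c where c: "c \<in> {1..n} \<rightarrow> carrier K" "v = lin_comb V n e c"
    using basis v unfolding is_basis_def by blast
  then show 1: "coords K V n e v \<in> {1..n} \<rightarrow> carrier K"
    using funcset_mem[OF c(1)] unfolding c(2) by (intro Pi_I) (simp only: coords_eqI[OF c(1)])
  show "lin_comb V n e (coords K V n e v) = v"
    unfolding c(2) lin_comb_def using c(1) 1 coords_eqI[OF c(1)] basis_closed
    unfolding c(2) lin_comb_def by (intro V.M.finsum_cong') auto
qed

lemma coords_closed: "\<lbrakk>v \<in> carrier V; i \<in> {1..n}\<rbrakk> \<Longrightarrow> coords K V n e v i \<in> carrier K"
  using funcset_mem[OF coords_closed_lin_comb(1)] by blast

lemma coords_linear: "i \<in> {1..n} \<Longrightarrow> (\<lambda>v. coords K V n e v i) \<in> linear_hom K V (scalars K)"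
proof (rule linear_homI)
  assume i: "i \<in> {1..n}"
  fix v assume v: "v \<in> carrier V"
  show "coords K V n e v i \<in> carrier (scalars K)" using coords_closed[OF v i] by (simp add: scalars_def)
  {
    fix w assume w: "w \<in> carrier V"
    have "v \<oplus>\<^bsub>V\<^esub> w = lin_comb V n e (coords K V n e v) \<oplus>\<^bsub>V\<^esub> lin_comb V n e (coords K V n e w)"
      using coords_closed_lin_comb(2) v w by simp
    also have "\<dots> = lin_comb V n e (\<lambda>j. coords K V n e v j \<oplus> coords K V n e w j)"
    proof -
      have "lin_comb V n e (\<lambda>j. coords K V n e v j \<oplus> coords K V n e w j)
        = (\<Oplus>\<^bsub>V\<^esub>j\<in>{1..n}. coords K V n e v j \<odot>\<^bsub>V\<^esub> e j \<oplus>\<^bsub>V\<^esub> coords K V n e w j \<odot>\<^bsub>V\<^esub> e j)"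
        unfolding lin_comb_def using coords_closed[OF v] coords_closed[OF w] basis_closed
        by (intro V.M.finsum_cong') (auto simp: V.smult_l_distr)
      also have "\<dots> = lin_comb V n e (coords K V n e v) \<oplus>\<^bsub>V\<^esub> lin_comb V n e (coords K V n e w)"
        unfolding lin_comb_def using coords_closed[OF v] coords_closed[OF w] basis_closed
        by (intro V.M.finsum_addf) auto
      finally show ?thesis by simp
    qed
    finally have "coords K V n e (v \<oplus>\<^bsub>V\<^esub> w) i = coords K V n e v i \<oplus> coords K V n e w i"
      using i coords_closed[OF v] coords_closed[OF w] by (simp add: coords_eqI)
    then show "coords K V n e (v \<oplus>\<^bsub>V\<^esub> w) i = coords K V n e v i \<oplus>\<^bsub>scalars K\<^esub> coords K V n e w i"
      by (simp add: scalars_def)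
  }
  fix a assume a: "a \<in> carrier K"
  have "a \<odot>\<^bsub>V\<^esub> v = a \<odot>\<^bsub>V\<^esub> lin_comb V n e (coords K V n e v)"
    using coords_closed_lin_comb(2) v by simp
  also have "\<dots> = (\<Oplus>\<^bsub>V\<^esub>j\<in>{1..n}. a \<odot>\<^bsub>V\<^esub> (coords K V n e v j \<odot>\<^bsub>V\<^esub> e j))"
    unfolding lin_comb_def using a coords_closed[OF v] basis_closed by (intro V.finsum_smult_ldistr) auto
  also have "\<dots> = lin_comb V n e (\<lambda>j. a \<otimes> coords K V n e v j)"
    unfolding lin_comb_def using a coords_closed[OF v] basis_closed
    by (intro V.M.finsum_cong') (auto simp: V.smult_assoc1)
  finally have "coords K V n e (a \<odot>\<^bsub>V\<^esub> v) i = a \<otimes> coords K V n e v i"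
    using i a coords_closed[OF v] by (simp add: coords_eqI)
  then show "coords K V n e (a \<odot>\<^bsub>V\<^esub> v) i = a \<odot>\<^bsub>scalars K\<^esub> coords K V n e v i"
    by (simp add: scalars_def)
qed

lemma coords_basis:
  assumes "i \<in> {1..n}" "j \<in> {1..n}"
  shows "coords K V n e (e i) j = (if i = j then \<one> else \<zero>)"
proof -
  have "lin_comb V n e (\<lambda>j. if i = j then \<one> else \<zero>) = (\<Oplus>\<^bsub>V\<^esub>j\<in>{1..n}. if i = j then e j else \<zero>\<^bsub>V\<^esub>)"
    unfolding lin_comb_def using basis_closed by (intro V.M.finsum_cong') auto
  also have "\<dots> = e i" using basis_closed assms by (intro V.M.finsum_singleton) auto
  finally have "coords K V n e (e i) j = coords K V n e (lin_comb V n e (\<lambda>j. if i = j then \<one> else \<zero>)) j" by simp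
  also have "\<dots> = (if i = j then \<one> else \<zero>)" using assms by (intro coords_eqI) auto
  finally show ?thesis .
qed

lemma basis_hom_eqI:
  assumes U: "module K U" and f: "f \<in> linear_hom K V U" and g: "g \<in> linear_hom K V U"
    and eq: "\<And>i. i \<in> {1..n} \<Longrightarrow> f (e i) = g (e i)" and v: "v \<in> carrier V"
  shows "f v = g v"
proof -
  interpret U: module K U by fact
  have "h v = (\<Oplus>\<^bsub>U\<^esub>i\<in>{1..n}. coords K V n e v i \<odot>\<^bsub>U\<^esub> h (e i))" if h: "h \<in> linear_hom K V U" for h
  proof -
    have "h v = h (lin_comb V n e (coords K V n e v))" using coords_closed_lin_comb(2)[OF v] by simp
    also have "\<dots> = (\<Oplus>\<^bsub>U\<^esub>i\<in>{1..n}. h (coords K V n e v i \<odot>\<^bsub>V\<^esub> e i))"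
      unfolding lin_comb_def using coords_closed[OF v] basis_closed by (intro linear_hom_finsum[OF V U h]) auto
    also have "\<dots> = (\<Oplus>\<^bsub>U\<^esub>i\<in>{1..n}. coords K V n e v i \<odot>\<^bsub>U\<^esub> h (e i))"
      using coords_closed[OF v] basis_closed linear_hom_closed[OF h]
      by (intro U.M.finsum_cong') (auto simp: linear_hom_smult[OF h])
    finally show ?thesis .
  qed
  note this[OF f] this[OF g]
  moreover have "(\<Oplus>\<^bsub>U\<^esub>i\<in>{1..n}. coords K V n e v i \<odot>\<^bsub>U\<^esub> f (e i)) = (\<Oplus>\<^bsub>U\<^esub>i\<in>{1..n}. coords K V n e v i \<odot>\<^bsub>U\<^esub> g (e i))"
    using coords_closed[OF v] basis_closed linear_hom_closed[OF g] eq
    by (intro U.M.finsum_cong') auto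
  ultimately show ?thesis by simp
qed

end

section \<open>Matrices compatible with structure constants\<close>

text \<open>For structure constants \<open>g\<close> this one predicate expresses the defining
  relations of the universal algebra, the condition for an algebra map out of it, and the
  multiplicativity of a coaction. With \<open>g\<close> as parameter it covers the associative
  product and the bracket alike.\<close>

definition struct_rel ::
  "('k, 'r) ring_scheme \<Rightarrow> nat set \<Rightarrow> (nat \<Rightarrow> nat \<Rightarrow> nat \<Rightarrow> 'k) \<Rightarrow> ('k, 'b, 'm) module_scheme
    \<Rightarrow> (nat \<Rightarrow> nat \<Rightarrow> 'b) \<Rightarrow> bool"
  where "struct_rel K J g B y \<longleftrightarrow> (\<forall>a\<in>J. \<forall>i\<in>J. \<forall>j\<in>J.
    (\<Oplus>\<^bsub>B\<^esub>u\<in>J. g i j u \<odot>\<^bsub>B\<^esub> y a u) = (\<Oplus>\<^bsub>B\<^esub>s\<in>J. \<Oplus>\<^bsub>B\<^esub>t\<in>J. g s t a \<odot>\<^bsub>B\<^esub> (y s i \<otimes>\<^bsub>B\<^esub> y t j)))"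

lemma (in abelian_monoid) finsum_rotate:
  assumes "finite I" "finite J" "finite L" and f: "\<And>i j l. \<lbrakk>i \<in> I; j \<in> J; l \<in> L\<rbrakk> \<Longrightarrow> f i j l \<in> carrier G"
  shows "(\<Oplus>i\<in>I. \<Oplus>j\<in>J. \<Oplus>l\<in>L. f i j l) = (\<Oplus>j\<in>J. \<Oplus>l\<in>L. \<Oplus>i\<in>I. f i j l)"
proof -
  have "(\<Oplus>i\<in>I. \<Oplus>j\<in>J. \<Oplus>l\<in>L. f i j l) = (\<Oplus>j\<in>J. \<Oplus>i\<in>I. \<Oplus>l\<in>L. f i j l)"
    using assms by (intro finsum_swap finsum_closed) auto
  also have "\<dots> = (\<Oplus>j\<in>J. \<Oplus>l\<in>L. \<Oplus>i\<in>I. f i j l)"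
    using assms by (intro finsum_cong' refl finsum_swap Pi_I finsum_closed) auto
  finally show ?thesis .
qed

lemma (in abelian_monoid) finsum_swap_pairs:
  assumes "finite I" "finite J" and f: "\<And>i j l m. \<lbrakk>i \<in> I; j \<in> I; l \<in> J; m \<in> J\<rbrakk> \<Longrightarrow> f i j l m \<in> carrier G"
  shows "(\<Oplus>i\<in>I. \<Oplus>j\<in>I. \<Oplus>l\<in>J. \<Oplus>m\<in>J. f i j l m) = (\<Oplus>l\<in>J. \<Oplus>m\<in>J. \<Oplus>i\<in>I. \<Oplus>j\<in>I. f i j l m)"
proof -
  have "(\<Oplus>i\<in>I. \<Oplus>j\<in>I. \<Oplus>l\<in>J. \<Oplus>m\<in>J. f i j l m) = (\<Oplus>i\<in>I. \<Oplus>l\<in>J. \<Oplus>m\<in>J. \<Oplus>j\<in>I. f i j l m)"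
    using assms by (intro finsum_cong' refl finsum_rotate Pi_I finsum_closed) auto
  also have "\<dots> = (\<Oplus>l\<in>J. \<Oplus>m\<in>J. \<Oplus>i\<in>I. \<Oplus>j\<in>I. f i j l m)"
    using assms by (intro finsum_rotate finsum_closed) auto
  finally show ?thesis .
qed

context algebra
begin

lemma smult_assoc2_right:
  "\<lbrakk>a \<in> carrier R; x \<in> carrier M; y \<in> carrier M\<rbrakk> \<Longrightarrow> x \<otimes>\<^bsub>M\<^esub> (a \<odot>\<^bsub>M\<^esub> y) = a \<odot>\<^bsub>M\<^esub> (x \<otimes>\<^bsub>M\<^esub> y)"
  by (rule bilin_map_smult_right[OF mult_bilin])

lemma finsum_mult_finsum:
  assumes "finite I" "finite J" "\<And>i. i \<in> I \<Longrightarrow> f i \<in> carrier M" "\<And>j. j \<in> J \<Longrightarrow> h j \<in> carrier M"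
  shows "(\<Oplus>\<^bsub>M\<^esub>i\<in>I. f i) \<otimes>\<^bsub>M\<^esub> (\<Oplus>\<^bsub>M\<^esub>j\<in>J. h j) = (\<Oplus>\<^bsub>M\<^esub>i\<in>I. \<Oplus>\<^bsub>M\<^esub>j\<in>J. f i \<otimes>\<^bsub>M\<^esub> h j)"
proof -
  have "(\<Oplus>\<^bsub>M\<^esub>i\<in>I. f i) \<otimes>\<^bsub>M\<^esub> (\<Oplus>\<^bsub>M\<^esub>j\<in>J. h j) = (\<Oplus>\<^bsub>M\<^esub>i\<in>I. f i \<otimes>\<^bsub>M\<^esub> (\<Oplus>\<^bsub>M\<^esub>j\<in>J. h j))"
    using assms by (intro finsum_ldistr M.finsum_closed) auto
  also have "\<dots> = (\<Oplus>\<^bsub>M\<^esub>i\<in>I. \<Oplus>\<^bsub>M\<^esub>j\<in>J. f i \<otimes>\<^bsub>M\<^esub> h j)"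
    using assms by (intro M.finsum_cong' refl finsum_rdistr Pi_I M.finsum_closed m_closed) auto
  finally show ?thesis .
qed

lemma struct_rel_cong:
  assumes g: "\<And>i j u. \<lbrakk>i \<in> J; j \<in> J; u \<in> J\<rbrakk> \<Longrightarrow> g i j u \<in> carrier R"
    and y: "\<And>i j. \<lbrakk>i \<in> J; j \<in> J\<rbrakk> \<Longrightarrow> y i j \<in> carrier M" and eq: "\<And>i j. \<lbrakk>i \<in> J; j \<in> J\<rbrakk> \<Longrightarrow> z i j = y i j"
    and r: "struct_rel R J g M y"
  shows "struct_rel R J g M z"
  unfolding struct_rel_def
proof (intro ballI)
  fix a i j assume a: "a \<in> J" "i \<in> J" "j \<in> J"
  have "(\<Oplus>\<^bsub>M\<^esub>u\<in>J. g i j u \<odot>\<^bsub>M\<^esub> z a u) = (\<Oplus>\<^bsub>M\<^esub>u\<in>J. g i j u \<odot>\<^bsub>M\<^esub> y a u)"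
    using a g y eq by (intro M.finsum_cong'[OF refl]) auto
  moreover have "(\<Oplus>\<^bsub>M\<^esub>s\<in>J. \<Oplus>\<^bsub>M\<^esub>t\<in>J. g s t a \<odot>\<^bsub>M\<^esub> (z s i \<otimes>\<^bsub>M\<^esub> z t j))
      = (\<Oplus>\<^bsub>M\<^esub>s\<in>J. \<Oplus>\<^bsub>M\<^esub>t\<in>J. g s t a \<odot>\<^bsub>M\<^esub> (y s i \<otimes>\<^bsub>M\<^esub> y t j))"
    using a g y eq by (intro M.finsum_cong' refl Pi_I M.finsum_closed) auto
  ultimately show "(\<Oplus>\<^bsub>M\<^esub>u\<in>J. g i j u \<odot>\<^bsub>M\<^esub> z a u) = (\<Oplus>\<^bsub>M\<^esub>s\<in>J. \<Oplus>\<^bsub>M\<^esub>t\<in>J. g s t a \<odot>\<^bsub>M\<^esub> (z s i \<otimes>\<^bsub>M\<^esub> z t j))"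
    using r a by (simp add: struct_rel_def)
qed

text \<open>Compatible matrices correspond to multiplicative maps, so the product, which corresponds to
  the composite, is again compatible.\<close>

lemma struct_rel_mult:
  assumes J: "finite J" and g: "\<And>i j u. \<lbrakk>i \<in> J; j \<in> J; u \<in> J\<rbrakk> \<Longrightarrow> g i j u \<in> carrier R"
    and y: "\<And>i j. \<lbrakk>i \<in> J; j \<in> J\<rbrakk> \<Longrightarrow> y i j \<in> carrier M" and z: "\<And>i j. \<lbrakk>i \<in> J; j \<in> J\<rbrakk> \<Longrightarrow> z i j \<in> carrier M"
    and ry: "struct_rel R J g M y" and rz: "struct_rel R J g M z"
  shows "struct_rel R J g M (\<lambda>i j. \<Oplus>\<^bsub>M\<^esub>s\<in>J. y i s \<otimes>\<^bsub>M\<^esub> z s j)"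
  unfolding struct_rel_def
proof (intro ballI)
  fix a i j assume a: "a \<in> J" and i: "i \<in> J" and j: "j \<in> J"
  note cl [simp] = a i j g y z
  note cI = M.finsum_cong' refl Pi_I M.finsum_closed smult_closed m_closed
  have "(\<Oplus>\<^bsub>M\<^esub>u\<in>J. g i j u \<odot>\<^bsub>M\<^esub> (\<Oplus>\<^bsub>M\<^esub>s\<in>J. y a s \<otimes>\<^bsub>M\<^esub> z s u))
      = (\<Oplus>\<^bsub>M\<^esub>u\<in>J. \<Oplus>\<^bsub>M\<^esub>s\<in>J. g i j u \<odot>\<^bsub>M\<^esub> (y a s \<otimes>\<^bsub>M\<^esub> z s u))"
    using J by (intro cI finsum_smult_ldistr) auto
  also have "\<dots> = (\<Oplus>\<^bsub>M\<^esub>s\<in>J. \<Oplus>\<^bsub>M\<^esub>u\<in>J. g i j u \<odot>\<^bsub>M\<^esub> (y a s \<otimes>\<^bsub>M\<^esub> z s u))"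
    using J by (intro M.finsum_swap) auto
  also have "\<dots> = (\<Oplus>\<^bsub>M\<^esub>s\<in>J. y a s \<otimes>\<^bsub>M\<^esub> (\<Oplus>\<^bsub>M\<^esub>u\<in>J. g i j u \<odot>\<^bsub>M\<^esub> z s u))"
    using J by (intro cI) (auto simp: finsum_rdistr smult_assoc2_right intro!: cI)
  \<comment> \<open>Inserting the relation for \<open>z\<close> makes the sum over \<open>s\<close>
    of \<open>g p q s\<close> times \<open>y a s\<close> appear. This is the left side of the
    relation for \<open>y\<close>; the regrouping that follows isolates it.\<close>
  also have "\<dots> = (\<Oplus>\<^bsub>M\<^esub>s\<in>J. y a s \<otimes>\<^bsub>M\<^esub> (\<Oplus>\<^bsub>M\<^esub>p\<in>J. \<Oplus>\<^bsub>M\<^esub>q\<in>J. g p q s \<odot>\<^bsub>M\<^esub> (z p i \<otimes>\<^bsub>M\<^esub> z q j)))"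
    using rz by (intro cI) (auto simp: struct_rel_def)
  also have "\<dots> = (\<Oplus>\<^bsub>M\<^esub>s\<in>J. \<Oplus>\<^bsub>M\<^esub>p\<in>J. \<Oplus>\<^bsub>M\<^esub>q\<in>J. (g p q s \<odot>\<^bsub>M\<^esub> y a s) \<otimes>\<^bsub>M\<^esub> (z p i \<otimes>\<^bsub>M\<^esub> z q j))"
  proof (intro cI)
    fix s assume s [simp]: "s \<in> J"
    have "y a s \<otimes>\<^bsub>M\<^esub> (\<Oplus>\<^bsub>M\<^esub>p\<in>J. \<Oplus>\<^bsub>M\<^esub>q\<in>J. g p q s \<odot>\<^bsub>M\<^esub> (z p i \<otimes>\<^bsub>M\<^esub> z q j))
      = (\<Oplus>\<^bsub>M\<^esub>p\<in>J. y a s \<otimes>\<^bsub>M\<^esub> (\<Oplus>\<^bsub>M\<^esub>q\<in>J. g p q s \<odot>\<^bsub>M\<^esub> (z p i \<otimes>\<^bsub>M\<^esub> z q j)))"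
      using J by (intro finsum_rdistr cI) auto
    also have "\<dots> = (\<Oplus>\<^bsub>M\<^esub>p\<in>J. \<Oplus>\<^bsub>M\<^esub>q\<in>J. (g p q s \<odot>\<^bsub>M\<^esub> y a s) \<otimes>\<^bsub>M\<^esub> (z p i \<otimes>\<^bsub>M\<^esub> z q j))"
    proof (intro cI)
      fix p assume p [simp]: "p \<in> J"
      have "y a s \<otimes>\<^bsub>M\<^esub> (\<Oplus>\<^bsub>M\<^esub>q\<in>J. g p q s \<odot>\<^bsub>M\<^esub> (z p i \<otimes>\<^bsub>M\<^esub> z q j))
        = (\<Oplus>\<^bsub>M\<^esub>q\<in>J. y a s \<otimes>\<^bsub>M\<^esub> (g p q s \<odot>\<^bsub>M\<^esub> (z p i \<otimes>\<^bsub>M\<^esub> z q j)))"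
        using J by (intro finsum_rdistr cI) auto
      also have "\<dots> = (\<Oplus>\<^bsub>M\<^esub>q\<in>J. (g p q s \<odot>\<^bsub>M\<^esub> y a s) \<otimes>\<^bsub>M\<^esub> (z p i \<otimes>\<^bsub>M\<^esub> z q j))"
        by (intro cI) (auto simp: smult_assoc2 smult_assoc2_right)
      finally show "y a s \<otimes>\<^bsub>M\<^esub> (\<Oplus>\<^bsub>M\<^esub>q\<in>J. g p q s \<odot>\<^bsub>M\<^esub> (z p i \<otimes>\<^bsub>M\<^esub> z q j))
        = (\<Oplus>\<^bsub>M\<^esub>q\<in>J. (g p q s \<odot>\<^bsub>M\<^esub> y a s) \<otimes>\<^bsub>M\<^esub> (z p i \<otimes>\<^bsub>M\<^esub> z q j))" .
    qed auto
    finally show "y a s \<otimes>\<^bsub>M\<^esub> (\<Oplus>\<^bsub>M\<^esub>p\<in>J. \<Oplus>\<^bsub>M\<^esub>q\<in>J. g p q s \<odot>\<^bsub>M\<^esub> (z p i \<otimes>\<^bsub>M\<^esub> z q j))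
      = (\<Oplus>\<^bsub>M\<^esub>p\<in>J. \<Oplus>\<^bsub>M\<^esub>q\<in>J. (g p q s \<odot>\<^bsub>M\<^esub> y a s) \<otimes>\<^bsub>M\<^esub> (z p i \<otimes>\<^bsub>M\<^esub> z q j))" .
  qed auto
  also have "\<dots> = (\<Oplus>\<^bsub>M\<^esub>p\<in>J. \<Oplus>\<^bsub>M\<^esub>q\<in>J. \<Oplus>\<^bsub>M\<^esub>s\<in>J. (g p q s \<odot>\<^bsub>M\<^esub> y a s) \<otimes>\<^bsub>M\<^esub> (z p i \<otimes>\<^bsub>M\<^esub> z q j))"
    using J by (intro M.finsum_rotate) auto
  also have "\<dots> = (\<Oplus>\<^bsub>M\<^esub>p\<in>J. \<Oplus>\<^bsub>M\<^esub>q\<in>J. (\<Oplus>\<^bsub>M\<^esub>s\<in>J. g p q s \<odot>\<^bsub>M\<^esub> y a s) \<otimes>\<^bsub>M\<^esub> (z p i \<otimes>\<^bsub>M\<^esub> z q j))"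
    using J by (intro cI finsum_ldistr[symmetric]) auto
  also have "\<dots> = (\<Oplus>\<^bsub>M\<^esub>p\<in>J. \<Oplus>\<^bsub>M\<^esub>q\<in>J.
      (\<Oplus>\<^bsub>M\<^esub>c\<in>J. \<Oplus>\<^bsub>M\<^esub>d\<in>J. g c d a \<odot>\<^bsub>M\<^esub> (y c p \<otimes>\<^bsub>M\<^esub> y d q)) \<otimes>\<^bsub>M\<^esub> (z p i \<otimes>\<^bsub>M\<^esub> z q j))"
    using ry by (intro cI) (auto simp: struct_rel_def)
  also have "\<dots> = (\<Oplus>\<^bsub>M\<^esub>p\<in>J. \<Oplus>\<^bsub>M\<^esub>q\<in>J. \<Oplus>\<^bsub>M\<^esub>c\<in>J. \<Oplus>\<^bsub>M\<^esub>d\<in>J.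
      g c d a \<odot>\<^bsub>M\<^esub> ((y c p \<otimes>\<^bsub>M\<^esub> z p i) \<otimes>\<^bsub>M\<^esub> (y d q \<otimes>\<^bsub>M\<^esub> z q j)))"
  proof (intro M.finsum_cong'[OF refl])
    fix p q assume [simp]: "p \<in> J" "q \<in> J"
    have "(\<Oplus>\<^bsub>M\<^esub>c\<in>J. \<Oplus>\<^bsub>M\<^esub>d\<in>J. g c d a \<odot>\<^bsub>M\<^esub> (y c p \<otimes>\<^bsub>M\<^esub> y d q)) \<otimes>\<^bsub>M\<^esub> (z p i \<otimes>\<^bsub>M\<^esub> z q j)
      = (\<Oplus>\<^bsub>M\<^esub>c\<in>J. (\<Oplus>\<^bsub>M\<^esub>d\<in>J. g c d a \<odot>\<^bsub>M\<^esub> (y c p \<otimes>\<^bsub>M\<^esub> y d q)) \<otimes>\<^bsub>M\<^esub> (z p i \<otimes>\<^bsub>M\<^esub> z q j))"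
      using J by (intro finsum_ldistr cI) auto
    also have "\<dots> = (\<Oplus>\<^bsub>M\<^esub>c\<in>J. \<Oplus>\<^bsub>M\<^esub>d\<in>J. (g c d a \<odot>\<^bsub>M\<^esub> (y c p \<otimes>\<^bsub>M\<^esub> y d q)) \<otimes>\<^bsub>M\<^esub> (z p i \<otimes>\<^bsub>M\<^esub> z q j))"
      using J by (intro cI finsum_ldistr) auto
    \<comment> \<open>Commutativity of the algebra is what lets \<open>y d q\<close> and
      \<open>z p i\<close> change places.\<close>
    also have "\<dots> = (\<Oplus>\<^bsub>M\<^esub>c\<in>J. \<Oplus>\<^bsub>M\<^esub>d\<in>J. g c d a \<odot>\<^bsub>M\<^esub> ((y c p \<otimes>\<^bsub>M\<^esub> z p i) \<otimes>\<^bsub>M\<^esub> (y d q \<otimes>\<^bsub>M\<^esub> z q j)))"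
      by (intro cI) (simp_all add: smult_assoc2, simp add: m_ac)
    finally show "(\<Oplus>\<^bsub>M\<^esub>c\<in>J. \<Oplus>\<^bsub>M\<^esub>d\<in>J. g c d a \<odot>\<^bsub>M\<^esub> (y c p \<otimes>\<^bsub>M\<^esub> y d q)) \<otimes>\<^bsub>M\<^esub> (z p i \<otimes>\<^bsub>M\<^esub> z q j)
      = (\<Oplus>\<^bsub>M\<^esub>c\<in>J. \<Oplus>\<^bsub>M\<^esub>d\<in>J. g c d a \<odot>\<^bsub>M\<^esub> ((y c p \<otimes>\<^bsub>M\<^esub> z p i) \<otimes>\<^bsub>M\<^esub> (y d q \<otimes>\<^bsub>M\<^esub> z q j)))" .
  qed (auto intro!: cI)
  also have "\<dots> = (\<Oplus>\<^bsub>M\<^esub>c\<in>J. \<Oplus>\<^bsub>M\<^esub>d\<in>J. \<Oplus>\<^bsub>M\<^esub>p\<in>J. \<Oplus>\<^bsub>M\<^esub>q\<in>J.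
      g c d a \<odot>\<^bsub>M\<^esub> ((y c p \<otimes>\<^bsub>M\<^esub> z p i) \<otimes>\<^bsub>M\<^esub> (y d q \<otimes>\<^bsub>M\<^esub> z q j)))"
    using J by (intro M.finsum_swap_pairs) auto
  also have "\<dots> = (\<Oplus>\<^bsub>M\<^esub>c\<in>J. \<Oplus>\<^bsub>M\<^esub>d\<in>J. g c d a \<odot>\<^bsub>M\<^esub>
      ((\<Oplus>\<^bsub>M\<^esub>p\<in>J. y c p \<otimes>\<^bsub>M\<^esub> z p i) \<otimes>\<^bsub>M\<^esub> (\<Oplus>\<^bsub>M\<^esub>q\<in>J. y d q \<otimes>\<^bsub>M\<^esub> z q j)))"
  proof (intro M.finsum_cong'[OF refl])
    fix c d assume [simp]: "c \<in> J" "d \<in> J"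
    have "(\<Oplus>\<^bsub>M\<^esub>p\<in>J. \<Oplus>\<^bsub>M\<^esub>q\<in>J. g c d a \<odot>\<^bsub>M\<^esub> ((y c p \<otimes>\<^bsub>M\<^esub> z p i) \<otimes>\<^bsub>M\<^esub> (y d q \<otimes>\<^bsub>M\<^esub> z q j)))
      = (\<Oplus>\<^bsub>M\<^esub>p\<in>J. g c d a \<odot>\<^bsub>M\<^esub> (\<Oplus>\<^bsub>M\<^esub>q\<in>J. (y c p \<otimes>\<^bsub>M\<^esub> z p i) \<otimes>\<^bsub>M\<^esub> (y d q \<otimes>\<^bsub>M\<^esub> z q j)))"
      using J by (intro cI finsum_smult_ldistr[symmetric]) auto
    also have "\<dots> = g c d a \<odot>\<^bsub>M\<^esub> (\<Oplus>\<^bsub>M\<^esub>p\<in>J. \<Oplus>\<^bsub>M\<^esub>q\<in>J. (y c p \<otimes>\<^bsub>M\<^esub> z p i) \<otimes>\<^bsub>M\<^esub> (y d q \<otimes>\<^bsub>M\<^esub> z q j))"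
      using J by (intro finsum_smult_ldistr[symmetric] cI) auto
    also have "\<dots> = g c d a \<odot>\<^bsub>M\<^esub> ((\<Oplus>\<^bsub>M\<^esub>p\<in>J. y c p \<otimes>\<^bsub>M\<^esub> z p i) \<otimes>\<^bsub>M\<^esub> (\<Oplus>\<^bsub>M\<^esub>q\<in>J. y d q \<otimes>\<^bsub>M\<^esub> z q j))"
      using J by (simp add: finsum_mult_finsum)
    finally show "(\<Oplus>\<^bsub>M\<^esub>p\<in>J. \<Oplus>\<^bsub>M\<^esub>q\<in>J. g c d a \<odot>\<^bsub>M\<^esub> ((y c p \<otimes>\<^bsub>M\<^esub> z p i) \<otimes>\<^bsub>M\<^esub> (y d q \<otimes>\<^bsub>M\<^esub> z q j)))
      = g c d a \<odot>\<^bsub>M\<^esub> ((\<Oplus>\<^bsub>M\<^esub>p\<in>J. y c p \<otimes>\<^bsub>M\<^esub> z p i) \<otimes>\<^bsub>M\<^esub> (\<Oplus>\<^bsub>M\<^esub>q\<in>J. y d q \<otimes>\<^bsub>M\<^esub> z q j))" .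
  qed (auto intro!: cI)
  finally show "(\<Oplus>\<^bsub>M\<^esub>u\<in>J. g i j u \<odot>\<^bsub>M\<^esub> (\<Oplus>\<^bsub>M\<^esub>s\<in>J. y a s \<otimes>\<^bsub>M\<^esub> z s u))
    = (\<Oplus>\<^bsub>M\<^esub>c\<in>J. \<Oplus>\<^bsub>M\<^esub>d\<in>J. g c d a \<odot>\<^bsub>M\<^esub>
      ((\<Oplus>\<^bsub>M\<^esub>p\<in>J. y c p \<otimes>\<^bsub>M\<^esub> z p i) \<otimes>\<^bsub>M\<^esub> (\<Oplus>\<^bsub>M\<^esub>q\<in>J. y d q \<otimes>\<^bsub>M\<^esub> z q j)))" .
qed

end

context
  fixes K (structure) and B and C and f and J :: "nat set" and g and y
  assumes B: "algebra K B" and C: "algebra K C" and f: "f \<in> alg_hom K B C" and J: "finite J"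
    and g: "\<And>i j u. \<lbrakk>i \<in> J; j \<in> J; u \<in> J\<rbrakk> \<Longrightarrow> g i j u \<in> carrier K"
    and y: "\<And>i j. \<lbrakk>i \<in> J; j \<in> J\<rbrakk> \<Longrightarrow> y i j \<in> carrier B"
begin

interpretation B: algebra K B by (rule B)
interpretation C: algebra K C by (rule C)

text \<open>The two sides are transported separately, without assuming them equal. For the variables
  of the polynomial algebra they are different elements, and their images under an evaluation are
  still needed.\<close>

lemma struct_rel_sums_hom:
  assumes "a \<in> J" "i \<in> J" "j \<in> J"
  shows "f (\<Oplus>\<^bsub>B\<^esub>u\<in>J. g i j u \<odot>\<^bsub>B\<^esub> y a u) = (\<Oplus>\<^bsub>C\<^esub>u\<in>J. g i j u \<odot>\<^bsub>C\<^esub> f (y a u))"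
    and "f (\<Oplus>\<^bsub>B\<^esub>s\<in>J. \<Oplus>\<^bsub>B\<^esub>t\<in>J. g s t a \<odot>\<^bsub>B\<^esub> (y s i \<otimes>\<^bsub>B\<^esub> y t j))
      = (\<Oplus>\<^bsub>C\<^esub>s\<in>J. \<Oplus>\<^bsub>C\<^esub>t\<in>J. g s t a \<odot>\<^bsub>C\<^esub> (f (y s i) \<otimes>\<^bsub>C\<^esub> f (y t j)))"
proof -
  note l = alg_hom_linear[OF f]
  note sum = linear_hom_finsum[OF B.module C.module l J]
  note fc = alg_hom_closed[OF f]
  show "f (\<Oplus>\<^bsub>B\<^esub>u\<in>J. g i j u \<odot>\<^bsub>B\<^esub> y a u) = (\<Oplus>\<^bsub>C\<^esub>u\<in>J. g i j u \<odot>\<^bsub>C\<^esub> f (y a u))"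
    by (subst sum) (use g y fc assms in \<open>auto intro!: C.M.finsum_cong' simp: linear_hom_smult[OF l]\<close>)
  have "f (\<Oplus>\<^bsub>B\<^esub>s\<in>J. \<Oplus>\<^bsub>B\<^esub>t\<in>J. g s t a \<odot>\<^bsub>B\<^esub> (y s i \<otimes>\<^bsub>B\<^esub> y t j))
      = (\<Oplus>\<^bsub>C\<^esub>s\<in>J. f (\<Oplus>\<^bsub>B\<^esub>t\<in>J. g s t a \<odot>\<^bsub>B\<^esub> (y s i \<otimes>\<^bsub>B\<^esub> y t j)))"
    using g y assms by (intro sum) (auto intro!: B.M.finsum_closed)
  also have "\<dots> = (\<Oplus>\<^bsub>C\<^esub>s\<in>J. \<Oplus>\<^bsub>C\<^esub>t\<in>J. g s t a \<odot>\<^bsub>C\<^esub> (f (y s i) \<otimes>\<^bsub>C\<^esub> f (y t j)))"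
  proof (intro C.M.finsum_cong'[OF refl])
    fix s assume s: "s \<in> J"
    show "f (\<Oplus>\<^bsub>B\<^esub>t\<in>J. g s t a \<odot>\<^bsub>B\<^esub> (y s i \<otimes>\<^bsub>B\<^esub> y t j)) = (\<Oplus>\<^bsub>C\<^esub>t\<in>J. g s t a \<odot>\<^bsub>C\<^esub> (f (y s i) \<otimes>\<^bsub>C\<^esub> f (y t j)))"
      by (subst sum) (use g y fc assms s in \<open>auto intro!: C.M.finsum_cong' simp: linear_hom_smult[OF l] alg_hom_mult[OF f]\<close>)
  qed (use g y fc assms in \<open>auto intro!: C.M.finsum_closed\<close>)
  finally show "f (\<Oplus>\<^bsub>B\<^esub>s\<in>J. \<Oplus>\<^bsub>B\<^esub>t\<in>J. g s t a \<odot>\<^bsub>B\<^esub> (y s i \<otimes>\<^bsub>B\<^esub> y t j))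
      = (\<Oplus>\<^bsub>C\<^esub>s\<in>J. \<Oplus>\<^bsub>C\<^esub>t\<in>J. g s t a \<odot>\<^bsub>C\<^esub> (f (y s i) \<otimes>\<^bsub>C\<^esub> f (y t j)))" .
qed

lemma struct_rel_hom: "struct_rel K J g B y \<Longrightarrow> struct_rel K J g C (\<lambda>i j. f (y i j))"
  unfolding struct_rel_def by (simp add: struct_rel_sums_hom[symmetric])

end

text \<open>The identity matrix belongs to the identity map of the algebra with structure constants
  \<open>g\<close>; both sides collapse to \<open>g i j a\<close>. It becomes the matrix of values
  of the counit.\<close>

lemma (in cring) struct_rel_unit:
  assumes J: "finite J" and g: "\<And>i j u. \<lbrakk>i \<in> J; j \<in> J; u \<in> J\<rbrakk> \<Longrightarrow> g i j u \<in> carrier R"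
  shows "struct_rel R J g (scalars R) (\<lambda>i j. if i = j then \<one> else \<zero>)"
proof -
  interpret S: algebra R "scalars R" by (rule scalars_algebra[OF is_cring])
  have sc: "a \<odot>\<^bsub>scalars R\<^esub> b = a \<otimes> b" "a \<otimes>\<^bsub>scalars R\<^esub> b = a \<otimes> b" "carrier (scalars R) = carrier R"
    "\<zero>\<^bsub>scalars R\<^esub> = \<zero>" for a b
    by (simp_all add: scalars_def)
  show ?thesis unfolding struct_rel_def
  proof (intro ballI)
    fix a i j assume a: "a \<in> J" "i \<in> J" "j \<in> J"
    have single: "(\<Oplus>\<^bsub>scalars R\<^esub>u\<in>J. if v = u then h u else \<zero>) = h v"
      if "v \<in> J" "h \<in> J \<rightarrow> carrier R" for h v
      using S.M.finsum_singleton[OF that(1) J, of h] that(2) unfolding sc by simp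
    have "(\<Oplus>\<^bsub>scalars R\<^esub>u\<in>J. g i j u \<odot>\<^bsub>scalars R\<^esub> (if a = u then \<one> else \<zero>))
        = (\<Oplus>\<^bsub>scalars R\<^esub>u\<in>J. if a = u then g i j u else \<zero>)"
      using g a by (intro S.M.finsum_cong'[OF refl]) (auto simp: sc)
    also have "\<dots> = g i j a" using g a by (intro single) auto
    also have "\<dots> = (\<Oplus>\<^bsub>scalars R\<^esub>s\<in>J. if i = s then g s j a else \<zero>)"
      using g a by (intro single[symmetric]) auto
    also have "\<dots> = (\<Oplus>\<^bsub>scalars R\<^esub>s\<in>J. \<Oplus>\<^bsub>scalars R\<^esub>t\<in>J. g s t a \<odot>\<^bsub>scalars R\<^esub>
        ((if s = i then \<one> else \<zero>) \<otimes>\<^bsub>scalars R\<^esub> (if t = j then \<one> else \<zero>)))"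
    proof (intro S.M.finsum_cong'[OF refl])
      fix s assume s: "s \<in> J"
      have "(\<Oplus>\<^bsub>scalars R\<^esub>t\<in>J. g s t a \<odot>\<^bsub>scalars R\<^esub> ((if s = i then \<one> else \<zero>) \<otimes>\<^bsub>scalars R\<^esub> (if t = j then \<one> else \<zero>)))
        = (\<Oplus>\<^bsub>scalars R\<^esub>t\<in>J. if j = t then (if i = s then g s t a else \<zero>) else \<zero>)"
        using g a s by (intro S.M.finsum_cong'[OF refl]) (auto simp: sc)
      also have "\<dots> = (if i = s then g s j a else \<zero>)" using g a s by (subst single) auto
      finally show "(if i = s then g s j a else \<zero>) = (\<Oplus>\<^bsub>scalars R\<^esub>t\<in>J. g s t a \<odot>\<^bsub>scalars R\<^esub>
        ((if s = i then \<one> else \<zero>) \<otimes>\<^bsub>scalars R\<^esub> (if t = j then \<one> else \<zero>)))" by simp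
    qed (use g a in \<open>auto intro!: S.M.finsum_closed[unfolded sc] simp: sc\<close>)
    finally show "(\<Oplus>\<^bsub>scalars R\<^esub>u\<in>J. g i j u \<odot>\<^bsub>scalars R\<^esub> (if a = u then \<one> else \<zero>))
      = (\<Oplus>\<^bsub>scalars R\<^esub>s\<in>J. \<Oplus>\<^bsub>scalars R\<^esub>t\<in>J. g s t a \<odot>\<^bsub>scalars R\<^esub>
        ((if s = i then \<one> else \<zero>) \<otimes>\<^bsub>scalars R\<^esub> (if t = j then \<one> else \<zero>)))" .
  qed
qed

section \<open>Coordinates in tensor products\<close>

lemma linear_hom_sum:
  assumes V: "module K V" and U: "module K U" and J: "finite J" and f: "\<And>j. j \<in> J \<Longrightarrow> f j \<in> linear_hom K V U"
  shows "(\<lambda>x. \<Oplus>\<^bsub>U\<^esub>j\<in>J. f j x) \<in> linear_hom K V U"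
proof -
  interpret V: module K V by fact
  interpret U: module K U by fact
  have fc: "f j x \<in> carrier U" if "j \<in> J" "x \<in> carrier V" for j x
    by (rule linear_hom_closed[OF f[OF that(1)] that(2)])
  show ?thesis
  proof (rule linear_homI)
    fix x assume x: "x \<in> carrier V"
    then show "(\<Oplus>\<^bsub>U\<^esub>j\<in>J. f j x) \<in> carrier U" using fc by (intro U.M.finsum_closed) auto
    show "(\<Oplus>\<^bsub>U\<^esub>j\<in>J. f j (a \<odot>\<^bsub>V\<^esub> x)) = a \<odot>\<^bsub>U\<^esub> (\<Oplus>\<^bsub>U\<^esub>j\<in>J. f j x)" if a: "a \<in> carrier K" for a
      using fc x a J by (subst U.finsum_smult_ldistr) (auto intro!: U.M.finsum_cong' linear_hom_smult[OF f])
    show "(\<Oplus>\<^bsub>U\<^esub>j\<in>J. f j (x \<oplus>\<^bsub>V\<^esub> y)) = (\<Oplus>\<^bsub>U\<^esub>j\<in>J. f j x) \<oplus>\<^bsub>U\<^esub> (\<Oplus>\<^bsub>U\<^esub>j\<in>J. f j y)" if y: "y \<in> carrier V" for y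
    proof -
      have "(\<Oplus>\<^bsub>U\<^esub>j\<in>J. f j (x \<oplus>\<^bsub>V\<^esub> y)) = (\<Oplus>\<^bsub>U\<^esub>j\<in>J. f j x \<oplus>\<^bsub>U\<^esub> f j y)"
        using fc x y by (intro U.M.finsum_cong'[OF refl]) (auto intro!: linear_hom_add[OF f])
      also have "\<dots> = (\<Oplus>\<^bsub>U\<^esub>j\<in>J. f j x) \<oplus>\<^bsub>U\<^esub> (\<Oplus>\<^bsub>U\<^esub>j\<in>J. f j y)"
        using fc x y by (intro U.M.finsum_addf) auto
      finally show ?thesis .
    qed
  qed
qed

lemma tens_finsum_left:
  assumes "module K V" "module K W" "finite I" "\<And>i. i \<in> I \<Longrightarrow> f i \<in> carrier V" "w \<in> carrier W"
  shows "tens K V W (\<Oplus>\<^bsub>V\<^esub>i\<in>I. f i) w = (\<Oplus>\<^bsub>tensor K V W\<^esub>i\<in>I. tens K V W (f i) w)"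
  using assms
  by (intro linear_hom_finsum[OF assms(1) tensor_module[OF assms(1,2)] bilin_map_left[OF tens_bilin]]) auto

lemma tens_finsum_right:
  assumes "module K V" "module K W" "finite I" "\<And>i. i \<in> I \<Longrightarrow> f i \<in> carrier W" "v \<in> carrier V"
  shows "tens K V W v (\<Oplus>\<^bsub>W\<^esub>i\<in>I. f i) = (\<Oplus>\<^bsub>tensor K V W\<^esub>i\<in>I. tens K V W v (f i))"
  using assms
  by (intro linear_hom_finsum[OF assms(2) tensor_module[OF assms(1,2)] bilin_map_right[OF tens_bilin]]) auto

context
  fixes K (structure) and V and n :: nat and e and B
  assumes V: "module K V" and basis: "is_basis K V n e" and B: "module K B"
begin

interpretation V: module K V by (rule V)
interpretation B: module K B by (rule B)
interpretation T: module K "tensor K V B" by (rule tensor_module[OF V B])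

private abbreviation (input) "VB \<equiv> tensor K V B"
private lemmas cc = coords_closed[OF V basis]
private lemmas ec = basis_closed[OF V basis]
private lemmas tc = tens_closed[OF V B]

declare One_nat_def [simp del] tensor_simps [simp del]

lemma basis_ext_linear:
  assumes w: "\<And>i. i \<in> {1..n} \<Longrightarrow> w i \<in> carrier B"
  shows "(\<lambda>v. lin_comb B n w (coords K V n e v)) \<in> linear_hom K V B"
  unfolding lin_comb_def
proof (rule linear_hom_sum[OF V B])
  fix i assume i: "i \<in> {1..n}"
  note lin = linear_hom_add[OF coords_linear[OF V basis i]] linear_hom_smult[OF coords_linear[OF V basis i]]
  show "(\<lambda>v. coords K V n e v i \<odot>\<^bsub>B\<^esub> w i) \<in> linear_hom K V B"
    using cc i w by (intro linear_homI) (auto simp: lin B.smult_l_distr B.smult_assoc1 scalars_def)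
qed simp

lemma basis_ext_basis:
  assumes w: "\<And>i. i \<in> {1..n} \<Longrightarrow> w i \<in> carrier B" and i: "i \<in> {1..n}"
  shows "lin_comb B n w (coords K V n e (e i)) = w i"
proof -
  have "lin_comb B n w (coords K V n e (e i)) = (\<Oplus>\<^bsub>B\<^esub>j\<in>{1..n}. if i = j then w j else \<zero>\<^bsub>B\<^esub>)"
    unfolding lin_comb_def using w i by (intro B.M.finsum_cong'[OF refl]) (simp_all add: coords_basis[OF V basis] del: atLeastAtMost_iff)
  also have "\<dots> = w i" using w i by (intro B.M.finsum_singleton) auto
  finally show ?thesis .
qed

text \<open>The dual basis functional of \<open>e s\<close> tensored with the identity of
  \<open>B\<close>, that is, the component with index \<open>s\<close> of the isomorphism from V
  \<otimes> B to B^n.\<close>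

definition tensor_coord :: "nat \<Rightarrow> _" where
  "tensor_coord s = tens_ext K B (\<lambda>v h. coords K V n e v s \<odot>\<^bsub>B\<^esub> h)"

lemma tensor_coord_bilin:
  assumes "s \<in> {1..n}"
  shows "bilin_map K V B B (\<lambda>v h. coords K V n e v s \<odot>\<^bsub>B\<^esub> h)"
proof -
  note lin = linear_hom_add[OF coords_linear[OF V basis assms]] linear_hom_smult[OF coords_linear[OF V basis assms]]
  have "a \<odot>\<^bsub>B\<^esub> (b \<odot>\<^bsub>B\<^esub> h) = b \<odot>\<^bsub>B\<^esub> (a \<odot>\<^bsub>B\<^esub> h)" if "a \<in> carrier K" "b \<in> carrier K" "h \<in> carrier B" for a b h
    using that by (simp add: B.smult_assoc1[symmetric] V.R.m_comm)
  then show ?thesis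
    using cc assms by (intro bilin_mapI) (auto simp: lin scalars_def B.smult_l_distr B.smult_r_distr B.smult_assoc1)
qed

lemma tensor_coord_linear: "s \<in> {1..n} \<Longrightarrow> tensor_coord s \<in> linear_hom K VB B"
  unfolding tensor_coord_def by (rule tens_ext_linear[OF V B B tensor_coord_bilin])

lemma tensor_coord_tens: "\<lbrakk>s \<in> {1..n}; v \<in> carrier V; h \<in> carrier B\<rbrakk>
    \<Longrightarrow> tensor_coord s (tens K V B v h) = coords K V n e v s \<odot>\<^bsub>B\<^esub> h"
  unfolding tensor_coord_def by (rule tens_ext_tens[OF V B B tensor_coord_bilin])

lemma tensor_coord_sum:
  assumes p: "\<And>s. s \<in> {1..n} \<Longrightarrow> p s \<in> carrier B" and s: "s \<in> {1..n}"
  shows "tensor_coord s (\<Oplus>\<^bsub>VB\<^esub>t\<in>{1..n}. tens K V B (e t) (p t)) = p s"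
proof -
  have "tensor_coord s (\<Oplus>\<^bsub>VB\<^esub>t\<in>{1..n}. tens K V B (e t) (p t))
      = (\<Oplus>\<^bsub>B\<^esub>t\<in>{1..n}. tensor_coord s (tens K V B (e t) (p t)))"
    using p ec tc by (intro linear_hom_finsum[OF T.module_axioms B tensor_coord_linear[OF s]]) auto
  also have "\<dots> = (\<Oplus>\<^bsub>B\<^esub>t\<in>{1..n}. if s = t then p t else \<zero>\<^bsub>B\<^esub>)"
    using p s ec by (intro B.M.finsum_cong'[OF refl])
      (auto simp add: tensor_coord_tens coords_basis[OF V basis] simp del: atLeastAtMost_iff)
  also have "\<dots> = p s" using p s by (intro B.M.finsum_singleton) auto
  finally show ?thesis .
qed

text \<open>Applying \<open>tensor_coord s\<close> to both sides picks out the entries. This is the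
  tool that extracts equations in \<open>B\<close> from an equation between coactions.\<close>

lemma tensor_coords_unique:
  assumes "\<And>s. s \<in> {1..n} \<Longrightarrow> p s \<in> carrier B" "\<And>s. s \<in> {1..n} \<Longrightarrow> q s \<in> carrier B"
    and "(\<Oplus>\<^bsub>VB\<^esub>t\<in>{1..n}. tens K V B (e t) (p t)) = (\<Oplus>\<^bsub>VB\<^esub>t\<in>{1..n}. tens K V B (e t) (q t))"
    and "s \<in> {1..n}"
  shows "p s = q s"
  using tensor_coord_sum[of p s] tensor_coord_sum[of q s] assms by simp

lemma tensor_coord_closed: "\<lbrakk>s \<in> {1..n}; z \<in> carrier VB\<rbrakk> \<Longrightarrow> tensor_coord s z \<in> carrier B"
  by (rule linear_hom_closed[OF tensor_coord_linear])

text \<open>On a pure tensor this is the expansion of its first factor in the basis, with the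
  scalars moved across the tensor sign. It provides the matrix of an arbitrary coaction.\<close>

lemma tensor_coord_repr:
  assumes z: "z \<in> carrier VB"
  shows "(\<Oplus>\<^bsub>VB\<^esub>s\<in>{1..n}. tens K V B (e s) (tensor_coord s z)) = z"
proof (rule tensor_hom_eqI[OF V B T.module_axioms _ linear_hom_id _ z])
  show "(\<lambda>z. \<Oplus>\<^bsub>VB\<^esub>s\<in>{1..n}. tens K V B (e s) (tensor_coord s z)) \<in> linear_hom K VB VB"
    by (intro linear_hom_sum[OF T.module_axioms T.module_axioms])
      (auto intro: linear_hom_comp[OF tensor_coord_linear bilin_map_right[OF tens_bilin[OF V B] ec]])
  fix v h assume vh: "v \<in> carrier V" "h \<in> carrier B"
  have "(\<Oplus>\<^bsub>VB\<^esub>s\<in>{1..n}. tens K V B (e s) (tensor_coord s (tens K V B v h)))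
      = (\<Oplus>\<^bsub>VB\<^esub>s\<in>{1..n}. tens K V B (coords K V n e v s \<odot>\<^bsub>V\<^esub> e s) h)"
    using vh ec cc tc
    by (intro T.M.finsum_cong'[OF refl])
      (auto simp: tensor_coord_tens bilin_map_smult_left[OF tens_bilin[OF V B]]
        bilin_map_smult_right[OF tens_bilin[OF V B]] simp del: atLeastAtMost_iff)
  also have "\<dots> = tens K V B (lin_comb V n e (coords K V n e v)) h"
    unfolding lin_comb_def using vh ec cc by (intro tens_finsum_left[OF V B, symmetric]) auto
  also have "\<dots> = tens K V B v h" using coords_closed_lin_comb(2)[OF V basis] vh by simp
  finally show "(\<Oplus>\<^bsub>VB\<^esub>s\<in>{1..n}. tens K V B (e s) (tensor_coord s (tens K V B v h))) = tens K V B v h" .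
qed

end

section \<open>The matrix of a coaction\<close>

context
  fixes K (structure) and V and n :: nat and e and B and \<rho> and h
  assumes V: "module K V" and basis: "is_basis K V n e" and B: "algebra K B"
    and rho: "\<rho> \<in> linear_hom K V (tensor K V B)"
    and h: "\<And>s i. \<lbrakk>s \<in> {1..n}; i \<in> {1..n}\<rbrakk> \<Longrightarrow> h s i \<in> carrier B"
    and rho_e: "\<And>i. i \<in> {1..n} \<Longrightarrow> \<rho> (e i) = (\<Oplus>\<^bsub>tensor K V B\<^esub>s\<in>{1..n}. tens K V B (e s) (h s i))"
begin

interpretation V: module K V by (rule V)
interpretation B: algebra K B by (rule B)
interpretation T: module K "tensor K V B" by (rule tensor_module[OF V B.module])

private abbreviation (input) "T' \<equiv> tensor K V B"
private lemmas cV = coords_closed[OF V basis]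
private lemmas eV = basis_closed[OF V basis]
private lemmas tV = tens_closed[OF V B.module]
private lemmas tb = tens_bilin[OF V B.module]

declare One_nat_def [simp del] tensor_simps [simp del] atLeastAtMost_iff [simp del]

text \<open>Applying a linear map to the second factor acts on the matrix entry by entry. The same
  computation serves comultiplication, counit and morphisms of coactions.\<close>

lemma coaction_map:
  assumes C: "module K C" and phi: "\<phi> \<in> linear_hom K B C" and i: "i \<in> {1..n}"
  shows "tensor_map K V C (\<lambda>x. x) \<phi> (\<rho> (e i)) = (\<Oplus>\<^bsub>tensor K V C\<^esub>t\<in>{1..n}. tens K V C (e t) (\<phi> (h t i)))"
proof -
  interpret VC: module K "tensor K V C" by (rule tensor_module[OF V C])
  note cl = h i eV tV tens_closed[OF V C] linear_hom_closed[OF phi]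
  have "tensor_map K V C (\<lambda>x. x) \<phi> (\<rho> (e i))
      = (\<Oplus>\<^bsub>tensor K V C\<^esub>t\<in>{1..n}. tensor_map K V C (\<lambda>x. x) \<phi> (tens K V B (e t) (h t i)))"
    unfolding rho_e[OF i] using cl
    by (intro linear_hom_finsum[OF T.module_axioms VC.module_axioms
      tensor_map_linear[OF V B.module V C linear_hom_id phi]]) auto
  also have "\<dots> = (\<Oplus>\<^bsub>tensor K V C\<^esub>t\<in>{1..n}. tens K V C (e t) (\<phi> (h t i)))"
    using cl by (intro VC.M.finsum_cong'[OF refl] tensor_map_tens[OF V B.module V C linear_hom_id phi]) auto
  finally show ?thesis .
qed

section \<open>Multiplicativity of a coaction in terms of its matrix\<close>

context
  fixes b
  assumes b: "bilin_map K V V V b"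
begin

private abbreviation (input) "g i j u \<equiv> coords K V n e (b (e i) (e j)) u"

private lemma gc: "\<lbrakk>i \<in> {1..n}; j \<in> {1..n}; u \<in> {1..n}\<rbrakk> \<Longrightarrow> g i j u \<in> carrier K"
  using cV bilin_map_closed[OF b] eV by blast

text \<open>Expanding the product in the basis and exchanging the sums makes the left side of
  \<open>struct_rel\<close> the coefficient at \<open>e a\<close>.\<close>

lemma coaction_of_product:
  assumes i: "i \<in> {1..n}" and j: "j \<in> {1..n}"
  shows "\<rho> (b (e i) (e j)) = (\<Oplus>\<^bsub>T'\<^esub>a\<in>{1..n}. tens K V B (e a) (\<Oplus>\<^bsub>B\<^esub>u\<in>{1..n}. g i j u \<odot>\<^bsub>B\<^esub> h a u))"
proof -
  have bij: "b (e i) (e j) \<in> carrier V" using bilin_map_closed[OF b] eV i j by blast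
  have "\<rho> (b (e i) (e j)) = \<rho> (lin_comb V n e (g i j))"
    using coords_closed_lin_comb(2)[OF V basis bij] by simp
  also have "\<dots> = (\<Oplus>\<^bsub>T'\<^esub>u\<in>{1..n}. \<rho> (g i j u \<odot>\<^bsub>V\<^esub> e u))"
    unfolding lin_comb_def using gc i j eV by (intro linear_hom_finsum[OF V T.module_axioms rho]) auto
  also have "\<dots> = (\<Oplus>\<^bsub>T'\<^esub>u\<in>{1..n}. \<Oplus>\<^bsub>T'\<^esub>a\<in>{1..n}. g i j u \<odot>\<^bsub>T'\<^esub> tens K V B (e a) (h a u))"
  proof (intro T.M.finsum_cong'[OF refl])
    fix u assume u: "u \<in> {1..n}"
    have "\<rho> (g i j u \<odot>\<^bsub>V\<^esub> e u) = g i j u \<odot>\<^bsub>T'\<^esub> \<rho> (e u)"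
      using gc i j u eV by (intro linear_hom_smult[OF rho]) auto
    also have "\<dots> = (\<Oplus>\<^bsub>T'\<^esub>a\<in>{1..n}. g i j u \<odot>\<^bsub>T'\<^esub> tens K V B (e a) (h a u))"
      unfolding rho_e[OF u] using gc i j u h eV tV by (intro T.finsum_smult_ldistr) auto
    finally show "\<rho> (g i j u \<odot>\<^bsub>V\<^esub> e u) = (\<Oplus>\<^bsub>T'\<^esub>a\<in>{1..n}. g i j u \<odot>\<^bsub>T'\<^esub> tens K V B (e a) (h a u))" .
  qed (use gc i j h eV tV in \<open>auto intro!: T.M.finsum_closed\<close>)
  also have "\<dots> = (\<Oplus>\<^bsub>T'\<^esub>a\<in>{1..n}. \<Oplus>\<^bsub>T'\<^esub>u\<in>{1..n}. g i j u \<odot>\<^bsub>T'\<^esub> tens K V B (e a) (h a u))"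
    using gc i j h eV tV by (intro T.M.finsum_swap) auto
  also have "\<dots> = (\<Oplus>\<^bsub>T'\<^esub>a\<in>{1..n}. tens K V B (e a) (\<Oplus>\<^bsub>B\<^esub>u\<in>{1..n}. g i j u \<odot>\<^bsub>B\<^esub> h a u))"
  proof (intro T.M.finsum_cong'[OF refl])
    fix a assume a: "a \<in> {1..n}"
    have "tens K V B (e a) (\<Oplus>\<^bsub>B\<^esub>u\<in>{1..n}. g i j u \<odot>\<^bsub>B\<^esub> h a u)
        = (\<Oplus>\<^bsub>T'\<^esub>u\<in>{1..n}. tens K V B (e a) (g i j u \<odot>\<^bsub>B\<^esub> h a u))"
      using gc i j a h eV by (intro tens_finsum_right[OF V B.module]) auto
    also have "\<dots> = (\<Oplus>\<^bsub>T'\<^esub>u\<in>{1..n}. g i j u \<odot>\<^bsub>T'\<^esub> tens K V B (e a) (h a u))"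
      using gc i j a h eV tV by (intro T.M.finsum_cong'[OF refl]) (auto simp: bilin_map_smult_right[OF tb])
    finally show "(\<Oplus>\<^bsub>T'\<^esub>u\<in>{1..n}. g i j u \<odot>\<^bsub>T'\<^esub> tens K V B (e a) (h a u))
      = tens K V B (e a) (\<Oplus>\<^bsub>B\<^esub>u\<in>{1..n}. g i j u \<odot>\<^bsub>B\<^esub> h a u)" by simp
  qed (use gc i j h eV in \<open>auto intro!: tV B.M.finsum_closed\<close>)
  finally show ?thesis .
qed

private abbreviation (input) "op \<equiv> tens_op K V B b (monoid.mult B)"

text \<open>The counterpart for the right side of \<open>struct_rel\<close>: structure constants
  arise from the first tensor factor, products of matrix entries from the second.\<close>

lemma product_of_coactions:
  assumes i: "i \<in> {1..n}" and j: "j \<in> {1..n}"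
  shows "op (\<rho> (e i)) (\<rho> (e j)) = (\<Oplus>\<^bsub>T'\<^esub>a\<in>{1..n}. tens K V B (e a)
      (\<Oplus>\<^bsub>B\<^esub>s\<in>{1..n}. \<Oplus>\<^bsub>B\<^esub>t\<in>{1..n}. g s t a \<odot>\<^bsub>B\<^esub> (h s i \<otimes>\<^bsub>B\<^esub> h t j)))"
proof -
  note opb = tens_op_bilin[OF V B.module b B.mult_bilin]
  note cl = gc i j h eV tV bilin_map_closed[OF b]
  have "op (\<rho> (e i)) (\<rho> (e j)) = (\<Oplus>\<^bsub>T'\<^esub>s\<in>{1..n}. op (tens K V B (e s) (h s i)) (\<rho> (e j)))"
    unfolding rho_e[OF i] using cl linear_hom_closed[OF rho]
    by (intro linear_hom_finsum[OF T.module_axioms T.module_axioms bilin_map_left[OF opb]]) auto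
  also have "\<dots> = (\<Oplus>\<^bsub>T'\<^esub>s\<in>{1..n}. \<Oplus>\<^bsub>T'\<^esub>t\<in>{1..n}. \<Oplus>\<^bsub>T'\<^esub>a\<in>{1..n}.
      g s t a \<odot>\<^bsub>T'\<^esub> tens K V B (e a) (h s i \<otimes>\<^bsub>B\<^esub> h t j))"
  proof (intro T.M.finsum_cong'[OF refl])
    fix s assume s: "s \<in> {1..n}"
    have "op (tens K V B (e s) (h s i)) (\<rho> (e j))
        = (\<Oplus>\<^bsub>T'\<^esub>t\<in>{1..n}. op (tens K V B (e s) (h s i)) (tens K V B (e t) (h t j)))"
      unfolding rho_e[OF j] using cl s
      by (intro linear_hom_finsum[OF T.module_axioms T.module_axioms bilin_map_right[OF opb]]) auto
    also have "\<dots> = (\<Oplus>\<^bsub>T'\<^esub>t\<in>{1..n}. \<Oplus>\<^bsub>T'\<^esub>a\<in>{1..n}.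
        g s t a \<odot>\<^bsub>T'\<^esub> tens K V B (e a) (h s i \<otimes>\<^bsub>B\<^esub> h t j))"
    proof (intro T.M.finsum_cong'[OF refl])
      fix t assume t: "t \<in> {1..n}"
      have bst: "b (e s) (e t) \<in> carrier V" by (intro bilin_map_closed[OF b] eV s t)
      have "op (tens K V B (e s) (h s i)) (tens K V B (e t) (h t j))
          = tens K V B (lin_comb V n e (g s t)) (h s i \<otimes>\<^bsub>B\<^esub> h t j)"
        using cl s t coords_closed_lin_comb(2)[OF V basis bst] by (simp add: tens_op_tens[OF V B.module b B.mult_bilin])
      also have "\<dots> = (\<Oplus>\<^bsub>T'\<^esub>a\<in>{1..n}. tens K V B (g s t a \<odot>\<^bsub>V\<^esub> e a) (h s i \<otimes>\<^bsub>B\<^esub> h t j))"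
        unfolding lin_comb_def using cl s t by (intro tens_finsum_left[OF V B.module]) auto
      also have "\<dots> = (\<Oplus>\<^bsub>T'\<^esub>a\<in>{1..n}. g s t a \<odot>\<^bsub>T'\<^esub> tens K V B (e a) (h s i \<otimes>\<^bsub>B\<^esub> h t j))"
        using cl s t by (intro T.M.finsum_cong'[OF refl]) (auto simp: bilin_map_smult_left[OF tb])
      finally show "op (tens K V B (e s) (h s i)) (tens K V B (e t) (h t j))
        = (\<Oplus>\<^bsub>T'\<^esub>a\<in>{1..n}. g s t a \<odot>\<^bsub>T'\<^esub> tens K V B (e a) (h s i \<otimes>\<^bsub>B\<^esub> h t j))" .
    qed (use cl s in \<open>auto intro!: T.M.finsum_closed\<close>)
    finally show "op (tens K V B (e s) (h s i)) (\<rho> (e j)) = (\<Oplus>\<^bsub>T'\<^esub>t\<in>{1..n}. \<Oplus>\<^bsub>T'\<^esub>a\<in>{1..n}.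
        g s t a \<odot>\<^bsub>T'\<^esub> tens K V B (e a) (h s i \<otimes>\<^bsub>B\<^esub> h t j))" .
  qed (use cl in \<open>auto intro!: T.M.finsum_closed\<close>)
  also have "\<dots> = (\<Oplus>\<^bsub>T'\<^esub>a\<in>{1..n}. \<Oplus>\<^bsub>T'\<^esub>s\<in>{1..n}. \<Oplus>\<^bsub>T'\<^esub>t\<in>{1..n}.
      g s t a \<odot>\<^bsub>T'\<^esub> tens K V B (e a) (h s i \<otimes>\<^bsub>B\<^esub> h t j))"
    using cl by (intro T.M.finsum_rotate[symmetric]) auto
  also have "\<dots> = (\<Oplus>\<^bsub>T'\<^esub>a\<in>{1..n}. tens K V B (e a)
      (\<Oplus>\<^bsub>B\<^esub>s\<in>{1..n}. \<Oplus>\<^bsub>B\<^esub>t\<in>{1..n}. g s t a \<odot>\<^bsub>B\<^esub> (h s i \<otimes>\<^bsub>B\<^esub> h t j)))"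
  proof (intro T.M.finsum_cong'[OF refl])
    fix a assume a: "a \<in> {1..n}"
    have "tens K V B (e a) (\<Oplus>\<^bsub>B\<^esub>s\<in>{1..n}. \<Oplus>\<^bsub>B\<^esub>t\<in>{1..n}. g s t a \<odot>\<^bsub>B\<^esub> (h s i \<otimes>\<^bsub>B\<^esub> h t j))
      = (\<Oplus>\<^bsub>T'\<^esub>s\<in>{1..n}. tens K V B (e a) (\<Oplus>\<^bsub>B\<^esub>t\<in>{1..n}. g s t a \<odot>\<^bsub>B\<^esub> (h s i \<otimes>\<^bsub>B\<^esub> h t j)))"
      using cl a by (intro tens_finsum_right[OF V B.module]) (auto intro!: B.M.finsum_closed)
    also have "\<dots> = (\<Oplus>\<^bsub>T'\<^esub>s\<in>{1..n}. \<Oplus>\<^bsub>T'\<^esub>t\<in>{1..n}. tens K V B (e a) (g s t a \<odot>\<^bsub>B\<^esub> (h s i \<otimes>\<^bsub>B\<^esub> h t j)))"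
      using cl a by (intro T.M.finsum_cong'[OF refl] tens_finsum_right[OF V B.module]) (auto intro!: T.M.finsum_closed)
    also have "\<dots> = (\<Oplus>\<^bsub>T'\<^esub>s\<in>{1..n}. \<Oplus>\<^bsub>T'\<^esub>t\<in>{1..n}. g s t a \<odot>\<^bsub>T'\<^esub> tens K V B (e a) (h s i \<otimes>\<^bsub>B\<^esub> h t j))"
      using cl a by (intro T.M.finsum_cong'[OF refl])
        (auto simp: bilin_map_smult_right[OF tb] intro!: T.M.finsum_closed)
    finally show "(\<Oplus>\<^bsub>T'\<^esub>s\<in>{1..n}. \<Oplus>\<^bsub>T'\<^esub>t\<in>{1..n}. g s t a \<odot>\<^bsub>T'\<^esub> tens K V B (e a) (h s i \<otimes>\<^bsub>B\<^esub> h t j))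
      = tens K V B (e a) (\<Oplus>\<^bsub>B\<^esub>s\<in>{1..n}. \<Oplus>\<^bsub>B\<^esub>t\<in>{1..n}. g s t a \<odot>\<^bsub>B\<^esub> (h s i \<otimes>\<^bsub>B\<^esub> h t j))" by simp
  qed (use cl in \<open>auto intro!: tV B.M.finsum_closed\<close>)
  finally show ?thesis .
qed

text \<open>One direction compares the coefficients at \<open>e a\<close>. For the other, equality
  on pairs of basis vectors is extended by linearity, first in \<open>y\<close> and then in
  \<open>x\<close>.\<close>

lemma coaction_multiplicative_iff:
  "(\<forall>x\<in>carrier V. \<forall>y\<in>carrier V. \<rho> (b x y) = op (\<rho> x) (\<rho> y))
    \<longleftrightarrow> struct_rel K {1..n} (\<lambda>i j u. g i j u) B h" (is "?L = ?R")
proof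
  note cl = gc h eV
  have sc: "(\<Oplus>\<^bsub>B\<^esub>u\<in>{1..n}. g i j u \<odot>\<^bsub>B\<^esub> h a u) \<in> carrier B"
    "(\<Oplus>\<^bsub>B\<^esub>s\<in>{1..n}. \<Oplus>\<^bsub>B\<^esub>t\<in>{1..n}. g s t a \<odot>\<^bsub>B\<^esub> (h s i \<otimes>\<^bsub>B\<^esub> h t j)) \<in> carrier B"
    if "i \<in> {1..n}" "j \<in> {1..n}" "a \<in> {1..n}" for i j a
    using that cl by (auto intro!: B.M.finsum_closed)
  {
    assume L: ?L
    show ?R unfolding struct_rel_def
    proof (intro ballI)
      fix a i j assume a: "a \<in> {1..n}" and i: "i \<in> {1..n}" and j: "j \<in> {1..n}"
      have "\<rho> (b (e i) (e j)) = op (\<rho> (e i)) (\<rho> (e j))" using L eV i j by blast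
      from this[unfolded coaction_of_product[OF i j] product_of_coactions[OF i j]]
      show "(\<Oplus>\<^bsub>B\<^esub>u\<in>{1..n}. g i j u \<odot>\<^bsub>B\<^esub> h a u)
          = (\<Oplus>\<^bsub>B\<^esub>s\<in>{1..n}. \<Oplus>\<^bsub>B\<^esub>t\<in>{1..n}. g s t a \<odot>\<^bsub>B\<^esub> (h s i \<otimes>\<^bsub>B\<^esub> h t j))"
        using sc i j a by (intro tensor_coords_unique[OF V basis B.module _ _ _ a,
          where p="\<lambda>a. \<Oplus>\<^bsub>B\<^esub>u\<in>{1..n}. g i j u \<odot>\<^bsub>B\<^esub> h a u"])
    qed
  }
  {
    assume R: ?R
    note opb = tens_op_bilin[OF V B.module b B.mult_bilin]
    note rc = linear_hom_closed[OF rho]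
    have 1: "\<rho> (b (e i) (e j)) = op (\<rho> (e i)) (\<rho> (e j))" if "i \<in> {1..n}" "j \<in> {1..n}" for i j
      unfolding coaction_of_product[OF that] product_of_coactions[OF that] using R that sc eV tV
      by (intro T.M.finsum_cong'[OF refl]) (auto simp: struct_rel_def)
    have 2: "\<rho> (b (e i) y) = op (\<rho> (e i)) (\<rho> y)" if "i \<in> {1..n}" "y \<in> carrier V" for i y
      by (rule basis_hom_eqI[OF V basis T.module_axioms
          linear_hom_comp[OF bilin_map_right[OF b] rho] linear_hom_comp[OF rho bilin_map_right[OF opb]] _ that(2)])
        (use 1 eV rc that in auto)
    have "\<rho> (b x y) = op (\<rho> x) (\<rho> y)" if "x \<in> carrier V" "y \<in> carrier V" for x y
      by (rule basis_hom_eqI[OF V basis T.module_axioms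
          linear_hom_comp[OF bilin_map_left[OF b] rho] linear_hom_comp[OF rho bilin_map_left[OF opb]] _ that(1)])
        (use 2 eV rc that in auto)
    then show ?L by blast
  }
qed

end

section \<open>Coassociativity of a coaction in terms of its matrix\<close>

context
  fixes \<Delta>
  assumes Delta: "\<Delta> \<in> linear_hom K B (tensor K B B)"
begin

private abbreviation (input) "BB' \<equiv> tensor K B B"
private abbreviation (input) "VBB \<equiv> tensor K V (tensor K B B)"

interpretation BB: module K "tensor K B B" by (rule tensor_module[OF B.module B.module])
interpretation VBB: module K "tensor K V (tensor K B B)" by (rule tensor_module[OF V BB.module_axioms])
interpretation VB_B: module K "tensor K (tensor K V B) B" by (rule tensor_module[OF T.module_axioms B.module])

private lemmas bbc = tens_closed[OF B.module B.module]
private lemmas vbbc = tens_closed[OF V BB.module_axioms]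
private lemmas vb_bc = tens_closed[OF T.module_axioms B.module]
private lemmas rl = tensor_map_linear[OF V B.module T.module_axioms B.module rho linear_hom_id]
private lemmas dl = tensor_map_linear[OF V B.module V BB.module_axioms linear_hom_id Delta]

text \<open>The iterated coaction has a matrix over B \<otimes> B: the matrix product of
  \<open>h\<close> with itself in which entries are tensored instead of multiplied.\<close>

lemma coaction_twice:
  assumes i: "i \<in> {1..n}"
  shows "tensor_assoc K V B B (tensor_map K (tensor K V B) B \<rho> (\<lambda>x. x) (\<rho> (e i)))
    = (\<Oplus>\<^bsub>VBB\<^esub>t\<in>{1..n}. tens K V BB' (e t) (\<Oplus>\<^bsub>BB'\<^esub>s\<in>{1..n}. tens K B B (h t s) (h s i)))"
proof -
  let ?f = "\<lambda>z. tensor_assoc K V B B (tensor_map K (tensor K V B) B \<rho> (\<lambda>x. x) z)"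
  note al = tensor_assoc_linear[OF V B.module B.module]
  have fl: "?f \<in> linear_hom K T' VBB" by (rule linear_hom_comp[OF rl al])
  note cl = h i eV tV bbc vbbc vb_bc
  have "?f (\<rho> (e i)) = (\<Oplus>\<^bsub>VBB\<^esub>s\<in>{1..n}. ?f (tens K V B (e s) (h s i)))"
    unfolding rho_e[OF i] using cl by (intro linear_hom_finsum[OF T.module_axioms VBB.module_axioms fl]) auto
  also have "\<dots> = (\<Oplus>\<^bsub>VBB\<^esub>s\<in>{1..n}. \<Oplus>\<^bsub>VBB\<^esub>t\<in>{1..n}. tens K V BB' (e t) (tens K B B (h t s) (h s i)))"
  proof (intro VBB.M.finsum_cong'[OF refl])
    fix s assume s: "s \<in> {1..n}"
    have "tensor_map K (tensor K V B) B \<rho> (\<lambda>x. x) (tens K V B (e s) (h s i)) = tens K T' B (\<rho> (e s)) (h s i)"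
      using cl s by (intro tensor_map_tens[OF V B.module T.module_axioms B.module rho linear_hom_id]) auto
    also have "\<dots> = (\<Oplus>\<^bsub>tensor K T' B\<^esub>t\<in>{1..n}. tens K T' B (tens K V B (e t) (h t s)) (h s i))"
      unfolding rho_e[OF s] using cl s by (intro tens_finsum_left[OF T.module_axioms B.module]) auto
    finally have "?f (tens K V B (e s) (h s i))
        = tensor_assoc K V B B (\<Oplus>\<^bsub>tensor K T' B\<^esub>t\<in>{1..n}. tens K T' B (tens K V B (e t) (h t s)) (h s i))" by simp
    also have "\<dots> = (\<Oplus>\<^bsub>VBB\<^esub>t\<in>{1..n}. tensor_assoc K V B B (tens K T' B (tens K V B (e t) (h t s)) (h s i)))"
      using cl s by (intro linear_hom_finsum[OF VB_B.module_axioms VBB.module_axioms al]) auto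
    also have "\<dots> = (\<Oplus>\<^bsub>VBB\<^esub>t\<in>{1..n}. tens K V BB' (e t) (tens K B B (h t s) (h s i)))"
      using cl s by (intro VBB.M.finsum_cong'[OF refl] tensor_assoc_tens[OF V B.module B.module]) auto
    finally show "?f (tens K V B (e s) (h s i))
        = (\<Oplus>\<^bsub>VBB\<^esub>t\<in>{1..n}. tens K V BB' (e t) (tens K B B (h t s) (h s i)))" .
  qed (use cl in \<open>auto intro!: VBB.M.finsum_closed\<close>)
  also have "\<dots> = (\<Oplus>\<^bsub>VBB\<^esub>t\<in>{1..n}. \<Oplus>\<^bsub>VBB\<^esub>s\<in>{1..n}. tens K V BB' (e t) (tens K B B (h t s) (h s i)))"
    using cl by (intro VBB.M.finsum_swap) auto
  also have "\<dots> = (\<Oplus>\<^bsub>VBB\<^esub>t\<in>{1..n}. tens K V BB' (e t) (\<Oplus>\<^bsub>BB'\<^esub>s\<in>{1..n}. tens K B B (h t s) (h s i)))"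
    using cl by (intro VBB.M.finsum_cong'[OF refl] tens_finsum_right[OF V BB.module_axioms, symmetric] Pi_I
      vbbc BB.M.finsum_closed) auto
  finally show ?thesis .
qed

text \<open>The two maps in the comodule axiom have matrices over B \<otimes> B, namely the one from
  \<open>coaction_twice\<close> and \<Delta> applied to each entry of \<open>h\<close>. The maps
  agree exactly when the matrices do.\<close>

lemma coaction_coassoc_iff:
  "(\<forall>v\<in>carrier V. tensor_assoc K V B B (tensor_map K (tensor K V B) B \<rho> (\<lambda>x. x) (\<rho> v))
      = tensor_map K V (tensor K B B) (\<lambda>x. x) \<Delta> (\<rho> v))
    \<longleftrightarrow> (\<forall>t\<in>{1..n}. \<forall>i\<in>{1..n}. \<Delta> (h t i) = (\<Oplus>\<^bsub>BB'\<^esub>s\<in>{1..n}. tens K B B (h t s) (h s i)))" (is "?L = ?R")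
proof
  have sc: "(\<Oplus>\<^bsub>BB'\<^esub>s\<in>{1..n}. tens K B B (h t s) (h s i)) \<in> carrier BB'" "\<Delta> (h t i) \<in> carrier BB'"
    if "i \<in> {1..n}" "t \<in> {1..n}" for i t
    using that h bbc linear_hom_closed[OF Delta] by (auto intro!: BB.M.finsum_closed)
  {
    assume L: ?L
    show ?R
    proof (intro ballI)
      fix t i assume t: "t \<in> {1..n}" and i: "i \<in> {1..n}"
      note L[rule_format, OF eV[OF i], unfolded coaction_twice[OF i] coaction_map[OF BB.module_axioms Delta i], symmetric]
      then show "\<Delta> (h t i) = (\<Oplus>\<^bsub>BB'\<^esub>s\<in>{1..n}. tens K B B (h t s) (h s i))"
        using sc i by (intro tensor_coords_unique[OF V basis BB.module_axioms _ _ _ t, where p="\<lambda>t. \<Delta> (h t i)"])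
    qed
  }
  {
    assume R: ?R
    show ?L
    proof (intro ballI)
      fix v assume v: "v \<in> carrier V"
      show "tensor_assoc K V B B (tensor_map K (tensor K V B) B \<rho> (\<lambda>x. x) (\<rho> v))
        = tensor_map K V (tensor K B B) (\<lambda>x. x) \<Delta> (\<rho> v)"
      proof (rule basis_hom_eqI[OF V basis VBB.module_axioms
            linear_hom_comp[OF linear_hom_comp[OF rho rl] tensor_assoc_linear[OF V B.module B.module]]
            linear_hom_comp[OF rho dl] _ v])
        fix i assume i: "i \<in> {1..n}"
        show "tensor_assoc K V B B (tensor_map K (tensor K V B) B \<rho> (\<lambda>x. x) (\<rho> (e i)))
          = tensor_map K V (tensor K B B) (\<lambda>x. x) \<Delta> (\<rho> (e i))"
          unfolding coaction_twice[OF i] coaction_map[OF BB.module_axioms Delta i] using R sc i eV vbbc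
          by (intro VBB.M.finsum_cong'[OF refl]) auto
      qed
    qed
  }
qed

end

section \<open>The counit axiom in terms of the matrix\<close>

context
  fixes \<epsilon>
  assumes eps: "\<epsilon> \<in> linear_hom K B (scalars K)"
begin

interpretation S: algebra K "scalars K" by (rule scalars_algebra[OF V.R.is_cring])
interpretation VS: module K "tensor K V (scalars K)" by (rule tensor_module[OF V S.module])

lemma coaction_counit_iff:
  "(\<forall>v\<in>carrier V. tensor_map K V (scalars K) (\<lambda>x. x) \<epsilon> (\<rho> v) = tens K V (scalars K) v \<one>)
    \<longleftrightarrow> (\<forall>t\<in>{1..n}. \<forall>i\<in>{1..n}. \<epsilon> (h t i) = (if t = i then \<one> else \<zero>))" (is "?L = ?R")
proof
  note tsc = tens_closed[OF V S.module]
  note tl = tensor_map_linear[OF V B.module V S.module linear_hom_id eps]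
  note ev = linear_hom_closed[OF eps]
  have one: "\<one> \<in> carrier (scalars K)" "\<zero>\<^bsub>scalars K\<^esub> = \<zero>" by (simp_all add: scalars_def)
  have zc: "\<zero> \<in> carrier (scalars K)" by (simp add: scalars_def)
  note 1 = coaction_map[OF S.module eps]
  \<comment> \<open>The map sending v to v \<otimes> 1 is written as a coaction with the identity
    matrix, so that both sides can be compared by entries.\<close>
  have 2: "tens K V (scalars K) (e i) \<one>
      = (\<Oplus>\<^bsub>tensor K V (scalars K)\<^esub>t\<in>{1..n}. tens K V (scalars K) (e t) (if t = i then \<one> else \<zero>))" if i: "i \<in> {1..n}" for i
  proof -
    have z: "tens K V (scalars K) v \<zero> = \<zero>\<^bsub>tensor K V (scalars K)\<^esub>" if "v \<in> carrier V" for v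
      using linear_hom_zero[OF S.module VS.module_axioms bilin_map_right[OF tens_bilin[OF V S.module] that]]
      by (simp add: one)
    have "(\<Oplus>\<^bsub>tensor K V (scalars K)\<^esub>t\<in>{1..n}. tens K V (scalars K) (e t) (if t = i then \<one> else \<zero>))
      = (\<Oplus>\<^bsub>tensor K V (scalars K)\<^esub>t\<in>{1..n}. if i = t then tens K V (scalars K) (e t) \<one> else \<zero>\<^bsub>tensor K V (scalars K)\<^esub>)"
      using i eV tsc one by (intro VS.M.finsum_cong'[OF refl]) (auto simp: z)
    also have "\<dots> = tens K V (scalars K) (e i) \<one>"
      using i eV tsc one by (intro VS.M.finsum_singleton) auto
    finally show ?thesis by simp
  qed
  {
    assume L: ?L
    show ?R
    proof (intro ballI)
      fix t i assume t: "t \<in> {1..n}" and i: "i \<in> {1..n}"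
      have E: "(\<Oplus>\<^bsub>tensor K V (scalars K)\<^esub>t\<in>{1..n}. tens K V (scalars K) (e t) (\<epsilon> (h t i)))
        = (\<Oplus>\<^bsub>tensor K V (scalars K)\<^esub>t\<in>{1..n}. tens K V (scalars K) (e t) (if t = i then \<one> else \<zero>))"
        using L eV i 1[OF i] 2[OF i] by simp
      show "\<epsilon> (h t i) = (if t = i then \<one> else \<zero>)"
        using h i ev one zc
        by (intro tensor_coords_unique[OF V basis S.module _ _ E t]) auto
    qed
  }
  {
    assume R: ?R
    show ?L
    proof (intro ballI)
      fix v assume v: "v \<in> carrier V"
      show "tensor_map K V (scalars K) (\<lambda>x. x) \<epsilon> (\<rho> v) = tens K V (scalars K) v \<one>"
      proof (rule basis_hom_eqI[OF V basis VS.module_axioms linear_hom_comp[OF rho tl]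
            bilin_map_left[OF tens_bilin[OF V S.module] one(1)] _ v])
        fix i assume i: "i \<in> {1..n}"
        show "tensor_map K V (scalars K) (\<lambda>x. x) \<epsilon> (\<rho> (e i)) = tens K V (scalars K) (e i) \<one>"
          unfolding 1[OF i] 2[OF i] using R i eV tsc one zc by (intro VS.M.finsum_cong'[OF refl]) auto
      qed
    qed
  }
qed

end

end

section \<open>The universal bialgebra\<close>

text \<open>The comultiplication is specified with tensors over \<open>univ_alg\<close>, while the
  bialgebra axioms use tensors over \<open>univ_bialg\<close>. These records have different types
  but the same operations, and only the operations enter the construction.\<close>

lemma tensor_cong:
  assumes "carrier V = carrier V'" "add V = add V'" "smult V = smult V'"
    and "monoid.mult V = monoid.mult V'" "one V = one V'"
    and "carrier W = carrier W'" "add W = add W'" "smult W = smult W'"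
    and "monoid.mult W = monoid.mult W'" "one W = one W'"
  shows "tens K V W = tens K V' W'" "tensor K V W = tensor K V' W'"
proof -
  have sub: "bilin_sub K V W = bilin_sub K V' W'"
    unfolding bilin_sub_def bilin_rels_def Let_def assms ..
  show t: "tens K V W = tens K V' W'" by (intro ext) (simp add: tens_def sub assms)
  have ts: "tensor_space K V W = tensor_space K V' W'" by (simp add: tensor_space_def sub assms)
  have "tens_op K V W = tens_op K V' W'" by (intro ext) (simp add: tens_op_def ts t)
  then show "tensor K V W = tensor K V' W'" by (simp add: tensor_def t ts assms)
qed

lemma (in poisson_algebra) mult_bilin: "bilin_map K P P P (monoid.mult P)"
proof (rule bilin_mapI)
  fix x y z assume "x \<in> carrier P" "y \<in> carrier P" "z \<in> carrier P"
  then show "x \<otimes>\<^bsub>P\<^esub> (y \<oplus>\<^bsub>P\<^esub> z) = x \<otimes>\<^bsub>P\<^esub> y \<oplus>\<^bsub>P\<^esub> x \<otimes>\<^bsub>P\<^esub> z"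
    using mult_add[of y z x] by (simp add: mult_commute)
next
  fix a x y assume "a \<in> carrier K" "x \<in> carrier P" "y \<in> carrier P"
  then show "x \<otimes>\<^bsub>P\<^esub> (a \<odot>\<^bsub>P\<^esub> y) = a \<odot>\<^bsub>P\<^esub> (x \<otimes>\<^bsub>P\<^esub> y)"
    using mult_smult[of a y x] by (simp add: mult_commute)
qed (auto simp: mult_closed mult_add mult_smult)

lemma (in poisson_algebra) lie_bilin: "bilin_map K P P P (lie P)"
  by (rule bilin_mapI) (auto simp: lie_closed lie_add_left lie_add_right lie_smult_left lie_smult_right)

section \<open>The universal algebra and its universal property\<close>

locale based_poisson_algebra = poisson_algebra +
  fixes n :: nat and e
  assumes basis: "is_basis K P n e"
begin

abbreviation (input) "MP \<equiv> mpoly_alg K ({1..n} \<times> {1..n})"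
abbreviation (input) "UA \<equiv> univ_alg K P n e"
abbreviation (input) "UI \<equiv> univ_ideal K P n e"
abbreviation (input) "X \<equiv> univ_gen K P n e"
abbreviation (input) "H \<equiv> univ_bialg K P n e"
abbreviation (input) "sc b i j u \<equiv> coords K P n e (b (e i) (e j)) u"

lemma K_cring: "cring K" by (rule R.is_cring)

lemma P_module: "module K P" by (rule module_axioms)

lemmas e_closed = basis_closed[OF P_module basis]

declare One_nat_def [simp del] tensor_simps [simp del] atLeastAtMost_iff [simp del]

interpretation MP: algebra K MP by (rule mpoly_algebra[OF K_cring])

lemma sc_closed:
  assumes "bilin_map K P P P b" "i \<in> {1..n}" "j \<in> {1..n}" "u \<in> {1..n}"
  shows "sc b i j u \<in> carrier K"
  using assms by (intro coords_closed[OF P_module basis] bilin_map_closed[OF assms(1)] e_closed)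

lemma var_closed: "\<lbrakk>s \<in> {1..n}; i \<in> {1..n}\<rbrakk> \<Longrightarrow> delta K {#(s, i)#} \<in> carrier MP"
  by (rule mpoly_delta_closed[OF K_cring]) simp

lemma univ_rels_eq: "univ_rels K P n e b =
    {(\<Oplus>\<^bsub>MP\<^esub>u\<in>{1..n}. sc b i j u \<odot>\<^bsub>MP\<^esub> delta K {#(a, u)#}) \<ominus>\<^bsub>MP\<^esub>
     (\<Oplus>\<^bsub>MP\<^esub>s\<in>{1..n}. \<Oplus>\<^bsub>MP\<^esub>t\<in>{1..n}. sc b s t a \<odot>\<^bsub>MP\<^esub> (delta K {#(s, i)#} \<otimes>\<^bsub>MP\<^esub> delta K {#(t, j)#})) |a i j.
     a \<in> {1..n} \<and> i \<in> {1..n} \<and> j \<in> {1..n}}"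
  by (simp add: univ_rels_def Let_def)

lemma rel_sides_closed:
  assumes b: "bilin_map K P P P b" and "a \<in> {1..n}" "i \<in> {1..n}" "j \<in> {1..n}"
  shows "(\<Oplus>\<^bsub>MP\<^esub>u\<in>{1..n}. sc b i j u \<odot>\<^bsub>MP\<^esub> delta K {#(a, u)#}) \<in> carrier MP"
    and "(\<Oplus>\<^bsub>MP\<^esub>s\<in>{1..n}. \<Oplus>\<^bsub>MP\<^esub>t\<in>{1..n}. sc b s t a \<odot>\<^bsub>MP\<^esub> (delta K {#(s, i)#} \<otimes>\<^bsub>MP\<^esub> delta K {#(t, j)#})) \<in> carrier MP"
  using assms sc_closed[OF b] var_closed by (auto intro!: MP.M.finsum_closed)

lemma rel_sides_hom:
  assumes b: "bilin_map K P P P b" and B: "algebra K B" and f: "f \<in> alg_hom K MP B"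
    and aij: "a \<in> {1..n}" "i \<in> {1..n}" "j \<in> {1..n}"
  shows "f (\<Oplus>\<^bsub>MP\<^esub>u\<in>{1..n}. sc b i j u \<odot>\<^bsub>MP\<^esub> delta K {#(a, u)#})
      = (\<Oplus>\<^bsub>B\<^esub>u\<in>{1..n}. sc b i j u \<odot>\<^bsub>B\<^esub> f (delta K {#(a, u)#}))"
    and "f (\<Oplus>\<^bsub>MP\<^esub>s\<in>{1..n}. \<Oplus>\<^bsub>MP\<^esub>t\<in>{1..n}. sc b s t a \<odot>\<^bsub>MP\<^esub> (delta K {#(s, i)#} \<otimes>\<^bsub>MP\<^esub> delta K {#(t, j)#}))
      = (\<Oplus>\<^bsub>B\<^esub>s\<in>{1..n}. \<Oplus>\<^bsub>B\<^esub>t\<in>{1..n}. sc b s t a \<odot>\<^bsub>B\<^esub> (f (delta K {#(s, i)#}) \<otimes>\<^bsub>B\<^esub> f (delta K {#(t, j)#})))"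
  using struct_rel_sums_hom[OF MP.algebra_axioms B f finite_atLeastAtMost, where g = "\<lambda>i j u. sc b i j u"
      and y = "\<lambda>s i. delta K {#(s, i)#}", OF sc_closed[OF b] var_closed aij] by simp_all

lemma univ_rels_closed: "bilin_map K P P P b \<Longrightarrow> univ_rels K P n e b \<subseteq> carrier MP"
  unfolding univ_rels_eq using rel_sides_closed[of b] by (auto intro!: MP.M.minus_closed)

lemma rels_closed: "univ_rels K P n e (monoid.mult P) \<union> univ_rels K P n e (lie P) \<subseteq> carrier MP"
  using univ_rels_closed[OF mult_bilin] univ_rels_closed[OF lie_bilin] by simp

lemma univ_ideal_ideal: "ideal UI MP"
  unfolding univ_ideal_def by (rule MP.genideal_ideal[OF rels_closed])

lemma univ_alg_algebra: "algebra K UA"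
  unfolding univ_alg_def by (rule MP.quot_algebra[OF univ_ideal_ideal])

interpretation UA: algebra K UA by (rule univ_alg_algebra)

lemma univ_alg_proj: "(\<lambda>x. UI +>\<^bsub>MP\<^esub> x) \<in> alg_hom K MP UA"
  unfolding univ_alg_def by (rule MP.quot_proj_alg_hom[OF univ_ideal_ideal])

lemma univ_gen_closed: "\<lbrakk>s \<in> {1..n}; i \<in> {1..n}\<rbrakk> \<Longrightarrow> X s i \<in> carrier UA"
  unfolding univ_gen_def by (intro alg_hom_closed[OF univ_alg_proj] var_closed)

text \<open>The difference of the two sides, formed from variables, is one of the elements
  generating the ideal, so the sides become equal in the quotient.\<close>

lemma univ_gen_rel:
  assumes b: "b = monoid.mult P \<or> b = lie P"
  shows "struct_rel K {1..n} (\<lambda>i j u. sc b i j u) UA X"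
  unfolding struct_rel_def
proof (intro ballI)
  fix a i j assume aij: "a \<in> {1..n}" "i \<in> {1..n}" "j \<in> {1..n}"
  have bil: "bilin_map K P P P b" using b mult_bilin lie_bilin by blast
  let ?L = "\<Oplus>\<^bsub>MP\<^esub>u\<in>{1..n}. sc b i j u \<odot>\<^bsub>MP\<^esub> delta K {#(a, u)#}"
  let ?R = "\<Oplus>\<^bsub>MP\<^esub>s\<in>{1..n}. \<Oplus>\<^bsub>MP\<^esub>t\<in>{1..n}. sc b s t a \<odot>\<^bsub>MP\<^esub> (delta K {#(s, i)#} \<otimes>\<^bsub>MP\<^esub> delta K {#(t, j)#})"
  have "?L \<ominus>\<^bsub>MP\<^esub> ?R \<in> univ_rels K P n e b" unfolding univ_rels_eq using aij by blast
  then have "?L \<ominus>\<^bsub>MP\<^esub> ?R \<in> UI" unfolding univ_ideal_def using b MP.genideal_self[OF rels_closed] by blast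
  then have "UI +>\<^bsub>MP\<^esub> ?L = UI +>\<^bsub>MP\<^esub> ?R"
    using rel_sides_closed[OF bil aij] by (subst MP.coset_eq_iff[OF MP.ideal_submodule[OF univ_ideal_ideal]])
  then show "(\<Oplus>\<^bsub>UA\<^esub>u\<in>{1..n}. sc b i j u \<odot>\<^bsub>UA\<^esub> X a u)
      = (\<Oplus>\<^bsub>UA\<^esub>s\<in>{1..n}. \<Oplus>\<^bsub>UA\<^esub>t\<in>{1..n}. sc b s t a \<odot>\<^bsub>UA\<^esub> (X s i \<otimes>\<^bsub>UA\<^esub> X t j))"
    unfolding univ_gen_def
    using rel_sides_hom[OF bil univ_alg_algebra univ_alg_proj aij] by simp
qed

text \<open>Evaluation of polynomials at \<open>y\<close> kills the generators of the ideal by the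
  relations assumed for both products, hence factors through the quotient.\<close>

lemma univ_hom_exists:
  assumes B: "algebra K B" and y: "\<And>s i. \<lbrakk>s \<in> {1..n}; i \<in> {1..n}\<rbrakk> \<Longrightarrow> y s i \<in> carrier B"
    and rel: "\<And>b. b = monoid.mult P \<or> b = lie P \<Longrightarrow> struct_rel K {1..n} (\<lambda>i j u. sc b i j u) B y"
  obtains f where "f \<in> alg_hom K UA B" "f \<in> extensional (carrier UA)"
    "\<And>s i. \<lbrakk>s \<in> {1..n}; i \<in> {1..n}\<rbrakk> \<Longrightarrow> f (X s i) = y s i"
proof -
  interpret B: algebra K B by fact
  obtain f where f: "f \<in> alg_hom K MP B"
    and fv: "\<And>si. si \<in> {1..n} \<times> {1..n} \<Longrightarrow> f (delta K {#si#}) = (case si of (s, i) \<Rightarrow> y s i)"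
    by (rule mpoly_alg_hom_exists[OF K_cring B, of "{1..n} \<times> {1..n}" "\<lambda>(s, i). y s i"]) (use y in auto)
  have "univ_rels K P n e b \<subseteq> {x \<in> carrier MP. f x = \<zero>\<^bsub>B\<^esub>}" if b: "b = monoid.mult P \<or> b = lie P" for b
  proof
    fix r assume r: "r \<in> univ_rels K P n e b"
    have bil: "bilin_map K P P P b" using b mult_bilin lie_bilin by blast
    from r obtain a i j where aij: "a \<in> {1..n}" "i \<in> {1..n}" "j \<in> {1..n}"
      and r': "r = (\<Oplus>\<^bsub>MP\<^esub>u\<in>{1..n}. sc b i j u \<odot>\<^bsub>MP\<^esub> delta K {#(a, u)#}) \<ominus>\<^bsub>MP\<^esub>
        (\<Oplus>\<^bsub>MP\<^esub>s\<in>{1..n}. \<Oplus>\<^bsub>MP\<^esub>t\<in>{1..n}. sc b s t a \<odot>\<^bsub>MP\<^esub> (delta K {#(s, i)#} \<otimes>\<^bsub>MP\<^esub> delta K {#(t, j)#}))"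
      unfolding univ_rels_eq by blast
    note S = rel_sides_hom[OF bil B f aij]
    have 1: "(\<Oplus>\<^bsub>B\<^esub>u\<in>{1..n}. sc b i j u \<odot>\<^bsub>B\<^esub> f (delta K {#(a, u)#})) = (\<Oplus>\<^bsub>B\<^esub>u\<in>{1..n}. sc b i j u \<odot>\<^bsub>B\<^esub> y a u)"
      using aij y sc_closed[OF bil] fv by (intro B.M.finsum_cong'[OF refl]) auto
    have 2: "(\<Oplus>\<^bsub>B\<^esub>s\<in>{1..n}. \<Oplus>\<^bsub>B\<^esub>t\<in>{1..n}. sc b s t a \<odot>\<^bsub>B\<^esub> (f (delta K {#(s, i)#}) \<otimes>\<^bsub>B\<^esub> f (delta K {#(t, j)#})))
        = (\<Oplus>\<^bsub>B\<^esub>s\<in>{1..n}. \<Oplus>\<^bsub>B\<^esub>t\<in>{1..n}. sc b s t a \<odot>\<^bsub>B\<^esub> (y s i \<otimes>\<^bsub>B\<^esub> y t j))"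
      using aij y sc_closed[OF bil] fv by (intro B.M.finsum_cong'[OF refl]) (auto intro!: B.M.finsum_closed)
    have cl: "(\<Oplus>\<^bsub>B\<^esub>s\<in>{1..n}. \<Oplus>\<^bsub>B\<^esub>t\<in>{1..n}. sc b s t a \<odot>\<^bsub>B\<^esub> (y s i \<otimes>\<^bsub>B\<^esub> y t j)) \<in> carrier B"
      using aij y sc_closed[OF bil] by (auto intro!: B.M.finsum_closed)
    have "f r = (\<Oplus>\<^bsub>B\<^esub>u\<in>{1..n}. sc b i j u \<odot>\<^bsub>B\<^esub> y a u) \<ominus>\<^bsub>B\<^esub>
        (\<Oplus>\<^bsub>B\<^esub>s\<in>{1..n}. \<Oplus>\<^bsub>B\<^esub>t\<in>{1..n}. sc b s t a \<odot>\<^bsub>B\<^esub> (y s i \<otimes>\<^bsub>B\<^esub> y t j))"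
      unfolding r' linear_hom_minus[OF MP.module B.module alg_hom_linear[OF f] rel_sides_closed[OF bil aij]]
      using S var_closed 1 2 by simp
    also have "\<dots> = \<zero>\<^bsub>B\<^esub>"
      using rel[OF b] aij cl unfolding struct_rel_def by (simp add: B.M.minus_eq B.M.r_neg)
    finally show "r \<in> {x \<in> carrier MP. f x = \<zero>\<^bsub>B\<^esub>}" using r univ_rels_closed[OF bil] by blast
  qed
  \<comment> \<open>The kernel of the evaluation is an ideal, so it contains the ideal generated by
    the relations as soon as it contains the relations.\<close>
  then have "UI \<subseteq> {x \<in> carrier MP. f x = \<zero>\<^bsub>B\<^esub>}"
    unfolding univ_ideal_def by (intro MP.genideal_minimal alg_hom_kernel_ideal[OF MP.algebra_axioms B f]) blast
  then have null: "\<And>x. x \<in> UI \<Longrightarrow> f x = \<zero>\<^bsub>B\<^esub>" by blast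
  obtain h where h: "h \<in> alg_hom K UA B" "h \<in> extensional (carrier UA)"
    "\<And>x. x \<in> carrier MP \<Longrightarrow> h (UI +>\<^bsub>MP\<^esub> x) = f x"
    using MP.quot_alg_hom_exists[OF B univ_ideal_ideal f null] unfolding univ_alg_def[symmetric] by blast
  show ?thesis
    by (rule that[OF h(1,2)]) (simp add: univ_gen_def h(3) var_closed fv)
qed

lemma univ_hom_eqI:
  assumes B: "algebra K B" and f: "f \<in> alg_hom K UA B" and g: "g \<in> alg_hom K UA B"
    and eq: "\<And>s i. \<lbrakk>s \<in> {1..n}; i \<in> {1..n}\<rbrakk> \<Longrightarrow> f (X s i) = g (X s i)" and x: "x \<in> carrier UA"
  shows "f x = g x"
proof -
  obtain m where m: "m \<in> carrier MP" "x = UI +>\<^bsub>MP\<^esub> m"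
    using x MP.quot_carrier[OF MP.ideal_submodule[OF univ_ideal_ideal]] unfolding univ_alg_def by blast
  show ?thesis unfolding m(2)
    by (rule mpoly_alg_hom_eqI[OF K_cring B alg_hom_comp[OF univ_alg_proj f] alg_hom_comp[OF univ_alg_proj g] _ m(1)])
      (use eq in \<open>auto simp: univ_gen_def\<close>)
qed

text \<open>Two algebra maps agreeing on generators agree on the carrier; extensionality settles all
  other arguments, as a definite description and a unique existence claim require.\<close>

lemma univ_hom_unique:
  assumes B: "algebra K B" and f: "f \<in> alg_hom K UA B" "f \<in> extensional (carrier UA)"
    and g: "g \<in> alg_hom K UA B" "g \<in> extensional (carrier UA)"
    and eq: "\<And>s i. \<lbrakk>s \<in> {1..n}; i \<in> {1..n}\<rbrakk> \<Longrightarrow> f (X s i) = g (X s i)"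
  shows "f = g"
  by (rule extensionalityI[OF f(2) g(2)]) (rule univ_hom_eqI[OF B f(1) g(1) eq])

subsection \<open>Comultiplication and counit\<close>

lemma univ_bialg_simps [simp]:
  "carrier H = carrier UA" "zero H = zero UA" "add H = add UA" "smult H = smult UA"
  "monoid.mult H = monoid.mult UA" "one H = one UA"
  "comult H = univ_comult K P n e" "counit H = univ_counit K P n e"
  by (simp_all add: univ_bialg_def module.defs bialg.defs)

lemma univ_bialg_tensor:
  "tens K H H = tens K UA UA" "tensor K H H = tensor K UA UA"
  "tens K P H = tens K P UA" "tensor K P H = tensor K P UA"
  by (rule tensor_cong; simp)+

lemma univ_bialg_algebra: "algebra K H"
  by (rule algebra_surj[OF univ_alg_algebra, of id]) simp_all

lemma univ_bialg_alg_hom: "alg_hom K H B = alg_hom K UA B"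
  by (simp add: alg_hom_def ring_hom_def linear_hom_def)

interpretation H: algebra K H by (rule univ_bialg_algebra)
interpretation HH: algebra K "tensor K H H" by (rule tensor_algebra[OF univ_bialg_algebra univ_bialg_algebra])
interpretation S: algebra K "scalars K" by (rule scalars_algebra[OF K_cring])

lemma univ_gen_closed_bialg: "\<lbrakk>s \<in> {1..n}; i \<in> {1..n}\<rbrakk> \<Longrightarrow> X s i \<in> carrier H"
  by (simp add: univ_gen_closed)

lemma univ_gen_rel_bialg: "b = monoid.mult P \<or> b = lie P \<Longrightarrow> struct_rel K {1..n} (\<lambda>i j u. sc b i j u) H X"
  using univ_gen_rel[of b] by (simp add: struct_rel_def finsum_def finprod_def)

text \<open>The generic matrix satisfies the relations, hence so do its images under the two
  embeddings into the tensor square, and hence so does the product of these images. The universal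
  property then yields the map.\<close>

lemma comult_exists: "\<exists>f. f \<in> alg_hom K UA (tensor K H H) \<inter> extensional (carrier UA) \<and>
  (\<forall>i\<in>{1..n}. \<forall>j\<in>{1..n}. f (X i j) = (\<Oplus>\<^bsub>tensor K H H\<^esub>s\<in>{1..n}. tens K H H (X i s) (X s j)))"
proof -
  let ?T = "tensor K H H"
  note l = tensor_left_hom[OF univ_bialg_algebra univ_bialg_algebra] and r = tensor_right_hom[OF univ_bialg_algebra univ_bialg_algebra]
  have rel: "struct_rel K {1..n} (\<lambda>i j u. sc b i j u) ?T (\<lambda>i j. \<Oplus>\<^bsub>?T\<^esub>s\<in>{1..n}. tens K H H (X i s) (X s j))"
    if b: "b = monoid.mult P \<or> b = lie P" for b
  proof -
    have bil: "bilin_map K P P P b" using b mult_bilin lie_bilin by blast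
    note hom = struct_rel_hom[OF univ_bialg_algebra HH.algebra_axioms _ finite_atLeastAtMost sc_closed[OF bil] univ_gen_closed_bialg univ_gen_rel_bialg[OF b]]
    have "struct_rel K {1..n} (\<lambda>i j u. sc b i j u) ?T (\<lambda>i j. \<Oplus>\<^bsub>?T\<^esub>s\<in>{1..n}. tens K H H (X i s) \<one>\<^bsub>H\<^esub> \<otimes>\<^bsub>?T\<^esub> tens K H H \<one>\<^bsub>H\<^esub> (X s j))"
      using alg_hom_closed[OF l] alg_hom_closed[OF r] univ_gen_closed_bialg
      by (intro HH.struct_rel_mult hom[OF l] hom[OF r] sc_closed[OF bil]) (auto simp del: univ_bialg_simps)
    \<comment> \<open>Multiplying the pure tensors brings the entries into the form prescribed by
      \<open>univ_comult\<close>.\<close>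
    moreover have "(\<Oplus>\<^bsub>?T\<^esub>s\<in>{1..n}. tens K H H (X i s) \<one>\<^bsub>H\<^esub> \<otimes>\<^bsub>?T\<^esub> tens K H H \<one>\<^bsub>H\<^esub> (X s j))
        = (\<Oplus>\<^bsub>?T\<^esub>s\<in>{1..n}. tens K H H (X i s) (X s j))" if "i \<in> {1..n}" "j \<in> {1..n}" for i j
      using that univ_gen_closed_bialg tens_closed[OF H.module H.module]
      by (intro HH.M.finsum_cong'[OF refl]) (auto simp: tensor_mult_tens[OF univ_bialg_algebra univ_bialg_algebra] simp del: univ_bialg_simps)
    ultimately show ?thesis
      using alg_hom_closed[OF l] alg_hom_closed[OF r] univ_gen_closed_bialg sc_closed[OF bil] tens_closed[OF H.module H.module]
      by (elim HH.struct_rel_cong[rotated 3]) (auto intro!: HH.M.finsum_closed simp del: univ_bialg_simps)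
  qed
  obtain f where "f \<in> alg_hom K UA ?T" "f \<in> extensional (carrier UA)"
    "\<And>i j. \<lbrakk>i \<in> {1..n}; j \<in> {1..n}\<rbrakk> \<Longrightarrow> f (X i j) = (\<Oplus>\<^bsub>?T\<^esub>s\<in>{1..n}. tens K H H (X i s) (X s j))"
    by (rule univ_hom_exists[OF HH.algebra_axioms _ rel])
      (use univ_gen_closed_bialg tens_closed[OF H.module H.module] in \<open>auto intro!: HH.M.finsum_closed simp del: univ_bialg_simps\<close>)
  then show ?thesis by blast
qed

text \<open>Existence together with \<open>univ_hom_unique\<close> makes the description denote the
  intended map; from here on only these properties of it are used.\<close>

lemma comult_spec: "univ_comult K P n e \<in> alg_hom K H (tensor K H H)"
    "univ_comult K P n e \<in> extensional (carrier UA)"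
    "\<lbrakk>i \<in> {1..n}; j \<in> {1..n}\<rbrakk> \<Longrightarrow>
      univ_comult K P n e (X i j) = (\<Oplus>\<^bsub>tensor K H H\<^esub>s\<in>{1..n}. tens K H H (X i s) (X s j))"
proof -
  let ?Q = "\<lambda>f. f \<in> alg_hom K UA (tensor K H H) \<inter> extensional (carrier UA) \<and>
    (\<forall>i\<in>{1..n}. \<forall>j\<in>{1..n}. f (X i j) = (\<Oplus>\<^bsub>tensor K H H\<^esub>s\<in>{1..n}. tens K H H (X i s) (X s j)))"
  have "\<exists>!f. ?Q f"
  proof (rule ex_ex1I[OF comult_exists])
    fix f g assume fg: "?Q f" "?Q g"
    then show "f = g" by (intro univ_hom_unique[OF HH.algebra_axioms]) (blast | simp)+
  qed
  then have "?Q (THE f. ?Q f)" by (rule theI')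
  also have "(THE f. ?Q f) = univ_comult K P n e" by (simp add: univ_comult_def Let_def univ_bialg_tensor)
  finally have Q: "?Q (univ_comult K P n e)" .
  show "univ_comult K P n e \<in> alg_hom K H (tensor K H H)" using Q by (simp add: univ_bialg_alg_hom)
  show "univ_comult K P n e \<in> extensional (carrier UA)" using Q by blast
  show "univ_comult K P n e (X i j) = (\<Oplus>\<^bsub>tensor K H H\<^esub>s\<in>{1..n}. tens K H H (X i s) (X s j))"
    if "i \<in> {1..n}" "j \<in> {1..n}" using Q that by blast
qed

text \<open>The identity matrix over the scalars satisfies the relations by
  \<open>struct_rel_unit\<close>, so the universal property supplies the map being
  described.\<close>

lemma counit_spec: "univ_counit K P n e \<in> alg_hom K H (scalars K)"
    "\<lbrakk>i \<in> {1..n}; j \<in> {1..n}\<rbrakk> \<Longrightarrow> univ_counit K P n e (X i j) = (if i = j then \<one>\<^bsub>K\<^esub> else \<zero>\<^bsub>K\<^esub>)"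
proof -
  let ?Q = "\<lambda>f. f \<in> alg_hom K UA (scalars K) \<inter> extensional (carrier UA) \<and>
    (\<forall>i\<in>{1..n}. \<forall>j\<in>{1..n}. f (X i j) = (if i = j then \<one>\<^bsub>K\<^esub> else \<zero>\<^bsub>K\<^esub>))"
  have ex: "\<exists>f. ?Q f"
  proof -
    have rel: "struct_rel K {1..n} (\<lambda>i j u. sc b i j u) (scalars K) (\<lambda>i j. if i = j then \<one>\<^bsub>K\<^esub> else \<zero>\<^bsub>K\<^esub>)"
      if "b = monoid.mult P \<or> b = lie P" for b
      using that mult_bilin lie_bilin by (intro R.struct_rel_unit sc_closed) auto
    obtain f where "f \<in> alg_hom K UA (scalars K)" "f \<in> extensional (carrier UA)"
      "\<And>i j. \<lbrakk>i \<in> {1..n}; j \<in> {1..n}\<rbrakk> \<Longrightarrow> f (X i j) = (if i = j then \<one>\<^bsub>K\<^esub> else \<zero>\<^bsub>K\<^esub>)"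
      by (rule univ_hom_exists[OF S.algebra_axioms _ rel]) (auto simp: scalars_def)
    then show ?thesis by blast
  qed
  have "\<exists>!f. ?Q f"
  proof (rule ex_ex1I[OF ex])
    fix f g assume fg: "?Q f" "?Q g"
    then show "f = g" by (intro univ_hom_unique[OF S.algebra_axioms]) (blast | simp)+
  qed
  then have "?Q (THE f. ?Q f)" by (rule theI')
  also have "(THE f. ?Q f) = univ_counit K P n e" by (simp add: univ_counit_def Let_def)
  finally have Q: "?Q (univ_counit K P n e)" .
  show "univ_counit K P n e \<in> alg_hom K H (scalars K)" using Q by (simp add: univ_bialg_alg_hom)
  show "univ_counit K P n e (X i j) = (if i = j then \<one>\<^bsub>K\<^esub> else \<zero>\<^bsub>K\<^esub>)"
    if "i \<in> {1..n}" "j \<in> {1..n}" using Q that by blast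
qed

abbreviation (input) "D \<equiv> univ_comult K P n e"
abbreviation (input) "E \<equiv> univ_counit K P n e"

lemma univ_bialg_hom_eqI:
  assumes "algebra K B" "f \<in> alg_hom K H B" "g \<in> alg_hom K H B"
    and "\<And>s i. \<lbrakk>s \<in> {1..n}; i \<in> {1..n}\<rbrakk> \<Longrightarrow> f (X s i) = g (X s i)" and "x \<in> carrier H"
  shows "f x = g x"
  by (rule univ_hom_eqI[OF assms(1) assms(2,3)[unfolded univ_bialg_alg_hom] assms(4) assms(5)[unfolded univ_bialg_simps]])

lemma hom_comult_X:
  assumes U: "module K U" and f: "f \<in> linear_hom K (tensor K H H) U" and i: "i \<in> {1..n}" and j: "j \<in> {1..n}"
  shows "f (D (X i j)) = (\<Oplus>\<^bsub>U\<^esub>s\<in>{1..n}. f (tens K H H (X i s) (X s j)))"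
  unfolding comult_spec(3)[OF i j] using univ_gen_closed_bialg i j tens_closed[OF H.module H.module]
  by (intro linear_hom_finsum[OF HH.module U f]) (auto simp del: univ_bialg_simps)

text \<open>Both sides are algebra maps, so the generators suffice. There the law is the
  associativity of the matrix product, with tensors in place of products of entries.\<close>

lemma univ_coassoc:
  assumes "x \<in> carrier H"
  shows "tensor_assoc K H H H (tensor_map K (tensor K H H) H D (\<lambda>x. x) (D x)) =
    tensor_map K H (tensor K H H) (\<lambda>x. x) D (D x)"
proof -
  let ?T = "tensor K H (tensor K H H)" and ?T' = "tensor K (tensor K H H) H"
  interpret T: algebra K ?T by (rule tensor_algebra[OF univ_bialg_algebra HH.algebra_axioms])
  interpret T': algebra K ?T' by (rule tensor_algebra[OF HH.algebra_axioms univ_bialg_algebra])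
  note D = comult_spec(1) and Dl = alg_hom_linear[OF comult_spec(1)]
  note f1 = tensor_map_alg_hom[OF univ_bialg_algebra univ_bialg_algebra HH.algebra_axioms univ_bialg_algebra D alg_hom_id]
  note f2 = tensor_map_alg_hom[OF univ_bialg_algebra univ_bialg_algebra univ_bialg_algebra HH.algebra_axioms alg_hom_id D]
  note as = tensor_assoc_alg_hom[OF univ_bialg_algebra univ_bialg_algebra univ_bialg_algebra]
  note asl = alg_hom_linear[OF as]
  note tc = tens_closed[OF H.module H.module] tens_closed[OF H.module HH.module] tens_closed[OF HH.module H.module]
  note cl = univ_gen_closed_bialg tc
  show ?thesis
  proof (rule univ_bialg_hom_eqI[OF T.algebra_axioms alg_hom_comp[OF alg_hom_comp[OF D f1] as] alg_hom_comp[OF D f2] _ assms])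
    fix i j assume i: "i \<in> {1..n}" and j: "j \<in> {1..n}"
    have "tensor_assoc K H H H (tensor_map K (tensor K H H) H D (\<lambda>x. x) (D (X i j)))
      = (\<Oplus>\<^bsub>?T\<^esub>s\<in>{1..n}. tensor_assoc K H H H (tensor_map K (tensor K H H) H D (\<lambda>x. x) (tens K H H (X i s) (X s j))))"
      by (rule hom_comult_X[OF T.module linear_hom_comp[OF alg_hom_linear[OF f1] asl] i j])
    also have "\<dots> = (\<Oplus>\<^bsub>?T\<^esub>s\<in>{1..n}. \<Oplus>\<^bsub>?T\<^esub>t\<in>{1..n}. tens K H (tensor K H H) (X i t) (tens K H H (X t s) (X s j)))"
    proof (intro T.M.finsum_cong'[OF refl])
      fix s assume s: "s \<in> {1..n}"
      note XHs = univ_gen_closed_bialg[OF s j]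
      have "tensor_map K (tensor K H H) H D (\<lambda>x. x) (tens K H H (X i s) (X s j)) = tens K (tensor K H H) H (D (X i s)) (X s j)"
        by (rule tensor_map_tens[OF H.module H.module HH.module H.module Dl linear_hom_id univ_gen_closed_bialg[OF i s] XHs])
      also have "\<dots> = (\<Oplus>\<^bsub>?T'\<^esub>t\<in>{1..n}. tens K (tensor K H H) H (tens K H H (X i t) (X t s)) (X s j))"
        by (rule hom_comult_X[OF T'.module bilin_map_left[OF tens_bilin[OF HH.module H.module] XHs] i s])
      finally have "tensor_assoc K H H H (tensor_map K (tensor K H H) H D (\<lambda>x. x) (tens K H H (X i s) (X s j)))
        = tensor_assoc K H H H (\<Oplus>\<^bsub>?T'\<^esub>t\<in>{1..n}. tens K (tensor K H H) H (tens K H H (X i t) (X t s)) (X s j))" by simp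
      also have "\<dots> = (\<Oplus>\<^bsub>?T\<^esub>t\<in>{1..n}. tensor_assoc K H H H (tens K (tensor K H H) H (tens K H H (X i t) (X t s)) (X s j)))"
        using cl i j s by (intro linear_hom_finsum[OF T'.module T.module asl]) (auto simp del: univ_bialg_simps)
      also have "\<dots> = (\<Oplus>\<^bsub>?T\<^esub>t\<in>{1..n}. tens K H (tensor K H H) (X i t) (tens K H H (X t s) (X s j)))"
        using cl i j s
        by (intro T.M.finsum_cong'[OF refl] tensor_assoc_tens[OF H.module H.module H.module]) (auto simp del: univ_bialg_simps)
      finally show "tensor_assoc K H H H (tensor_map K (tensor K H H) H D (\<lambda>x. x) (tens K H H (X i s) (X s j)))
        = (\<Oplus>\<^bsub>?T\<^esub>t\<in>{1..n}. tens K H (tensor K H H) (X i t) (tens K H H (X t s) (X s j)))" .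
    qed (use cl i j in \<open>auto intro!: T.M.finsum_closed simp del: univ_bialg_simps\<close>)
    \<comment> \<open>Applying \<open>D\<close> to the left factor expands the inner index first,
      applying it to the right factor expands it last; exchanging the two sums reconciles the
      orders.\<close>
    also have "\<dots> = (\<Oplus>\<^bsub>?T\<^esub>t\<in>{1..n}. \<Oplus>\<^bsub>?T\<^esub>s\<in>{1..n}. tens K H (tensor K H H) (X i t) (tens K H H (X t s) (X s j)))"
      using cl i j by (intro T.M.finsum_swap) (auto simp del: univ_bialg_simps)
    also have "\<dots> = (\<Oplus>\<^bsub>?T\<^esub>t\<in>{1..n}. tensor_map K H (tensor K H H) (\<lambda>x. x) D (tens K H H (X i t) (X t j)))"
    proof (intro T.M.finsum_cong'[OF refl])
      fix t assume t: "t \<in> {1..n}"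
      have "tensor_map K H (tensor K H H) (\<lambda>x. x) D (tens K H H (X i t) (X t j)) = tens K H (tensor K H H) (X i t) (D (X t j))"
        by (rule tensor_map_tens[OF H.module H.module H.module HH.module linear_hom_id Dl univ_gen_closed_bialg[OF i t] univ_gen_closed_bialg[OF t j]])
      also have "\<dots> = (\<Oplus>\<^bsub>?T\<^esub>s\<in>{1..n}. tens K H (tensor K H H) (X i t) (tens K H H (X t s) (X s j)))"
        by (rule hom_comult_X[OF T.module bilin_map_right[OF tens_bilin[OF H.module HH.module] univ_gen_closed_bialg[OF i t]] t j])
      finally show "(\<Oplus>\<^bsub>?T\<^esub>s\<in>{1..n}. tens K H (tensor K H H) (X i t) (tens K H H (X t s) (X s j)))
        = tensor_map K H (tensor K H H) (\<lambda>x. x) D (tens K H H (X i t) (X t j))" by simp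
    qed (use cl i j alg_hom_closed[OF f2] in \<open>auto simp del: univ_bialg_simps\<close>)
    also have "\<dots> = tensor_map K H (tensor K H H) (\<lambda>x. x) D (D (X i j))"
      by (rule hom_comult_X[OF T.module alg_hom_linear[OF f2] i j, symmetric])
    finally show "tensor_assoc K H H H (tensor_map K (tensor K H H) H D (\<lambda>x. x) (D (X i j)))
      = tensor_map K H (tensor K H H) (\<lambda>x. x) D (D (X i j))" .
  qed
qed

text \<open>Again a comparison of algebra maps on generators, where the identity matrix of counit
  values acts as a left unit for the matrix product.\<close>

lemma univ_counit_left:
  assumes "x \<in> carrier H"
  shows "tensor_map K (scalars K) H E (\<lambda>x. x) (D x) = tens K (scalars K) H \<one>\<^bsub>K\<^esub> x"
proof -
  let ?T = "tensor K (scalars K) H"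
  interpret T: algebra K ?T by (rule tensor_algebra[OF S.algebra_axioms univ_bialg_algebra])
  note f1 = tensor_map_alg_hom[OF univ_bialg_algebra univ_bialg_algebra S.algebra_axioms univ_bialg_algebra counit_spec(1) alg_hom_id]
  have one: "\<one>\<^bsub>scalars K\<^esub> = \<one>\<^bsub>K\<^esub>" "\<zero>\<^bsub>scalars K\<^esub> = \<zero>\<^bsub>K\<^esub>" "\<one>\<^bsub>K\<^esub> \<in> carrier (scalars K)" by (simp_all add: scalars_def)
  note f2 = tensor_right_hom[OF S.algebra_axioms univ_bialg_algebra, unfolded one]
  note tc = tens_closed[OF S.module H.module]
  have z: "tens K (scalars K) H \<zero>\<^bsub>K\<^esub> h = \<zero>\<^bsub>?T\<^esub>" if "h \<in> carrier H" for h
    using linear_hom_zero[OF S.module T.module bilin_map_left[OF tens_bilin[OF S.module H.module] that]] by (simp add: one)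
  show ?thesis
  proof (rule univ_bialg_hom_eqI[OF T.algebra_axioms alg_hom_comp[OF comult_spec(1) f1] f2 _ assms])
    fix i j assume i: "i \<in> {1..n}" and j: "j \<in> {1..n}"
    have "tensor_map K (scalars K) H E (\<lambda>x. x) (D (X i j))
      = (\<Oplus>\<^bsub>?T\<^esub>s\<in>{1..n}. tensor_map K (scalars K) H E (\<lambda>x. x) (tens K H H (X i s) (X s j)))"
      by (rule hom_comult_X[OF T.module alg_hom_linear[OF f1] i j])
    \<comment> \<open>\<open>E (X i s)\<close> vanishes unless \<open>s = i\<close>, and a tensor
      with a zero factor is zero, so one summand is left.\<close>
    also have "\<dots> = (\<Oplus>\<^bsub>?T\<^esub>s\<in>{1..n}. if i = s then tens K (scalars K) H \<one>\<^bsub>K\<^esub> (X s j) else \<zero>\<^bsub>?T\<^esub>)"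
      using i j univ_gen_closed_bialg tc one z
      by (intro T.M.finsum_cong'[OF refl])
        (auto simp: tensor_map_tens[OF H.module H.module S.module H.module alg_hom_linear[OF counit_spec(1)] linear_hom_id]
          counit_spec(2) simp del: univ_bialg_simps)
    also have "\<dots> = tens K (scalars K) H \<one>\<^bsub>K\<^esub> (X i j)"
      using i j univ_gen_closed_bialg tc one by (intro T.M.finsum_singleton) (auto simp del: univ_bialg_simps)
    finally show "tensor_map K (scalars K) H E (\<lambda>x. x) (D (X i j)) = tens K (scalars K) H \<one>\<^bsub>K\<^esub> (X i j)" .
  qed
qed

lemma univ_counit_right:
  assumes "x \<in> carrier H"
  shows "tensor_map K H (scalars K) (\<lambda>x. x) E (D x) = tens K H (scalars K) x \<one>\<^bsub>K\<^esub>"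
proof -
  let ?T = "tensor K H (scalars K)"
  interpret T: algebra K ?T by (rule tensor_algebra[OF univ_bialg_algebra S.algebra_axioms])
  note f1 = tensor_map_alg_hom[OF univ_bialg_algebra univ_bialg_algebra univ_bialg_algebra S.algebra_axioms alg_hom_id counit_spec(1)]
  have one: "\<one>\<^bsub>scalars K\<^esub> = \<one>\<^bsub>K\<^esub>" "\<zero>\<^bsub>scalars K\<^esub> = \<zero>\<^bsub>K\<^esub>" "\<one>\<^bsub>K\<^esub> \<in> carrier (scalars K)" by (simp_all add: scalars_def)
  note f2 = tensor_left_hom[OF univ_bialg_algebra S.algebra_axioms, unfolded one]
  note tc = tens_closed[OF H.module S.module]
  have z: "tens K H (scalars K) h \<zero>\<^bsub>K\<^esub> = \<zero>\<^bsub>?T\<^esub>" if "h \<in> carrier H" for h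
    using linear_hom_zero[OF S.module T.module bilin_map_right[OF tens_bilin[OF H.module S.module] that]] by (simp add: one)
  show ?thesis
  proof (rule univ_bialg_hom_eqI[OF T.algebra_axioms alg_hom_comp[OF comult_spec(1) f1] f2 _ assms])
    fix i j assume i: "i \<in> {1..n}" and j: "j \<in> {1..n}"
    have "tensor_map K H (scalars K) (\<lambda>x. x) E (D (X i j))
      = (\<Oplus>\<^bsub>?T\<^esub>s\<in>{1..n}. tensor_map K H (scalars K) (\<lambda>x. x) E (tens K H H (X i s) (X s j)))"
      by (rule hom_comult_X[OF T.module alg_hom_linear[OF f1] i j])
    also have "\<dots> = (\<Oplus>\<^bsub>?T\<^esub>s\<in>{1..n}. if j = s then tens K H (scalars K) (X i s) \<one>\<^bsub>K\<^esub> else \<zero>\<^bsub>?T\<^esub>)"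
      using i j univ_gen_closed_bialg tc one z
      by (intro T.M.finsum_cong'[OF refl])
        (auto simp: tensor_map_tens[OF H.module H.module H.module S.module linear_hom_id alg_hom_linear[OF counit_spec(1)]]
          counit_spec(2) simp del: univ_bialg_simps)
    also have "\<dots> = tens K H (scalars K) (X i j) \<one>\<^bsub>K\<^esub>"
      using i j univ_gen_closed_bialg tc one by (intro T.M.finsum_singleton) (auto simp del: univ_bialg_simps)
    finally show "tensor_map K H (scalars K) (\<lambda>x. x) E (D (X i j)) = tens K H (scalars K) (X i j) \<one>\<^bsub>K\<^esub>" .
  qed
qed

lemma univ_bialg_comm_bialgebra: "comm_bialgebra K H"
  using comult_spec(1) counit_spec(1) univ_coassoc univ_counit_left univ_counit_right
  by (intro comm_bialgebra.intro univ_bialg_algebra comm_bialgebra_axioms.intro) (simp_all only: univ_bialg_simps(7,8))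

subsection \<open>The universal coaction\<close>

abbreviation (input) "\<eta> \<equiv> univ_coaction K P n e"

interpretation PH: module K "tensor K P H" by (rule tensor_module[OF P_module H.module])

lemma eta_eq: "\<eta> = (\<lambda>v. lin_comb (tensor K P H) n
    (\<lambda>i. \<Oplus>\<^bsub>tensor K P H\<^esub>s\<in>{1..n}. tens K P H (e s) (X s i)) (coords K P n e v))"
  by (intro ext) (simp add: univ_coaction_def Let_def univ_bialg_tensor)

lemma eta_sum_closed: "i \<in> {1..n} \<Longrightarrow> (\<Oplus>\<^bsub>tensor K P H\<^esub>s\<in>{1..n}. tens K P H (e s) (X s i)) \<in> carrier (tensor K P H)"
  using tens_closed[OF P_module H.module] univ_gen_closed_bialg e_closed by (auto intro!: PH.M.finsum_closed simp del: univ_bialg_simps)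

lemma univ_coaction_linear: "\<eta> \<in> linear_hom K P (tensor K P H)"
  unfolding eta_eq by (rule basis_ext_linear[OF P_module basis PH.module_axioms eta_sum_closed])

lemma univ_coaction_basis: "i \<in> {1..n} \<Longrightarrow> \<eta> (e i) = (\<Oplus>\<^bsub>tensor K P H\<^esub>s\<in>{1..n}. tens K P H (e s) (X s i))"
  unfolding eta_eq by (rule basis_ext_basis[OF P_module basis PH.module_axioms eta_sum_closed])

lemmas univ_coaction_matrix = P_module basis univ_bialg_algebra univ_coaction_linear univ_gen_closed_bialg univ_coaction_basis

lemma poisson_tensor_simps:
  "linear_hom K P (poisson_tensor K P B) = linear_hom K P (tensor K P B)"
  "monoid.mult (poisson_tensor K P B) = tens_op K P B (monoid.mult P) (monoid.mult B)"
  "lie (poisson_tensor K P B) = tens_op K P B (lie P) (monoid.mult B)"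
  by (simp_all add: poisson_tensor_def linear_hom_def module.defs poisson.defs tensor_simps)

lemma coact_poisson_iff:
  assumes B: "algebra K B" and rho: "\<rho> \<in> linear_hom K P (tensor K P B)"
    and h: "\<And>s i. \<lbrakk>s \<in> {1..n}; i \<in> {1..n}\<rbrakk> \<Longrightarrow> h s i \<in> carrier B"
    and rho_e: "\<And>i. i \<in> {1..n} \<Longrightarrow> \<rho> (e i) = (\<Oplus>\<^bsub>tensor K P B\<^esub>s\<in>{1..n}. tens K P B (e s) (h s i))"
  shows "\<rho> \<in> poisson_hom K P (poisson_tensor K P B) \<longleftrightarrow>
    (\<forall>b. b = monoid.mult P \<or> b = lie P \<longrightarrow> struct_rel K {1..n} (\<lambda>i j u. sc b i j u) B h)"
  using coaction_multiplicative_iff[OF P_module basis B rho h rho_e mult_bilin]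
    coaction_multiplicative_iff[OF P_module basis B rho h rho_e lie_bilin] rho
  unfolding poisson_hom_def poisson_tensor_simps by blast

text \<open>The three matrix criteria are applied with the generic matrix. Their right sides are
  then the defining relations and the prescribed values of comultiplication and counit.\<close>

lemma univ_coaction_coact_obj: "coact_obj K P H \<eta>"
  unfolding coact_obj_def right_comodule_def
proof (intro conjI univ_bialg_comm_bialgebra univ_coaction_linear)
  show "\<eta> \<in> poisson_hom K P (poisson_tensor K P H)"
    using coact_poisson_iff[OF univ_bialg_algebra univ_coaction_linear univ_gen_closed_bialg univ_coaction_basis] univ_gen_rel_bialg by blast
  have "\<forall>v\<in>carrier P. tensor_assoc K P H H (tensor_map K (tensor K P H) H \<eta> (\<lambda>x. x) (\<eta> v)) =
      tensor_map K P (tensor K H H) (\<lambda>x. x) D (\<eta> v)"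
    using coaction_coassoc_iff[OF univ_coaction_matrix alg_hom_linear[OF comult_spec(1)]] comult_spec(3) by blast
  moreover have "\<forall>v\<in>carrier P. tensor_map K P (scalars K) (\<lambda>x. x) E (\<eta> v) = tens K P (scalars K) v \<one>\<^bsub>K\<^esub>"
    using coaction_counit_iff[OF univ_coaction_matrix alg_hom_linear[OF counit_spec(1)]] counit_spec(2) by blast
  ultimately show "\<forall>v\<in>carrier P.
    tensor_assoc K P H H (tensor_map K (tensor K P H) H \<eta> (\<lambda>x. x) (\<eta> v)) =
      tensor_map K P (tensor K H H) (\<lambda>x. x) (comult H) (\<eta> v) \<and>
    tensor_map K P (scalars K) (\<lambda>x. x) (counit H) (\<eta> v) = tens K P (scalars K) v \<one>\<^bsub>K\<^esub>"
    unfolding univ_bialg_simps(7,8) by blast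
qed

text \<open>The same matrix criteria, now applied to the given coaction, turn each of its axioms
  into the corresponding statement about the images of the generators. The remaining conditions on
  \<open>f\<close> compare algebra maps out of H, or linear maps out of P, and are checked on
  generators or on the basis.\<close>

lemma univ_bialg_initial:
  assumes obj: "coact_obj K P B \<rho>"
  shows "\<exists>!f. f \<in> coact_hom K P H \<eta> B \<rho>"
proof -
  interpret B: comm_bialgebra K B using obj by (simp add: coact_obj_def)
  interpret BB: algebra K "tensor K B B" by (rule tensor_algebra[OF B.algebra_axioms B.algebra_axioms])
  interpret PB: module K "tensor K P B" by (rule tensor_module[OF P_module B.module])
  have rho: "\<rho> \<in> linear_hom K P (tensor K P B)" using obj by (simp add: coact_obj_def right_comodule_def)
  note rc = linear_hom_closed[OF rho]
  \<comment> \<open>The coefficients of \<open>\<rho> (e i)\<close> on the basis;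
    \<open>tensor_coord_repr\<close> shows that they recover the coaction.\<close>
  define h where "h s i = tensor_coord K P n e B s (\<rho> (e i))" for s i
  have h: "h s i \<in> carrier B" if "s \<in> {1..n}" "i \<in> {1..n}" for s i
    unfolding h_def by (rule tensor_coord_closed[OF P_module basis B.module that(1) rc[OF e_closed[OF that(2)]]])
  have rho_e: "\<rho> (e i) = (\<Oplus>\<^bsub>tensor K P B\<^esub>s\<in>{1..n}. tens K P B (e s) (h s i))" if "i \<in> {1..n}" for i
    unfolding h_def by (rule tensor_coord_repr[OF P_module basis B.module rc[OF e_closed[OF that]], symmetric])
  note mat = P_module basis B.algebra_axioms rho h rho_e
  have rel: "struct_rel K {1..n} (\<lambda>i j u. sc b i j u) B h" if "b = monoid.mult P \<or> b = lie P" for b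
    using coact_poisson_iff[OF B.algebra_axioms rho h rho_e] obj that unfolding coact_obj_def by blast
  note Bc = B.comult_hom and Be = B.counit_hom
  have co: "comult B (h t i) = (\<Oplus>\<^bsub>tensor K B B\<^esub>s\<in>{1..n}. tens K B B (h t s) (h s i))" if "t \<in> {1..n}" "i \<in> {1..n}" for t i
    using coaction_coassoc_iff[OF mat alg_hom_linear[OF Bc]] obj that unfolding coact_obj_def right_comodule_def by blast
  have cu: "counit B (h t i) = (if t = i then \<one>\<^bsub>K\<^esub> else \<zero>\<^bsub>K\<^esub>)" if "t \<in> {1..n}" "i \<in> {1..n}" for t i
    using coaction_counit_iff[OF mat alg_hom_linear[OF Be]] obj that unfolding coact_obj_def right_comodule_def by blast
  obtain f where f: "f \<in> alg_hom K H B" "f \<in> extensional (carrier H)"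
    and fX: "\<And>s i. \<lbrakk>s \<in> {1..n}; i \<in> {1..n}\<rbrakk> \<Longrightarrow> f (X s i) = h s i"
    using univ_hom_exists[OF B.algebra_axioms h rel] unfolding univ_bialg_alg_hom[symmetric] univ_bialg_simps(1)[symmetric] by blast
  note ff = tensor_map_alg_hom[OF univ_bialg_algebra univ_bialg_algebra B.algebra_axioms B.algebra_axioms f(1) f(1)]
  have "comult B (f x) = tensor_map K B B f f (D x)" if "x \<in> carrier H" for x
  proof (rule univ_bialg_hom_eqI[OF BB.algebra_axioms alg_hom_comp[OF f(1) Bc] alg_hom_comp[OF comult_spec(1) ff] _ that])
    fix i j assume i: "i \<in> {1..n}" and j: "j \<in> {1..n}"
    have "tensor_map K B B f f (D (X i j)) = (\<Oplus>\<^bsub>tensor K B B\<^esub>s\<in>{1..n}. tensor_map K B B f f (tens K H H (X i s) (X s j)))"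
      by (rule hom_comult_X[OF BB.module alg_hom_linear[OF ff] i j])
    also have "\<dots> = (\<Oplus>\<^bsub>tensor K B B\<^esub>s\<in>{1..n}. tens K B B (h i s) (h s j))"
      using i j h univ_gen_closed_bialg fX tens_closed[OF B.module B.module]
      by (intro BB.M.finsum_cong'[OF refl])
        (auto simp: tensor_map_tens[OF H.module H.module B.module B.module alg_hom_linear[OF f(1)] alg_hom_linear[OF f(1)]]
          simp del: univ_bialg_simps)
    finally show "comult B (f (X i j)) = tensor_map K B B f f (D (X i j))" using co i j fX by simp
  qed
  moreover have "counit B (f x) = E x" if "x \<in> carrier H" for x
    by (rule univ_bialg_hom_eqI[OF S.algebra_axioms alg_hom_comp[OF f(1) Be] counit_spec(1) _ that])
      (simp add: fX cu counit_spec(2))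
  \<comment> \<open>Stated for every algebra map \<open>g\<close>: it verifies the coaction
    condition for \<open>f\<close> and later determines an arbitrary competing morphism on the
    generators.\<close>
  moreover have eta_f: "tensor_map K P B (\<lambda>x. x) g (\<eta> (e i)) = (\<Oplus>\<^bsub>tensor K P B\<^esub>t\<in>{1..n}. tens K P B (e t) (g (X t i)))"
    if "g \<in> alg_hom K H B" "i \<in> {1..n}" for g i
    by (rule coaction_map[OF univ_coaction_matrix B.module alg_hom_linear[OF that(1)] that(2)])
  have "tensor_map K P B (\<lambda>x. x) f (\<eta> v) = \<rho> v" if "v \<in> carrier P" for v
  proof (rule basis_hom_eqI[OF P_module basis PB.module_axioms linear_hom_comp[OF univ_coaction_linear
        tensor_map_linear[OF P_module H.module P_module B.module linear_hom_id alg_hom_linear[OF f(1)]]] rho _ that])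
    fix i assume i: "i \<in> {1..n}"
    show "tensor_map K P B (\<lambda>x. x) f (\<eta> (e i)) = \<rho> (e i)"
      unfolding eta_f[OF f(1) i] rho_e[OF i] using fX h i e_closed tens_closed[OF P_module B.module]
      by (intro PB.M.finsum_cong'[OF refl]) auto
  qed
  ultimately have fc: "f \<in> coact_hom K P H \<eta> B \<rho>"
    using f unfolding coact_hom_def univ_bialg_simps(7,8) by blast
  show ?thesis
  proof (rule ex1I[of _ f])
    show "f \<in> coact_hom K P H \<eta> B \<rho>" by (rule fc)
  next
    fix g assume g: "g \<in> coact_hom K P H \<eta> B \<rho>"
    then have gH: "g \<in> alg_hom K H B" "g \<in> extensional (carrier H)"
      and gr: "\<And>v. v \<in> carrier P \<Longrightarrow> tensor_map K P B (\<lambda>x. x) g (\<eta> v) = \<rho> v"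
      unfolding coact_hom_def by blast+
    have "g (X s i) = f (X s i)" if s: "s \<in> {1..n}" and i: "i \<in> {1..n}" for s i
    proof -
      have "(\<Oplus>\<^bsub>tensor K P B\<^esub>t\<in>{1..n}. tens K P B (e t) (g (X t i))) = (\<Oplus>\<^bsub>tensor K P B\<^esub>t\<in>{1..n}. tens K P B (e t) (h t i))"
        using gr[OF e_closed[OF i]] unfolding eta_f[OF gH(1) i] rho_e[OF i] .
      then have "g (X s i) = h s i"
        using alg_hom_closed[OF gH(1) univ_gen_closed_bialg] h i by (intro tensor_coords_unique[OF P_module basis B.module _ _ _ s, where p = "\<lambda>t. g (X t i)"])
      then show ?thesis using fX s i by simp
    qed
    then show "g = f"
      using univ_hom_unique[OF B.algebra_axioms] gH f unfolding univ_bialg_alg_hom univ_bialg_simps(1) by blast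
  qed
qed

end

theorem theorem3p3:
  fixes K :: "'k ring"
    and P :: "('k, 'p) poisson"
    and n :: nat and e :: "nat \<Rightarrow> 'p"
  assumes "field K"
    and "poisson_algebra K P"
    and "is_basis K P n e"
  shows "coact_obj K P (univ_bialg K P n e) (univ_coaction K P n e) \<and>
    (\<forall>(H :: ('k, 'h) bialg) \<rho>. coact_obj K P H \<rho> \<longrightarrow>
      (\<exists>!f. f \<in> coact_hom K P (univ_bialg K P n e) (univ_coaction K P n e) H \<rho>))"
proof -
  interpret based_poisson_algebra K P n e
    using assms(2,3) by (intro based_poisson_algebra.intro based_poisson_algebra_axioms.intro)
  show ?thesis using univ_coaction_coact_obj univ_bialg_initial by blast
qed

end
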